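(* The capacity region of the injective deterministic state-dependent Z-interference channel with state known noncausally at encoder 1 only (defined in the context) is the set of rate pairs $(R_1,R_2)$ that satisfy $$\begin{aligned} R_1 & \leq H(Y_1|S,Q),\\ R_2 & \leq H(Y_2|T_1,Q),\\ R_2 & \leq H(Y_2|Q) - I(T_1;S|Q),\\ R_1 + R_2 & \leq H(Y_1|T_1,S,Q)+H(Y_2|Q)-I(T_1;S|Q), \end{aligned}$$ for some pmf $p(q)\,p(x_1|s,q)\,p(x_2|q)$, where $|\mathcal{Q}|\leq 4$ and the quantities are evaluated under the joint pmf $p(s)p(q)p(x_1|s,q)p(x_2|q)$ with $T_1=t_1(X_1,S)$, $Y_1=y_1(X_1,S)$, $Y_2=y_2(X_2,T_1)$.
   Context: Channel: finite alphabets; the state $S^n$ is i.i.d. according to $p(s)$, independent of the messages, and known noncausally at encoder 1 only. Receiver 1 observes $Y_1=y_1(X_1,S)$, a deterministic function of the input $X_1$ and the state. The interference is $T_1=t_1(X_1,S)$, a deterministic function, and receiver 2 observes $Y_2=y_2(X_2,T_1)$, a deterministic function. Injectivity: for each fixed $x_2$, $t_1\mapsto y_2(x_2,t_1)$ is injective, i.e. there is a function $g$ with $t_1=g(y_2,x_2)$. All functions act letter by letter over $n$ channel uses. Codes: $[1:2^{nR}]$ denotes $\{1,\dots,\lceil 2^{nR}\rceil\}$. The messages $M_1,M_2$ are independent, uniform on $[1:2^{nR_1}]$ and $[1:2^{nR_2}]$; sender $j$ communicates $M_j$ to receiver $j$. An $(n,2^{nR_1},2^{nR_2},\epsilon)$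 code consists of encoding functions $f_{1,i}:[1:2^{nR_1}]\times\mathcal{S}^n\to\mathcal{X}_1$ and $f_{2,i}:[1:2^{nR_2}]\to\mathcal{X}_2$, $1\le i\le n$, and decoding functions $g_j:\mathcal{Y}_j^n\to[1:2^{nR_j}]$, with $\Pr\{g_j(Y_j^n)\ne M_j\}\le\epsilon$ for $j\in\{1,2\}$. A pair $(R_1,R_2)$ of nonnegative reals is achievable if for every $\epsilon>0$ there exists such a code for all sufficiently large $n$. The capacity region is the closure of the set of achievable rate pairs. *)

theory Defs
  imports "HOL-Probability.Probability"
begin

definition msgs :: "nat \<Rightarrow> real \<Rightarrow> nat set" where
  "msgs n R = {1..nat \<lceil>2 powr (real n * R)\<rceil>}"

(* The letters sent during channel uses 1..n. Here f i m s is the i-th encoding function applied to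
   the message m and the whole state sequence s; f i m is the i-th encoding function at a sender
   that does not know the state. *)

definition word1 :: "nat \<Rightarrow> (nat \<Rightarrow> nat \<Rightarrow> 's list \<Rightarrow> 'x1) \<Rightarrow> nat \<Rightarrow> 's list \<Rightarrow> 'x1 list" where
  "word1 n f m s = map (\<lambda>i. f i m s) [1..<Suc n]"

definition word2 :: "nat \<Rightarrow> (nat \<Rightarrow> nat \<Rightarrow> 'x2) \<Rightarrow> nat \<Rightarrow> 'x2 list" where
  "word2 n f m = map (\<lambda>i. f i m) [1..<Suc n]"

definition source_pmf :: "'s pmf \<Rightarrow> nat \<Rightarrow> real \<Rightarrow> real \<Rightarrow> (nat \<times> nat \<times> 's list) pmf" where
  "source_pmf pS n R1 R2 =
     pair_pmf (pmf_of_set (msgs n R1)) (pair_pmf (pmf_of_set (msgs n R2)) (replicate_pmf n pS))"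

definition is_code ::
  "'s pmf \<Rightarrow> ('x1 \<Rightarrow> 's \<Rightarrow> 'y1) \<Rightarrow> ('x1 \<Rightarrow> 's \<Rightarrow> 't1) \<Rightarrow> ('x2 \<Rightarrow> 't1 \<Rightarrow> 'y2) \<Rightarrow>
   nat \<Rightarrow> real \<Rightarrow> real \<Rightarrow> real \<Rightarrow>
   (nat \<Rightarrow> nat \<Rightarrow> 's list \<Rightarrow> 'x1) \<Rightarrow> (nat \<Rightarrow> nat \<Rightarrow> 'x2) \<Rightarrow>
   ('y1 list \<Rightarrow> nat) \<Rightarrow> ('y2 list \<Rightarrow> nat) \<Rightarrow> bool" where
  "is_code pS y1 t1 y2 n R1 R2 \<epsilon> f1 f2 g1 g2 \<longleftrightarrow>
     (\<forall>ys. length ys = n \<longrightarrow> g1 ys \<in> msgs n R1) \<and>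
     (\<forall>ys. length ys = n \<longrightarrow> g2 ys \<in> msgs n R2) \<and>
     measure_pmf.prob (source_pmf pS n R1 R2)
       {(m1, m2, s). g1 (map2 y1 (word1 n f1 m1 s) s) \<noteq> m1} \<le> \<epsilon> \<and>
     measure_pmf.prob (source_pmf pS n R1 R2)
       {(m1, m2, s). g2 (map2 y2 (word2 n f2 m2) (map2 t1 (word1 n f1 m1 s) s)) \<noteq> m2} \<le> \<epsilon>"

definition achievable ::
  "'s pmf \<Rightarrow> ('x1 \<Rightarrow> 's \<Rightarrow> 'y1) \<Rightarrow> ('x1 \<Rightarrow> 's \<Rightarrow> 't1) \<Rightarrow> ('x2 \<Rightarrow> 't1 \<Rightarrow> 'y2) \<Rightarrow>
   real \<times> real \<Rightarrow> bool" where
  "achievable pS y1 t1 y2 = (\<lambda>(R1, R2). 0 \<le> R1 \<and> 0 \<le> R2 \<and>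
     (\<forall>\<epsilon>>0. \<forall>\<^sub>F n in sequentially. \<exists>f1 f2 g1 g2. is_code pS y1 t1 y2 n R1 R2 \<epsilon> f1 f2 g1 g2))"

definition capacity_region ::
  "'s pmf \<Rightarrow> ('x1 \<Rightarrow> 's \<Rightarrow> 'y1) \<Rightarrow> ('x1 \<Rightarrow> 's \<Rightarrow> 't1) \<Rightarrow> ('x2 \<Rightarrow> 't1 \<Rightarrow> 'y2) \<Rightarrow>
   (real \<times> real) set" where
  "capacity_region pS y1 t1 y2 = closure {R. achievable pS y1 t1 y2 R}"

(* The library's conditional entropy and conditional mutual information, in bits, with every
   variable ranging over the counting space on its image. *)

definition cond_entropy :: "'w pmf \<Rightarrow> ('w \<Rightarrow> 'a) \<Rightarrow> ('w \<Rightarrow> 'b) \<Rightarrow> real" where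
  "cond_entropy P X Z =
     prob_space.conditional_entropy (measure_pmf P) 2
       (count_space (range X)) (count_space (range Z)) X Z"

definition cond_mutual_info ::
  "'w pmf \<Rightarrow> ('w \<Rightarrow> 'a) \<Rightarrow> ('w \<Rightarrow> 'b) \<Rightarrow> ('w \<Rightarrow> 'c) \<Rightarrow> real" where
  "cond_mutual_info P X Y Z =
     prob_space.conditional_mutual_information (measure_pmf P) 2
       (count_space (range X)) (count_space (range Y)) (count_space (range Z)) X Y Z"

(* The joint pmf p(s) p(q) p(x1|s,q) p(x2|q) of (S, Q, X1, X2). *)
definition joint_pmf ::
  "'s pmf \<Rightarrow> 'q pmf \<Rightarrow> ('s \<Rightarrow> 'q \<Rightarrow> 'x1 pmf) \<Rightarrow> ('q \<Rightarrow> 'x2 pmf) \<Rightarrow> ('s \<times> 'q \<times> 'x1 \<times> 'x2) pmf" where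
  "joint_pmf pS pQ pX1 pX2 =
     do {s \<leftarrow> pS; q \<leftarrow> pQ; x1 \<leftarrow> pX1 s q; x2 \<leftarrow> pX2 q; return_pmf (s, q, x1, x2)}"

(* The alphabet of Q is the four-element type 4. As pQ need not have full support, this covers
   every alphabet with at most four elements. *)
definition rate_region ::
  "'s pmf \<Rightarrow> ('x1 \<Rightarrow> 's \<Rightarrow> 'y1) \<Rightarrow> ('x1 \<Rightarrow> 's \<Rightarrow> 't1) \<Rightarrow> ('x2 \<Rightarrow> 't1 \<Rightarrow> 'y2) \<Rightarrow>
   (real \<times> real) set" where
  "rate_region pS y1 t1 y2 = {(R1, R2). 0 \<le> R1 \<and> 0 \<le> R2 \<and>
     (\<exists>(pQ :: 4 pmf) pX1 pX2.
        let P = joint_pmf pS pQ pX1 pX2;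
            S = (\<lambda>(s, q, x1, x2). s);
            Q = (\<lambda>(s, q, x1, x2). q);
            T1 = (\<lambda>(s, q, x1, x2). t1 x1 s);
            Y1 = (\<lambda>(s, q, x1, x2). y1 x1 s);
            Y2 = (\<lambda>(s, q, x1, x2). y2 x2 (t1 x1 s))
        in R1 \<le> cond_entropy P Y1 (\<lambda>w. (S w, Q w)) \<and>
           R2 \<le> cond_entropy P Y2 (\<lambda>w. (T1 w, Q w)) \<and>
           R2 \<le> cond_entropy P Y2 Q - cond_mutual_info P T1 S Q \<and>
           R1 + R2 \<le> cond_entropy P Y1 (\<lambda>w. (T1 w, S w, Q w))
                      + cond_entropy P Y2 Q - cond_mutual_info P T1 S Q)}"

end

theory Submission
  imports Defs
begin

text \<open>
  Converse: Fano's inequality and the chain rule, with the time index as time-sharing variable. By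
  injectivity \<open>H(Y\<^sub>2\<^sup>n | M\<^sub>2) = H(T\<^sub>1\<^sup>n)\<close>, which turns \<open>I(M\<^sub>2; Y\<^sub>2\<^sup>n)\<close> into
  \<open>H(Y\<^sub>2\<^sup>n) - H(T\<^sub>1\<^sup>n)\<close>. For a fixed input distribution the four bounds form a vector in a compact set,
  and the rate region consists of the pairs dominated by a point of its convex hull. Such a point can
  be pushed along \<open>(1, 1, 1, 1)\<close> to the frontier of the hull, where a supporting hyperplane lowers
  Caratheodory's bound from five points to four; compactness also makes the region closed.

  Achievability: fix a typical time-sharing word, draw a codebook of \<open>T\<^sub>1\<close>-words, colour the \<open>Y\<^sub>1\<close>-words
  at random with the messages \<open>m\<^sub>1\<close>, and let receiver 1 read off the colour. If the index of the
  \<open>T\<^sub>1\<close>-word were uniform and independent of the codebook, a union bound would control receiver 2. Soft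
  covering shows that the state and the colour obtained in this idealised way are almost
  distributed as required, so the encoder can sample from the idealised conditional distribution.
\<close>

section \<open>Entropy of finitely supported pmfs\<close>

text \<open>The rate r of the \<open>T\<^sub>1\<close>-codebook is a free parameter. Soft covering
  asks for R1 < H(Y1|S,Q), r > I(T1;S|Q) and R1 < r - I(T1;S|Q) + H(Y1|T1,S,Q); packing asks for R2
  < H(Y2|T1,Q) and R2 + r < H(Y2|Q). Eliminating r leaves exactly the four bounds. Y1 and T1 are
  functions of X1 and S, so an encoder that knows the state can prescribe the Y1-word and the
  T1-word exactly. The obstacle is receiver 2: the T1-word actually sent depends on the state, on
  the message and on the whole codebook, so its collisions cannot be averaged directly. This forces
  the detour through an idealised law. Zero rates need care: the right-hand side may be 0 as well,
  and then no strict inequality is available. Variances and union bounds therefore keep the exact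
  factors M - 1 and N - 1, which vanish for a single message.\<close>

abbreviation expect :: "'a pmf \<Rightarrow> ('a \<Rightarrow> real) \<Rightarrow> real" where
  "expect P f \<equiv> measure_pmf.expectation P f"

abbreviation pr :: "'a pmf \<Rightarrow> 'a set \<Rightarrow> real" where
  "pr P A \<equiv> measure (measure_pmf P) A"

lemma expect_eq_sum:
  "finite (set_pmf P) \<Longrightarrow> expect P f = (\<Sum>w\<in>set_pmf P. pmf P w * f w)"
  by (subst integral_measure_pmf_real[where A="set_pmf P"]) (auto simp: mult.commute)

lemma expect_add:
  "finite (set_pmf P) \<Longrightarrow> expect P (\<lambda>w. f w + g w) = expect P f + expect P g"
  by (simp add: integrable_measure_pmf_finite)

lemma expect_diff:
  "finite (set_pmf P) \<Longrightarrow> expect P (\<lambda>w. f w - g w) = expect P f - expect P g"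
  by (simp add: integrable_measure_pmf_finite)

lemma expect_mono:
  assumes "finite (set_pmf P)" "\<And>w. w \<in> set_pmf P \<Longrightarrow> f w \<le> g w"
  shows "expect P f \<le> expect P g"
  by (intro integral_mono_AE) (auto simp: AE_measure_pmf_iff integrable_measure_pmf_finite assms)

lemma expect_cong:
  assumes "\<And>w. w \<in> set_pmf P \<Longrightarrow> f w = g w"
  shows "expect P f = expect P g"
  by (intro integral_cong_AE) (auto simp: AE_measure_pmf_iff assms)

lemma expect_bind:
  assumes "finite (set_pmf P)" "\<And>x. x \<in> set_pmf P \<Longrightarrow> finite (set_pmf (K x))"
  shows "expect (bind_pmf P K) f = expect P (\<lambda>x. expect (K x) f)"
proof -
  let ?A = "\<Union>x\<in>set_pmf P. set_pmf (K x)"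
  have fin: "finite ?A" using assms by auto
  have "expect (bind_pmf P K) f = (\<Sum>w\<in>?A. f w * pmf (bind_pmf P K) w)"
    by (rule integral_measure_pmf_real) (use fin in auto)
  also have "\<dots> = (\<Sum>w\<in>?A. f w * (\<Sum>x\<in>set_pmf P. pmf P x * pmf (K x) w))"
    by (simp add: pmf_bind expect_eq_sum assms)
  also have "\<dots> = (\<Sum>x\<in>set_pmf P. pmf P x * (\<Sum>w\<in>?A. f w * pmf (K x) w))"
    unfolding sum_distrib_left by (subst sum.swap) (simp add: mult_ac)
  also have "\<dots> = (\<Sum>x\<in>set_pmf P. pmf P x * expect (K x) f)"
    by (intro sum.cong refl, subst integral_measure_pmf_real[where A = ?A]) (use fin in auto)
  also have "\<dots> = expect P (\<lambda>x. expect (K x) f)" by (simp add: expect_eq_sum assms)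
  finally show ?thesis .
qed

lemma expect_pair:
  assumes "finite (set_pmf P)" "finite (set_pmf R)"
  shows "expect (pair_pmf P R) f = expect P (\<lambda>x. expect R (\<lambda>y. f (x, y)))"
  unfolding pair_pmf_def using assms by (simp add: expect_bind)

lemma pmf_map_pos: "w \<in> set_pmf P \<Longrightarrow> 0 < pmf (map_pmf X P) (X w)"
  by (simp add: pmf_positive_iff)

lemma pmf_map_comp_le: "pmf (map_pmf X P) (X w) \<le> pmf (map_pmf (\<lambda>w. f (X w)) P) (f (X w))"
  by (auto simp: pmf_map intro!: measure_pmf.finite_measure_mono)

lemma pmf_map_eq_sum_image:
  assumes "finite (set_pmf P)"
  shows "pmf (map_pmf (\<lambda>w. f (X w)) P) c = (\<Sum>x\<in>{x \<in> X ` set_pmf P. f x = c}. pmf (map_pmf X P) x)"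
proof -
  have "pmf (map_pmf (\<lambda>w. f (X w)) P) c = measure (measure_pmf (map_pmf X P)) (f -` {c})"
    by (simp add: pmf_map vimage_def)
  also have "\<dots> = measure (measure_pmf (map_pmf X P)) {x \<in> X ` set_pmf P. f x = c}"
    by (rule measure_pmf.finite_measure_eq_AE) (auto simp: AE_measure_pmf_iff)
  also have "\<dots> = (\<Sum>x\<in>{x \<in> X ` set_pmf P. f x = c}. pmf (map_pmf X P) x)"
    by (rule measure_measure_pmf_finite) (use assms in auto)
  finally show ?thesis .
qed

text \<open>Mean surprisal instead of a sum over an alphabet: finite support suffices, so values may
  be naturals or lists, and identities between entropies reduce to linearity of expectation.\<close>

definition ent :: "'w pmf \<Rightarrow> ('w \<Rightarrow> 'a) \<Rightarrow> real" where
  "ent P X = expect P (\<lambda>w. - log 2 (pmf (map_pmf X P) (X w)))"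

definition cent :: "'w pmf \<Rightarrow> ('w \<Rightarrow> 'a) \<Rightarrow> ('w \<Rightarrow> 'b) \<Rightarrow> real" where
  "cent P X Z = ent P (\<lambda>w. (X w, Z w)) - ent P Z"

lemma ent_map: "ent (map_pmf f P) X = ent P (\<lambda>w. X (f w))"
  unfolding ent_def by (simp add: pmf.map_comp o_def)

lemma ent_cong_distr:
  assumes "map_pmf X P = map_pmf Y R"
  shows "ent P X = ent R Y"
proof -
  have "ent P X = ent (map_pmf X P) (\<lambda>x. x)" "ent R Y = ent (map_pmf Y R) (\<lambda>x. x)"
    by (simp_all add: ent_map)
  then show ?thesis using assms by simp
qed

lemma ent_cong: "(\<And>w. w \<in> set_pmf P \<Longrightarrow> X w = Y w) \<Longrightarrow> ent P X = ent P Y"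
  by (intro ent_cong_distr map_pmf_cong) auto

text \<open>Gibbs' inequality, from ln x <= x - 1. The weights q may be subnormalised and need only
  be positive on the support; submodularity and Fano's inequality are both obtained by a suitable
  choice of q.\<close>

lemma ent_le_cross_entropy:
  assumes fin: "finite (set_pmf P)"
    and pos: "\<And>w. w \<in> set_pmf P \<Longrightarrow> 0 < q (X w)"
    and le1: "(\<Sum>x\<in>X ` set_pmf P. q x) \<le> 1"
  shows "ent P X \<le> expect P (\<lambda>w. - log 2 (q (X w)))"
proof -
  let ?p = "\<lambda>w. pmf (map_pmf X P) (X w)"
  have "ent P X - expect P (\<lambda>w. - log 2 (q (X w))) = expect P (\<lambda>w. log 2 (q (X w)) - log 2 (?p w))"
    unfolding ent_def using fin by (simp add: expect_diff)
  also have "\<dots> \<le> expect P (\<lambda>w. (q (X w) / ?p w - 1) / ln 2)"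
  proof (rule expect_mono[OF fin])
    fix w assume w: "w \<in> set_pmf P"
    have "log 2 (q (X w)) - log 2 (?p w) = ln (q (X w) / ?p w) / ln 2"
      using pos[OF w] pmf_map_pos[OF w, of X]
      by (simp add: log_def ln_div diff_divide_distrib)
    also have "\<dots> \<le> (q (X w) / ?p w - 1) / ln 2"
      using pos[OF w] pmf_map_pos[OF w, of X]
      by (intro divide_right_mono ln_le_minus_one) auto
    finally show "log 2 (q (X w)) - log 2 (?p w) \<le> (q (X w) / ?p w - 1) / ln 2" .
  qed
  also have "\<dots> = (expect P (\<lambda>w. q (X w) / ?p w) - 1) / ln 2"
    using fin by (simp add: expect_diff)
  also have "expect P (\<lambda>w. q (X w) / ?p w) = expect (map_pmf X P) (\<lambda>x. q x / pmf (map_pmf X P) x)"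
    by simp
  also have "\<dots> = (\<Sum>x\<in>X ` set_pmf P. q x)"
    using fin by (subst expect_eq_sum) (auto intro!: sum.cong simp: set_pmf_iff[of _ "map_pmf X P", symmetric])
  also have "((\<Sum>x\<in>X ` set_pmf P. q x) - 1) / ln 2 \<le> 0"
    using le1 by (simp add: divide_le_0_iff)
  finally show ?thesis by simp
qed

lemma ent_comp_le:
  assumes fin: "finite (set_pmf P)"
  shows "ent P (\<lambda>w. f (X w)) \<le> ent P X"
  unfolding ent_def
proof (rule expect_mono[OF fin])
  fix w assume w: "w \<in> set_pmf P"
  show "- log 2 (pmf (map_pmf (\<lambda>w. f (X w)) P) (f (X w))) \<le> - log 2 (pmf (map_pmf X P) (X w))"
    using pmf_map_comp_le[of X P w f] pmf_map_pos[OF w, of X] by simp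
qed

lemma ent_le_of_function:
  assumes fin: "finite (set_pmf P)" and "\<And>w. w \<in> set_pmf P \<Longrightarrow> X w = f (Y w)"
  shows "ent P X \<le> ent P Y"
  using ent_comp_le[OF fin, of f Y] ent_cong[of P X "\<lambda>w. f (Y w)"] assms by simp

lemma ent_eq_of_function:
  assumes "finite (set_pmf P)" and "\<And>w. w \<in> set_pmf P \<Longrightarrow> X w = f (Y w)"
    and "\<And>w. w \<in> set_pmf P \<Longrightarrow> Y w = g (X w)"
  shows "ent P X = ent P Y"
  by (intro antisym ent_le_of_function[where f = f] ent_le_of_function[where f = g] assms)

text \<open>Nonnegativity of I(X;Y|Z): Gibbs' inequality with q(x,y,z) = p(x,z) p(y,z) / p(z), the
  law that makes X and Y conditionally independent.\<close>

lemma ent_submodular: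
  assumes fin: "finite (set_pmf P)"
  shows "ent P (\<lambda>w. (X w, Y w, Z w)) + ent P Z \<le> ent P (\<lambda>w. (X w, Z w)) + ent P (\<lambda>w. (Y w, Z w))"
proof -
  let ?xz = "pmf (map_pmf (\<lambda>w. (X w, Z w)) P)" and ?yz = "pmf (map_pmf (\<lambda>w. (Y w, Z w)) P)"
    and ?z = "pmf (map_pmf Z P)"
  let ?q = "\<lambda>(x, y, z). ?xz (x, z) * ?yz (y, z) / ?z z"
  let ?U = "(\<lambda>w. (X w, Y w, Z w)) ` set_pmf P"
  let ?SX = "X ` set_pmf P" and ?SY = "Y ` set_pmf P" and ?SZ = "Z ` set_pmf P"
  have marg: "(\<Sum>x\<in>V ` set_pmf P. pmf (map_pmf (\<lambda>w. (V w, Z w)) P) (x, z)) = ?z z"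
    for V :: "'a \<Rightarrow> 'e" and z
  proof -
    have "?z z = (\<Sum>p\<in>{p \<in> (\<lambda>w. (V w, Z w)) ` set_pmf P. snd p = z}. pmf (map_pmf (\<lambda>w. (V w, Z w)) P) p)"
      using pmf_map_eq_sum_image[OF fin, where X = "\<lambda>w. (V w, Z w)" and f = snd and c = z] by simp
    also have "\<dots> = (\<Sum>p\<in>V ` set_pmf P \<times> {z}. pmf (map_pmf (\<lambda>w. (V w, Z w)) P) p)"
      by (rule sum.mono_neutral_left) (use fin in \<open>auto intro!: pmf_map_outside\<close>)
    also have "\<dots> = (\<Sum>x\<in>V ` set_pmf P. pmf (map_pmf (\<lambda>w. (V w, Z w)) P) (x, z))"
      by (subst sum.reindex[of "\<lambda>x. (x, z)", symmetric, unfolded o_def])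
        (auto simp: inj_on_def intro!: sum.cong)
    finally show ?thesis by simp
  qed
  have "(\<Sum>u\<in>?U. ?q u) \<le> (\<Sum>u\<in>?SX \<times> ?SY \<times> ?SZ. ?q u)"
    by (rule sum_mono2) (use fin in auto)
  also have "\<dots> = (\<Sum>x\<in>?SX. \<Sum>y\<in>?SY. \<Sum>z\<in>?SZ. ?xz (x, z) * ?yz (y, z) / ?z z)"
    by (simp add: sum.cartesian_product[symmetric])
  also have "\<dots> = (\<Sum>z\<in>?SZ. (\<Sum>x\<in>?SX. ?xz (x, z)) * (\<Sum>y\<in>?SY. ?yz (y, z)) / ?z z)"
    unfolding sum_product sum_divide_distrib
    by (subst sum.swap[of _ ?SZ]) (rule sum.swap)
  also have "\<dots> = (\<Sum>z\<in>?SZ. ?z z)"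
    unfolding marg by simp
  also have "\<dots> = 1"
    using sum_pmf_eq_1[of ?SZ "map_pmf Z P"] fin by simp
  finally have le1: "(\<Sum>u\<in>?U. ?q u) \<le> 1" .
  have "ent P (\<lambda>w. (X w, Y w, Z w)) \<le> expect P (\<lambda>w. - log 2 (?q (X w, Y w, Z w)))"
  proof (rule ent_le_cross_entropy[OF fin _ le1])
    fix w assume w: "w \<in> set_pmf P"
    show "0 < ?q (X w, Y w, Z w)"
      using pmf_map_pos[OF w, of "\<lambda>w. (X w, Z w)"] pmf_map_pos[OF w, of "\<lambda>w. (Y w, Z w)"]
        pmf_map_pos[OF w, of Z] by simp
  qed
  also have "\<dots> = expect P (\<lambda>w. - log 2 (?xz (X w, Z w)) + - log 2 (?yz (Y w, Z w)) - - log 2 (?z (Z w)))"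
  proof (rule expect_cong)
    fix w assume w: "w \<in> set_pmf P"
    show "- log 2 (?q (X w, Y w, Z w)) = - log 2 (?xz (X w, Z w)) + - log 2 (?yz (Y w, Z w)) - - log 2 (?z (Z w))"
      using pmf_map_pos[OF w, of "\<lambda>w. (X w, Z w)"] pmf_map_pos[OF w, of "\<lambda>w. (Y w, Z w)"]
        pmf_map_pos[OF w, of Z] by (simp add: log_divide_pos log_mult_pos)
  qed
  also have "\<dots> = ent P (\<lambda>w. (X w, Z w)) + ent P (\<lambda>w. (Y w, Z w)) - ent P Z"
    unfolding ent_def using fin by (simp add: expect_diff expect_add)
  finally show ?thesis by simp
qed

text \<open>Submodularity with f(Z) as the conditioning variable, since (Z, f(Z)) carries the same
  information as Z.\<close>

lemma cent_comp_ge: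
  assumes fin: "finite (set_pmf P)"
  shows "cent P X Z \<le> cent P X (\<lambda>w. f (Z w))"
proof -
  have "ent P (\<lambda>w. (X w, Z w, f (Z w))) = ent P (\<lambda>w. (X w, Z w))"
    by (rule ent_eq_of_function[OF fin, where f = "\<lambda>(x, z). (x, z, f z)" and g = "\<lambda>(x, z, _). (x, z)"]) auto
  moreover have "ent P (\<lambda>w. (Z w, f (Z w))) = ent P Z"
    by (rule ent_eq_of_function[OF fin, where f = "\<lambda>z. (z, f z)" and g = fst]) auto
  ultimately show ?thesis
    using ent_submodular[OF fin, of X Z "\<lambda>w. f (Z w)"] by (simp add: cent_def)
qed

lemma cent_pair_le:
  assumes fin: "finite (set_pmf P)"
  shows "cent P (\<lambda>w. (X w, Y w)) Z \<le> cent P X Z + cent P Y Z"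
proof -
  have "ent P (\<lambda>w. ((X w, Y w), Z w)) = ent P (\<lambda>w. (X w, Y w, Z w))"
    by (rule ent_eq_of_function[OF fin, where f = "\<lambda>(x, y, z). ((x, y), z)" and g = "\<lambda>((x, y), z). (x, y, z)"]) auto
  then show ?thesis
    using ent_submodular[OF fin, of X Y Z] by (simp add: cent_def)
qed

text \<open>Chain rule and removal of conditioning in one induction. The functions
  \<open>f i\<close> select what the term for i still conditions on; in the converse they pick the
  letters at time i.\<close>

lemma cent_map_le_sum:
  assumes fin: "finite (set_pmf P)"
  shows "cent P (\<lambda>w. map (\<lambda>i. X i w) is) Z \<le> (\<Sum>i\<leftarrow>is. cent P (X i) (\<lambda>w. f i (Z w)))"
proof (induction "is")
  case Nil
  show ?case
    using ent_le_of_function[OF fin, of "\<lambda>w. ([], Z w)" "\<lambda>z. ([], z)" Z] by (simp add: cent_def)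
next
  case (Cons i "is")
  have "ent P (\<lambda>w. (X i w # map (\<lambda>i. X i w) is, Z w)) = ent P (\<lambda>w. ((X i w, map (\<lambda>i. X i w) is), Z w))"
    by (rule ent_eq_of_function[OF fin, where f = "\<lambda>((x, xs), z). (x # xs, z)"
          and g = "\<lambda>(xs, z). ((hd xs, tl xs), z)"]) auto
  then have "cent P (\<lambda>w. X i w # map (\<lambda>i. X i w) is) Z = cent P (\<lambda>w. (X i w, map (\<lambda>i. X i w) is)) Z"
    by (simp add: cent_def)
  also have "\<dots> \<le> cent P (X i) Z + cent P (\<lambda>w. map (\<lambda>i. X i w) is) Z"
    by (rule cent_pair_le[OF fin])
  also have "\<dots> \<le> cent P (X i) (\<lambda>w. f i (Z w)) + (\<Sum>i\<leftarrow>is. cent P (X i) (\<lambda>w. f i (Z w)))"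
    using cent_comp_ge[OF fin, of "X i" Z "f i"] Cons.IH by linarith
  finally show ?case by simp
qed

lemma ent_const: "ent P (\<lambda>w. c) = 0"
  by (simp add: ent_def)

text \<open>Conditioning on the unit type makes the unconditional inequalities instances of the
  conditional ones.\<close>

lemma cent_unit: "finite (set_pmf P) \<Longrightarrow> cent P V (\<lambda>w. ()) = ent P V"
  using ent_eq_of_function[of P "\<lambda>w. (V w, ())" "\<lambda>v. (v, ())" V fst] by (simp add: cent_def ent_const)

lemma ent_map_le_sum:
  assumes fin: "finite (set_pmf P)"
  shows "ent P (\<lambda>w. map (\<lambda>i. X i w) is) \<le> (\<Sum>i\<leftarrow>is. ent P (X i))"
  using cent_map_le_sum[OF fin, of X "is" "\<lambda>w. ()" "\<lambda>_ _. ()"] by (simp add: cent_unit fin)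

lemma ent_pair_le:
  assumes fin: "finite (set_pmf P)"
  shows "ent P (\<lambda>w. (X w, Y w)) \<le> ent P X + ent P Y"
  using cent_pair_le[OF fin, of X Y "\<lambda>w. ()"] by (simp add: cent_unit fin)

lemma ent_indep:
  assumes fin: "finite (set_pmf P)"
    and ind: "map_pmf (\<lambda>w. (X w, Y w)) P = pair_pmf (map_pmf X P) (map_pmf Y P)"
  shows "ent P (\<lambda>w. (X w, Y w)) = ent P X + ent P Y"
proof -
  have "ent P (\<lambda>w. (X w, Y w)) = expect P (\<lambda>w. - log 2 (pmf (map_pmf X P) (X w)) + - log 2 (pmf (map_pmf Y P) (Y w)))"
    unfolding ent_def ind pmf_pair
    by (rule expect_cong) (use pmf_map_pos[of _ P X] pmf_map_pos[of _ P Y] in \<open>auto simp: log_mult_pos\<close>)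
  then show ?thesis using fin by (simp add: ent_def expect_diff)
qed

lemma ent_uniform:
  assumes "map_pmf X P = pmf_of_set A" "finite A" "A \<noteq> {}"
  shows "ent P X = log 2 (card A)"
proof -
  have "ent P X = expect P (\<lambda>w. log 2 (card A))"
    unfolding ent_def
  proof (rule expect_cong)
    fix w assume "w \<in> set_pmf P"
    then have "X w \<in> A" using assms by (metis imageI set_map_pmf set_pmf_of_set)
    then show "- log 2 (pmf (map_pmf X P) (X w)) = log 2 (card A)"
      using assms by (simp add: log_divide indicator_def)
  qed
  then show ?thesis by simp
qed

text \<open>Gibbs' inequality with a guess at X: weight 1/2 on the decoder's output and 1/(2 |A|) on
  every other value. Beyond the surprisal of Y, a correct decision costs one bit and an error 1 +
  log |A| bits.\<close>

lemma fano_inequality: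
  assumes fin: "finite (set_pmf P)" and M: "finite A" "A \<noteq> {}" "X ` set_pmf P \<subseteq> A"
    and err: "pr P {w. g (Y w) \<noteq> X w} \<le> \<epsilon>"
  shows "cent P X Y \<le> 1 + \<epsilon> * log 2 (card A)"
proof -
  let ?y = "pmf (map_pmf Y P)"
  define c where "c = real (card A)"
  have c: "1 \<le> c" using M by (simp add: c_def Suc_leI card_gt_0_iff)
  define q where "q = (\<lambda>(x, y). (if g y = x then 1 / 2 else 1 / (2 * c)) * ?y y)"
  have qsum: "(\<Sum>x\<in>A. if g y = x then 1 / 2 else 1 / (2 * c)) \<le> 1" for y
  proof -
    have "(\<Sum>x\<in>A. if g y = x then 1 / 2 else 1 / (2 * c)) \<le> (\<Sum>x\<in>A. (if g y = x then 1 / 2 else 0) + 1 / (2 * c))"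
      using c by (intro sum_mono) auto
    also have "\<dots> = (if g y \<in> A then 1 / 2 else 0) + c * (1 / (2 * c))"
      using M by (simp add: sum.distrib c_def)
    also have "\<dots> \<le> 1" using c by simp
    finally show ?thesis .
  qed
  have "(\<Sum>u\<in>(\<lambda>w. (X w, Y w)) ` set_pmf P. q u) \<le> (\<Sum>u\<in>A \<times> Y ` set_pmf P. q u)"
    by (rule sum_mono2) (use fin M c in \<open>auto simp: q_def\<close>)
  also have "\<dots> = (\<Sum>x\<in>A. \<Sum>y\<in>Y ` set_pmf P. q (x, y))"
    by (simp add: sum.cartesian_product)
  also have "\<dots> = (\<Sum>y\<in>Y ` set_pmf P. (\<Sum>x\<in>A. if g y = x then 1 / 2 else 1 / (2 * c)) * ?y y)"
    by (subst sum.swap) (simp add: q_def sum_distrib_right)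
  also have "\<dots> \<le> (\<Sum>y\<in>Y ` set_pmf P. 1 * ?y y)"
    by (intro sum_mono mult_right_mono qsum) simp
  also have "\<dots> = 1"
    using sum_pmf_eq_1[of "Y ` set_pmf P" "map_pmf Y P"] fin by simp
  finally have le1: "(\<Sum>u\<in>(\<lambda>w. (X w, Y w)) ` set_pmf P. q u) \<le> 1" .
  have "ent P (\<lambda>w. (X w, Y w)) \<le> expect P (\<lambda>w. - log 2 (q (X w, Y w)))"
    using fin pmf_map_pos[of _ P Y] c
    by (intro ent_le_cross_entropy[OF fin _ le1]) (auto simp: q_def)
  also have "\<dots> \<le> expect P (\<lambda>w. (1 + log 2 c * indicat_real {w. g (Y w) \<noteq> X w} w) + - log 2 (?y (Y w)))"
  proof (rule expect_mono[OF fin])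
    fix w assume w: "w \<in> set_pmf P"
    show "- log 2 (q (X w, Y w)) \<le> (1 + log 2 c * indicat_real {w. g (Y w) \<noteq> X w} w) + - log 2 (?y (Y w))"
      using pmf_map_pos[OF w, of Y] c by (auto simp: q_def log_mult_pos log_divide_pos)
  qed
  also have "\<dots> = 1 + log 2 c * pr P {w. g (Y w) \<noteq> X w} + ent P Y"
    using fin by (simp add: expect_diff expect_add ent_def integrable_measure_pmf_finite)
  also have "log 2 c * pr P {w. g (Y w) \<noteq> X w} \<le> log 2 c * \<epsilon>"
    using c err by (intro mult_left_mono) auto
  finally show ?thesis by (simp add: cent_def c_def mult.commute)
qed

text \<open>H(X,Q) = H(Q) + H(X|Q), where X may be a different function for each q. As q is
  recorded, the supports for different q are disjoint and the law factors as p(q) p(x|q). This turns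
  quantities conditioned on Q into averages over q.\<close>

lemma ent_mixture:
  assumes fin: "finite (set_pmf R)" "\<And>q. q \<in> set_pmf R \<Longrightarrow> finite (set_pmf (K q))"
  shows "ent (bind_pmf R (\<lambda>q. map_pmf (Pair q) (K q))) (\<lambda>(q, w). (X q w, q))
       = ent R (\<lambda>q. q) + expect R (\<lambda>q. ent (K q) (X q))"
proof -
  let ?P = "bind_pmf R (\<lambda>q. map_pmf (Pair q) (K q))"
  have p: "pmf (map_pmf (\<lambda>(q, w). (X q w, q)) ?P) (x, q) = pmf R q * pmf (map_pmf (X q) (K q)) x"
    if "q \<in> set_pmf R" for x q
  proof -
    have "map_pmf (\<lambda>(q, w). (X q w, q)) ?P = bind_pmf R (\<lambda>q. map_pmf (\<lambda>w. (X q w, q)) (K q))"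
      by (simp add: map_bind_pmf pmf.map_comp o_def)
    then have "pmf (map_pmf (\<lambda>(q, w). (X q w, q)) ?P) (x, q)
        = (\<Sum>q'\<in>set_pmf R. pmf R q' * pmf (map_pmf (\<lambda>w. (X q' w, q')) (K q')) (x, q))"
      by (simp add: pmf_bind expect_eq_sum fin)
    also have "\<dots> = (\<Sum>q'\<in>set_pmf R. if q' = q then pmf R q * pmf (map_pmf (X q) (K q)) x else 0)"
    proof (rule sum.cong[OF refl])
      fix q' assume "q' \<in> set_pmf R"
      have "pmf (map_pmf (\<lambda>w. (X q' w, q')) (K q')) (x, q) = 0" if "q' \<noteq> q"
        using that by (intro pmf_map_outside) auto
      moreover have "pmf (map_pmf (\<lambda>w. (X q w, q)) (K q)) (x, q) = pmf (map_pmf (X q) (K q)) x"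
        by (simp add: pmf_map vimage_def)
      ultimately show "pmf R q' * pmf (map_pmf (\<lambda>w. (X q' w, q')) (K q')) (x, q)
          = (if q' = q then pmf R q * pmf (map_pmf (X q) (K q)) x else 0)" by auto
    qed
    also have "\<dots> = pmf R q * pmf (map_pmf (X q) (K q)) x"
      using that fin by simp
    finally show ?thesis .
  qed
  have "ent ?P (\<lambda>(q, w). (X q w, q))
      = expect R (\<lambda>q. expect (K q) (\<lambda>w. - log 2 (pmf (map_pmf (\<lambda>(q, w). (X q w, q)) ?P) (X q w, q))))"
    unfolding ent_def by (subst expect_bind) (use fin in \<open>auto simp: case_prod_unfold\<close>)
  also have "\<dots> = expect R (\<lambda>q. - log 2 (pmf R q) + ent (K q) (X q))"
  proof (rule expect_cong)
    fix q assume q: "q \<in> set_pmf R"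
    have "expect (K q) (\<lambda>w. - log 2 (pmf (map_pmf (\<lambda>(q, w). (X q w, q)) ?P) (X q w, q)))
        = expect (K q) (\<lambda>w. - log 2 (pmf R q) + - log 2 (pmf (map_pmf (X q) (K q)) (X q w)))"
      unfolding p[OF q]
      by (rule expect_cong) (use q pmf_map_pos[of _ "K q" "X q"] in \<open>auto simp: log_mult_pos pmf_positive\<close>)
    also have "\<dots> = - log 2 (pmf R q) + ent (K q) (X q)"
      unfolding ent_def using fin(2)[OF q] by (subst expect_add) simp_all
    finally show "expect (K q) (\<lambda>w. - log 2 (pmf (map_pmf (\<lambda>(q, w). (X q w, q)) ?P) (X q w, q)))
        = - log 2 (pmf R q) + ent (K q) (X q)" .
  qed
  also have "\<dots> = ent R (\<lambda>q. q) + expect R (\<lambda>q. ent (K q) (X q))"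
    using fin by (simp add: expect_add expect_diff ent_def)
  finally show ?thesis .
qed

section \<open>Agreement with the library's conditional entropy and mutual information\<close>

lemma simple_distributed_pmf:
  fixes P :: "'w::finite pmf"
  shows "simple_distributed (measure_pmf P) X (pmf (map_pmf X P))"
  by (rule prob_space.simple_distributedI[OF prob_space_measure_pmf]) (auto simp: pmf_map simple_function_def)

lemma information_space_pmf: "information_space (measure_pmf P) 2"
  by (simp add: information_space_def information_space_axioms_def prob_space_measure_pmf)

lemma ent_eq_sum:
  fixes P :: "'w::finite pmf"
  shows "ent P X = - (\<Sum>x\<in>range X. pmf (map_pmf X P) x * log 2 (pmf (map_pmf X P) x))"
proof -
  have "ent P X = expect (map_pmf X P) (\<lambda>x. - log 2 (pmf (map_pmf X P) x))"
    by (simp add: ent_def)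
  also have "\<dots> = - (\<Sum>x\<in>range X. pmf (map_pmf X P) x * log 2 (pmf (map_pmf X P) x))"
    by (subst integral_measure_pmf_real[where A = "range X"]) (auto simp: mult.commute simp flip: sum_negf)
  finally show ?thesis .
qed

lemma cond_entropy_eq:
  fixes P :: "'w::finite pmf"
  shows "cond_entropy P X Z = cent P X Z"
proof -
  interpret information_space "measure_pmf P" 2 by (rule information_space_pmf)
  let ?xz = "pmf (map_pmf (\<lambda>w. (X w, Z w)) P)" and ?z = "pmf (map_pmf Z P)"
  have "cond_entropy P X Z = - (\<Sum>(x, z)\<in>range (\<lambda>w. (X w, Z w)). ?xz (x, z) * log 2 (?xz (x, z) / ?z z))"
    using conditional_entropy_eq[OF simple_distributed_pmf simple_distributed_pmf, of X Z] by (simp add: cond_entropy_def)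
  also have "\<dots> = expect (map_pmf (\<lambda>w. (X w, Z w)) P) (\<lambda>(x, z). - log 2 (?xz (x, z) / ?z z))"
    by (subst integral_measure_pmf_real[where A = "range (\<lambda>w. (X w, Z w))"])
      (auto simp: case_prod_unfold mult.commute simp flip: sum_negf)
  also have "\<dots> = expect P (\<lambda>w. - log 2 (?xz (X w, Z w)) - (- log 2 (?z (Z w))))"
    unfolding integral_map_pmf split
  proof (rule expect_cong)
    fix w assume w: "w \<in> set_pmf P"
    show "- log 2 (?xz (X w, Z w) / ?z (Z w)) = - log 2 (?xz (X w, Z w)) - (- log 2 (?z (Z w)))"
      using pmf_map_pos[OF w, of "\<lambda>w. (X w, Z w)"] pmf_map_pos[OF w, of Z]
      by (simp add: log_divide_pos)
  qed
  also have "\<dots> = cent P X Z"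
    unfolding ent_def cent_def by (simp only: expect_diff finite)
  finally show ?thesis .
qed

lemma cond_mutual_info_eq:
  fixes P :: "'w::finite pmf"
  shows "cond_mutual_info P X Y Z =
    ent P (\<lambda>w. (X w, Z w)) + ent P (\<lambda>w. (Y w, Z w)) - ent P (\<lambda>w. (X w, Y w, Z w)) - ent P Z"
proof -
  interpret information_space "measure_pmf P" 2 by (rule information_space_pmf)
  let ?p = "pmf (map_pmf (\<lambda>w. (X w, Y w, Z w)) P)" and ?xz = "pmf (map_pmf (\<lambda>w. (X w, Z w)) P)"
    and ?yz = "pmf (map_pmf (\<lambda>w. (Y w, Z w)) P)" and ?z = "pmf (map_pmf Z P)"
  have "cond_mutual_info P X Y Z = (\<Sum>(x, y, z)\<in>range (\<lambda>w. (X w, Y w, Z w)).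
      ?p (x, y, z) * log 2 (?p (x, y, z) / (?xz (x, z) * (?yz (y, z) / ?z z))))"
    using conditional_mutual_information_eq[OF simple_distributed_pmf simple_distributed_pmf simple_distributed_pmf simple_distributed_pmf, of X Y Z] by (simp add: cond_mutual_info_def)
  also have "\<dots> = expect (map_pmf (\<lambda>w. (X w, Y w, Z w)) P) (\<lambda>(x, y, z). log 2 (?p (x, y, z) / (?xz (x, z) * (?yz (y, z) / ?z z))))"
    by (subst integral_measure_pmf_real[where A = "range (\<lambda>w. (X w, Y w, Z w))"]) (auto simp: case_prod_unfold mult.commute)
  also have "\<dots> = expect P (\<lambda>w. (- log 2 (?xz (X w, Z w)) + - log 2 (?yz (Y w, Z w))) - (- log 2 (?p (X w, Y w, Z w))) - (- log 2 (?z (Z w))))"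
    unfolding integral_map_pmf split
  proof (rule expect_cong)
    fix w assume w: "w \<in> set_pmf P"
    show "log 2 (?p (X w, Y w, Z w) / (?xz (X w, Z w) * (?yz (Y w, Z w) / ?z (Z w)))) =
       (- log 2 (?xz (X w, Z w)) + - log 2 (?yz (Y w, Z w))) - (- log 2 (?p (X w, Y w, Z w))) - (- log 2 (?z (Z w)))"
      using pmf_map_pos[OF w, of "\<lambda>w. (X w, Z w)"] pmf_map_pos[OF w, of "\<lambda>w. (Y w, Z w)"]
        pmf_map_pos[OF w, of Z] pmf_map_pos[OF w, of "\<lambda>w. (X w, Y w, Z w)"]
      by (simp add: log_divide_pos log_mult_pos)
  qed
  also have "\<dots> = ent P (\<lambda>w. (X w, Z w)) + ent P (\<lambda>w. (Y w, Z w)) - ent P (\<lambda>w. (X w, Y w, Z w)) - ent P Z"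
    unfolding ent_def by (simp only: expect_add expect_diff finite)
  finally show ?thesis .
qed

section \<open>Convex hulls\<close>

text \<open>The gain over Caratheodory's theorem is one point, DIM instead of DIM + 1, at the price
  of moving w by a nonnegative multiple of e. In the application the move only raises the
  bounds.\<close>

lemma convex_hull_push_caratheodory:
  fixes V :: "'a::euclidean_space set"
  assumes V: "compact V" and w: "w \<in> convex hull V" and e: "e \<noteq> 0"
  obtains t S u where "0 \<le> t" "finite S" "S \<subseteq> V" "card S \<le> DIM('a)" "\<And>x. x \<in> S \<Longrightarrow> 0 \<le> u x"
    "sum u S = 1" "w + t *\<^sub>R e = (\<Sum>v\<in>S. u v *\<^sub>R v)"
proof -
  let ?C = "convex hull V"
  have C: "compact ?C" using V by (rule compact_convex_hull)
  define A where "A = {t. 0 \<le> t \<and> w + t *\<^sub>R e \<in> ?C}"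
  have "0 \<in> A" using w by (simp add: A_def)
  have "closed A"
  proof -
    have "A = {0..} \<inter> (\<lambda>t. w + t *\<^sub>R e) -` ?C" by (auto simp: A_def)
    moreover have "closed ((\<lambda>t. w + t *\<^sub>R e) -` ?C)"
      by (rule closed_vimage) (use C in \<open>auto intro!: compact_imp_closed continuous_intros\<close>)
    ultimately show ?thesis by (simp add: closed_Int)
  qed
  moreover have "bounded A"
  proof -
    obtain B where B: "\<And>x. x \<in> ?C \<Longrightarrow> norm x \<le> B"
      using compact_imp_bounded[OF C] by (auto simp: bounded_iff)
    have "norm t \<le> (B + norm w) / norm e" if "t \<in> A" for t
    proof -
      have "norm (t *\<^sub>R e) \<le> norm (w + t *\<^sub>R e) + norm w"
        by (metis add_diff_cancel_left' norm_triangle_ineq4)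
      also have "\<dots> \<le> B + norm w" using B that by (simp add: A_def)
      finally show ?thesis using e by (simp add: pos_le_divide_eq)
    qed
    then show ?thesis by (auto simp: bounded_iff)
  qed
  ultimately have "compact A" by (simp add: compact_eq_bounded_closed)
  then obtain t where t: "t \<in> A" "\<And>t'. t' \<in> A \<Longrightarrow> t' \<le> t"
    using compact_attains_sup[of A] \<open>0 \<in> A\<close> by auto
  define w' where "w' = w + t *\<^sub>R e"
  have w': "w' \<in> ?C" and t0: "0 \<le> t" using t(1) by (auto simp: A_def w'_def)
  \<comment> \<open>The open ray beyond the last point w' misses the hull and can be separated from
    it; it comes arbitrarily close to w', which forces w' onto the separating hyperplane.\<close>
  let ?R = "(\<lambda>r. w' + r *\<^sub>R e) ` {0<..}"
  have "?C \<inter> ?R = {}"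
  proof (rule ccontr)
    assume "?C \<inter> ?R \<noteq> {}"
    then obtain r where r: "0 < r" "w' + r *\<^sub>R e \<in> ?C" by auto
    then have "t + r \<in> A" using t0 by (simp add: A_def w'_def algebra_simps)
    then show False using t(2)[of "t + r"] r by simp
  qed
  moreover have "convex ?R"
  proof -
    have "?R = (+) w' ` ((\<lambda>r. r *\<^sub>R e) ` {0<..})" by auto
    moreover have "convex ((\<lambda>r. r *\<^sub>R e) ` {0<..})"
      by (intro convex_linear_image) (auto intro!: linear_scaleR_left simp: convex_real_interval)
    ultimately show ?thesis by (simp add: convex_translation)
  qed
  moreover have "?C \<noteq> {}" "?R \<noteq> {}" using w by (auto intro: exI[of _ 1])
  ultimately obtain a b where ab: "a \<noteq> 0" "\<And>x. x \<in> ?C \<Longrightarrow> a \<bullet> x \<le> b" "\<And>x. x \<in> ?R \<Longrightarrow> b \<le> a \<bullet> x"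
    using separating_hyperplane_sets[of ?C ?R] by blast
  have "b \<le> a \<bullet> w'"
  proof (rule tendsto_lowerbound)
    show "((\<lambda>r. a \<bullet> (w' + r *\<^sub>R e)) \<longlongrightarrow> a \<bullet> w') (at_right 0)"
      by (auto intro!: tendsto_eq_intros)
    show "eventually (\<lambda>r. b \<le> a \<bullet> (w' + r *\<^sub>R e)) (at_right 0)"
      by (rule eventually_at_right_less[THEN eventually_mono]) (use ab(3) in auto)
  qed simp
  then have aw: "a \<bullet> w' = b" using ab(2)[OF w'] by simp
  let ?H = "V \<inter> {x. a \<bullet> x = b}"
  have "w' \<in> convex hull ?H"
  proof -
    obtain F u where F: "finite F" "F \<subseteq> V" "\<And>x. x \<in> F \<Longrightarrow> 0 \<le> u x" "sum u F = 1" "(\<Sum>v\<in>F. u v *\<^sub>R v) = w'"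
      using w' unfolding convex_hull_explicit by auto
    \<comment> \<open>A convex combination that attains the maximum b gives positive weight only to
      points attaining it: the nonnegative slacks average to 0.\<close>
    have "(\<Sum>v\<in>F. u v * (b - a \<bullet> v)) = 0"
    proof -
      have "(\<Sum>v\<in>F. u v * (b - a \<bullet> v)) = sum u F * b - a \<bullet> (\<Sum>v\<in>F. u v *\<^sub>R v)"
        by (simp add: algebra_simps sum_subtractf inner_sum_right sum_distrib_left)
      then show ?thesis using F aw by simp
    qed
    then have z: "u v * (b - a \<bullet> v) = 0" if "v \<in> F" for v
      using that F ab(2) hull_subset[of V convex]
      by (subst (asm) sum_nonneg_eq_0_iff) (auto intro!: mult_nonneg_nonneg)
    let ?G = "{v \<in> F. u v \<noteq> 0}"
    have "sum u ?G = 1" "(\<Sum>v\<in>?G. u v *\<^sub>R v) = w'"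
      using F by (subst sum.mono_neutral_left[of F]; auto)+
    moreover have "?G \<subseteq> ?H" using z F by auto
    ultimately show ?thesis
      unfolding convex_hull_explicit using F by (intro CollectI exI[of _ ?G] exI[of _ u]) auto
  qed
  \<comment> \<open>Caratheodory's theorem in affine dimension d needs d + 1 points, here at most
    DIM.\<close>
  moreover have "aff_dim ?H \<le> int DIM('a) - 1"
    using aff_dim_subset[of ?H "{x. a \<bullet> x = b}"] ab(1) by simp
  ultimately obtain S u where "finite S" "S \<subseteq> ?H" "int (card S) \<le> int DIM('a)" "\<forall>x\<in>S. 0 \<le> u x"
    "sum u S = 1" "(\<Sum>v\<in>S. u v *\<^sub>R v) = w'"
    unfolding convex_hull_caratheodory_aff_dim by auto
  then show thesis using t0 by (intro that[of t S u]) (auto simp: w'_def)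
qed

section \<open>The rate region as a dominated convex hull\<close>

text \<open>Law of (S, X1, X2) given one value of the time-sharing variable; k is the input kernel
  of sender 1 and p the input law of sender 2.\<close>

definition input_pmf :: "'s pmf \<Rightarrow> ('s \<Rightarrow> 'x1 pmf) \<Rightarrow> 'x2 pmf \<Rightarrow> ('s \<times> 'x1 \<times> 'x2) pmf" where
  "input_pmf pS k p = bind_pmf pS (\<lambda>s. bind_pmf (k s) (\<lambda>x1. map_pmf (\<lambda>x2. (s, x1, x2)) p))"

text \<open>The four right-hand sides at one fixed q, with I = I(T1;S). The right-hand sides with Q
  are convex combinations of these vectors.\<close>

definition rate_vec ::
  "('x1 \<Rightarrow> 's \<Rightarrow> 'y1) \<Rightarrow> ('x1 \<Rightarrow> 's \<Rightarrow> 't1) \<Rightarrow> ('x2 \<Rightarrow> 't1 \<Rightarrow> 'y2) \<Rightarrow>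
   ('s \<times> 'x1 \<times> 'x2) pmf \<Rightarrow> real \<times> real \<times> real \<times> real" where
  "rate_vec y1 t1 y2 P =
    (let S = (\<lambda>(s, x1, x2). s); T = (\<lambda>(s, x1, x2). t1 x1 s);
         Y1 = (\<lambda>(s, x1, x2). y1 x1 s); Y2 = (\<lambda>(s, x1, x2). y2 x2 (t1 x1 s));
         I = ent P T + ent P S - ent P (\<lambda>w. (T w, S w))
     in (cent P Y1 S, cent P Y2 T, ent P Y2 - I, cent P Y1 (\<lambda>w. (T w, S w)) + ent P Y2 - I))"

definition meets :: "real \<times> real \<Rightarrow> real \<times> real \<times> real \<times> real \<Rightarrow> bool" where
  "meets = (\<lambda>(R1, R2) (a, b, c, d). R1 \<le> a \<and> R2 \<le> b \<and> R2 \<le> c \<and> R1 + R2 \<le> d)"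

lemma joint_pmf_eq:
  "joint_pmf pS pQ pX1 pX2 = map_pmf (\<lambda>(q, s, x1, x2). (s, q, x1, x2))
     (bind_pmf pQ (\<lambda>q. map_pmf (Pair q) (input_pmf pS (\<lambda>s. pX1 s q) (pX2 q))))"
  unfolding joint_pmf_def input_pmf_def
  by (subst bind_commute_pmf) (simp add: map_bind_pmf pmf.map_comp o_def bind_assoc_pmf bind_map_pmf map_pmf_def bind_return_pmf)

lemma ent_joint_pmf:
  fixes pS :: "'s::finite pmf" and pQ :: "'q::finite pmf" and pX1 :: "'s \<Rightarrow> 'q \<Rightarrow> 'x1::finite pmf"
    and pX2 :: "'q \<Rightarrow> 'x2::finite pmf"
  shows "ent (joint_pmf pS pQ pX1 pX2) (\<lambda>(s, q, x1, x2). (F s x1 x2, q))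
    = ent pQ (\<lambda>q. q) + expect pQ (\<lambda>q. ent (input_pmf pS (\<lambda>s. pX1 s q) (pX2 q)) (\<lambda>(s, x1, x2). F s x1 x2))"
  using ent_mixture[of pQ "\<lambda>q. input_pmf pS (\<lambda>s. pX1 s q) (pX2 q)" "\<lambda>q (s, x1, x2). F s x1 x2"]
  unfolding joint_pmf_eq ent_map by (simp add: case_prod_unfold)

text \<open>By \<open>ent_mixture\<close> every entropy involving Q is H(Q) plus an average over q.
  In each of the four expressions the coefficients of H(Q) add up to 0, so only the averages
  remain.\<close>

lemma rate_vec_joint:
  fixes pS :: "'s::finite pmf" and pQ :: "'q::finite pmf" and pX1 :: "'s \<Rightarrow> 'q \<Rightarrow> 'x1::finite pmf"
    and pX2 :: "'q \<Rightarrow> 'x2::finite pmf"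
    and y1 :: "'x1 \<Rightarrow> 's \<Rightarrow> 'y1::finite" and t1 :: "'x1 \<Rightarrow> 's \<Rightarrow> 't1::finite"
    and y2 :: "'x2 \<Rightarrow> 't1 \<Rightarrow> 'y2::finite"
  defines "P \<equiv> joint_pmf pS pQ pX1 pX2"
    and "S \<equiv> \<lambda>(s, q, x1, x2). s" and "Q \<equiv> \<lambda>(s, q, x1, x2). q" and "T \<equiv> \<lambda>(s, q, x1, x2). t1 x1 s"
    and "Y1 \<equiv> \<lambda>(s, q, x1, x2). y1 x1 s" and "Y2 \<equiv> \<lambda>(s, q, x1, x2). y2 x2 (t1 x1 s)"
  shows "(\<Sum>q\<in>UNIV. pmf pQ q *\<^sub>R rate_vec y1 t1 y2 (input_pmf pS (\<lambda>s. pX1 s q) (pX2 q))) =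
    (cond_entropy P Y1 (\<lambda>w. (S w, Q w)), cond_entropy P Y2 (\<lambda>w. (T w, Q w)),
     cond_entropy P Y2 Q - cond_mutual_info P T S Q,
     cond_entropy P Y1 (\<lambda>w. (T w, S w, Q w)) + cond_entropy P Y2 Q - cond_mutual_info P T S Q)"
proof -
  let ?K = "\<lambda>q. input_pmf pS (\<lambda>s. pX1 s q) (pX2 q)"
  have J: "ent P (\<lambda>w. (F (S w) (T w) (Y1 w) (Y2 w), Q w))
     = ent pQ (\<lambda>q. q) + expect pQ (\<lambda>q. ent (?K q) (\<lambda>(s, x1, x2). F s (t1 x1 s) (y1 x1 s) (y2 x2 (t1 x1 s))))"
    for F :: "'s \<Rightarrow> 't1 \<Rightarrow> 'y1 \<Rightarrow> 'y2 \<Rightarrow> 'e"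
    using ent_joint_pmf[of pS pQ pX1 pX2 "\<lambda>s x1 x2. F s (t1 x1 s) (y1 x1 s) (y2 x2 (t1 x1 s))"]
    by (simp add: P_def S_def T_def Y1_def Y2_def Q_def case_prod_unfold)
  have assoc: "ent P (\<lambda>w. (V w, U w, Q w)) = ent P (\<lambda>w. ((V w, U w), Q w))"
    for V :: "'s \<times> 'q \<times> 'x1 \<times> 'x2 \<Rightarrow> 'e" and U :: "'s \<times> 'q \<times> 'x1 \<times> 'x2 \<Rightarrow> 'f"
    by (rule ent_eq_of_function[where f = "\<lambda>((v, u), q). (v, u, q)" and g = "\<lambda>(v, u, q). ((v, u), q)"]) auto
  have assoc': "ent P (\<lambda>w. (V w, U w, W w, Q w)) = ent P (\<lambda>w. ((V w, U w, W w), Q w))"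
    for V :: "'s \<times> 'q \<times> 'x1 \<times> 'x2 \<Rightarrow> 'e" and U :: "'s \<times> 'q \<times> 'x1 \<times> 'x2 \<Rightarrow> 'f" and W :: "'s \<times> 'q \<times> 'x1 \<times> 'x2 \<Rightarrow> 'g"
    by (rule ent_eq_of_function[where f = "\<lambda>((v, u, x), q). (v, u, x, q)" and g = "\<lambda>(v, u, x, q). ((v, u, x), q)"]) auto
  have Qe: "ent P Q = ent pQ (\<lambda>q. q)"
  proof -
    have "ent P Q = ent P (\<lambda>w. ((), Q w))"
      by (rule ent_eq_of_function[where f = snd and g = "\<lambda>q. ((), q)"]) auto
    also have "\<dots> = ent pQ (\<lambda>q. q)"
      using J[of "\<lambda>_ _ _ _. ()"] by (simp add: ent_const case_prod_unfold)
    finally show ?thesis .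
  qed
  show ?thesis
    unfolding cond_entropy_eq cond_mutual_info_eq cent_def assoc assoc'
    unfolding J[of "\<lambda>s t y z. (y, s)"] J[of "\<lambda>s t y z. s"] J[of "\<lambda>s t y z. (z, t)"] J[of "\<lambda>s t y z. t"]
      J[of "\<lambda>s t y z. (t, s)"] J[of "\<lambda>s t y z. (y, t, s)"] J[of "\<lambda>s t y z. z"] Qe
    by (simp add: rate_vec_def Let_def cent_def prod_eq_iff fst_sum snd_sum case_prod_unfold,
        simp add: integral_measure_pmf_real[where A = UNIV] sum.distrib sum_subtractf ring_distribs,
        simp add: algebra_simps sum_negf)
qed

lemma rate_region_iff:
  fixes pS :: "'s::finite pmf"
    and y1 :: "'x1::finite \<Rightarrow> 's \<Rightarrow> 'y1::finite"
    and t1 :: "'x1 \<Rightarrow> 's \<Rightarrow> 't1::finite"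
    and y2 :: "'x2::finite \<Rightarrow> 't1 \<Rightarrow> 'y2::finite"
  shows "(R1, R2) \<in> rate_region pS y1 t1 y2 \<longleftrightarrow> 0 \<le> R1 \<and> 0 \<le> R2 \<and>
    (\<exists>(pQ :: 4 pmf) k p. meets (R1, R2) (\<Sum>q\<in>UNIV. pmf pQ q *\<^sub>R rate_vec y1 t1 y2 (input_pmf pS (k q) (p q))))"
    (is "_ \<longleftrightarrow> _ \<and> _ \<and> ?R")
proof -
  have "?R \<longleftrightarrow> (\<exists>(pQ :: 4 pmf) pX1 p. meets (R1, R2) (\<Sum>q\<in>UNIV. pmf pQ q *\<^sub>R rate_vec y1 t1 y2 (input_pmf pS (\<lambda>s. pX1 s q) (p q))))"
  proof (intro iffI; elim exE)
    fix pQ :: "4 pmf" and k p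
    assume "meets (R1, R2) (\<Sum>q\<in>UNIV. pmf pQ q *\<^sub>R rate_vec y1 t1 y2 (input_pmf pS (k q) (p q)))"
    then show "\<exists>(pQ :: 4 pmf) pX1 p. meets (R1, R2) (\<Sum>q\<in>UNIV. pmf pQ q *\<^sub>R rate_vec y1 t1 y2 (input_pmf pS (\<lambda>s. pX1 s q) (p q)))"
      by (intro exI[of _ pQ] exI[of _ "\<lambda>s q. k q s"] exI[of _ p]) simp
  next
    fix pQ :: "4 pmf" and k p
    assume "meets (R1, R2) (\<Sum>q\<in>UNIV. pmf pQ q *\<^sub>R rate_vec y1 t1 y2 (input_pmf pS (\<lambda>s. k s q) (p q)))"
    then show ?R
      by (intro exI[of _ pQ] exI[of _ "\<lambda>q s. k s q"] exI[of _ p]) simp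
  qed
  then show ?thesis
    unfolding rate_vec_joint rate_region_def Let_def meets_def by simp
qed

section \<open>Compactness of the set of rate vectors\<close>

lemma continuous_xlogx: "continuous_on {0..} (\<lambda>x::real. x * log 2 x)"
proof (rule continuous_on_eq[of _ "\<lambda>x. x * ln x / ln 2"])
  have "continuous (at x within {0..}) (\<lambda>x::real. x * ln x)" if "0 \<le> x" for x
  proof (cases "x = 0")
    case True
    \<comment> \<open>Substituting 1/x gives x ln x = - ln (1/x) / (1/x), and the limit 0 agrees
      with the value of the function at 0.\<close>
    have "((\<lambda>x::real. x * ln x) \<longlongrightarrow> 0) (at_right 0)"
    proof -
      have "((\<lambda>x::real. ln (inverse x) / inverse x) \<longlongrightarrow> 0) (at_right 0)"
        by (rule filterlim_compose[OF ln_x_over_x_tendsto_0 filterlim_inverse_at_top_right])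
      from tendsto_minus[OF this] have "((\<lambda>x::real. - (ln (inverse x) / inverse x)) \<longlongrightarrow> 0) (at_right 0)"
        by simp
      then show ?thesis
        by (rule filterlim_cong[THEN iffD1, OF refl refl, rotated])
          (auto simp: ln_inverse divide_inverse mult.commute intro!: eventually_mono[OF eventually_at_right_less])
    qed
    then have "((\<lambda>x::real. x * ln x) \<longlongrightarrow> 0) (at 0 within {0..})"
      by (simp add: at_within_Ici_at_right)
    then show ?thesis using True by (simp add: continuous_within)
  next
    case False
    then show ?thesis by (intro continuous_intros) auto
  qed
  then have "continuous_on {0..} (\<lambda>x::real. x * ln x)"
    by (simp add: continuous_on_eq_continuous_within)
  then show "continuous_on {0..} (\<lambda>x::real. x * ln x / ln 2)"
    by (intro continuous_on_divide continuous_on_const) auto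
qed (simp add: log_def)

lemma pmf_exists:
  fixes f :: "'a::finite \<Rightarrow> real"
  assumes "\<And>x. 0 \<le> f x" "(\<Sum>x\<in>UNIV. f x) = 1"
  obtains p where "\<And>x. pmf p x = f x"
proof -
  have "(\<integral>\<^sup>+x. ennreal (f x) \<partial>count_space UNIV) = 1"
    using assms by (simp add: nn_integral_count_space_finite sum_ennreal)
  then show thesis using assms by (intro that[of "embed_pmf f"]) (simp add: pmf_embed_pmf)
qed

text \<open>Entropy in terms of the weights alone, so that continuity in the weights can be stated.\<close>

definition wvec_ent :: "('w::finite \<Rightarrow> real) \<Rightarrow> ('w \<Rightarrow> 'a) \<Rightarrow> real" where
  "wvec_ent f X = - (\<Sum>x\<in>range X. (\<Sum>w\<in>X -` {x}. f w) * log 2 (\<Sum>w\<in>X -` {x}. f w))"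

lemma ent_eq_wvec_ent:
  fixes P :: "'w::finite pmf"
  shows "ent P X = wvec_ent (pmf P) X"
  unfolding ent_eq_sum wvec_ent_def by (simp add: pmf_map measure_measure_pmf_finite)

lemma continuous_on_wvec_ent:
  fixes f :: "'p::topological_space \<Rightarrow> 'w::finite \<Rightarrow> real"
  assumes "\<And>w. continuous_on A (\<lambda>p. f p w)" "\<And>p w. p \<in> A \<Longrightarrow> 0 \<le> f p w"
  shows "continuous_on A (\<lambda>p. wvec_ent (f p) X)"
  unfolding wvec_ent_def
  by (intro continuous_intros continuous_on_compose2[OF continuous_xlogx]) (auto intro!: assms sum_nonneg)

lemma pmf_input_pmf:
  fixes pS :: "'s::finite pmf" and k :: "'s \<Rightarrow> 'x1::finite pmf" and p :: "'x2::finite pmf"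
  shows "pmf (input_pmf pS k p) = (\<lambda>(s, x1, x2). pmf pS s * pmf (k s) x1 * pmf p x2)"
proof (rule ext, clarify)
  fix s :: 's and x1 :: 'x1 and x2 :: 'x2
  have "pmf (map_pmf (\<lambda>x2. (s', x1', x2)) p) (s, x1, x2) = (if s' = s then if x1' = x1 then pmf p x2 else 0 else 0)" for s' x1'
    by (auto simp: pmf_map vimage_def pmf.rep_eq)
  then show "pmf (input_pmf pS k p) (s, x1, x2) = pmf pS s * pmf (k s) x1 * pmf p x2"
    unfolding input_pmf_def pmf_bind
    by (simp add: integral_measure_pmf_real[where A = UNIV] if_distrib[of "\<lambda>x. x * _"] sum.If_cases cong: if_cong)
qed

definition rate_vecs ::
  "'s pmf \<Rightarrow> ('x1 \<Rightarrow> 's \<Rightarrow> 'y1) \<Rightarrow> ('x1 \<Rightarrow> 's \<Rightarrow> 't1) \<Rightarrow> ('x2 \<Rightarrow> 't1 \<Rightarrow> 'y2) \<Rightarrow>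
   (real \<times> real \<times> real \<times> real) set" where
  "rate_vecs pS y1 t1 y2 = {rate_vec y1 t1 y2 (input_pmf pS k p) | k p. True}"

text \<open>A continuous image of a product of simplices: stochastic matrices encode the kernel k,
  probability vectors the law p. Entropies are continuous up to the boundary because x log x
  is.\<close>

lemma compact_rate_vecs:
  fixes pS :: "'s::finite pmf"
    and y1 :: "'x1::finite \<Rightarrow> 's \<Rightarrow> 'y1::finite"
    and t1 :: "'x1 \<Rightarrow> 's \<Rightarrow> 't1::finite"
    and y2 :: "'x2::finite \<Rightarrow> 't1 \<Rightarrow> 'y2::finite"
  shows "compact (rate_vecs pS y1 t1 y2)"
proof -
  define D :: "((real, 'x1) vec, 's) vec set" where
    "D = {a. \<forall>s. (\<forall>x. 0 \<le> a $ s $ x) \<and> (\<Sum>x\<in>UNIV. a $ s $ x) = 1}"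
  define E :: "(real, 'x2) vec set" where
    "E = {b. (\<forall>x. 0 \<le> b $ x) \<and> (\<Sum>x\<in>UNIV. b $ x) = 1}"
  define f :: "((real, 'x1) vec, 's) vec \<times> (real, 'x2) vec \<Rightarrow> 's \<times> 'x1 \<times> 'x2 \<Rightarrow> real" where
    "f = (\<lambda>(a, b) (s, x1, x2). pmf pS s * a $ s $ x1 * b $ x2)"
  define G where "G = (\<lambda>c.
    let S = (\<lambda>(s, x1, x2). s); T = (\<lambda>(s, x1, x2). t1 x1 s);
         Y1 = (\<lambda>(s, x1, x2). y1 x1 s); Y2 = (\<lambda>(s, x1, x2). y2 x2 (t1 x1 s));
         I = wvec_ent (f c) T + wvec_ent (f c) S - wvec_ent (f c) (\<lambda>w. (T w, S w))
     in (wvec_ent (f c) (\<lambda>w. (Y1 w, S w)) - wvec_ent (f c) S, wvec_ent (f c) (\<lambda>w. (Y2 w, T w)) - wvec_ent (f c) T,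
         wvec_ent (f c) Y2 - I,
         wvec_ent (f c) (\<lambda>w. (Y1 w, (T w, S w))) - wvec_ent (f c) (\<lambda>w. (T w, S w)) + wvec_ent (f c) Y2 - I))"
  have closed: "closed D" "closed E"
  proof -
    have "D = (\<Inter>s. (\<Inter>x. {a. 0 \<le> a $ s $ x}) \<inter> {a. (\<Sum>x\<in>UNIV. a $ s $ x) = 1})"
      by (auto simp: D_def)
    moreover have "closed (\<Inter>s. (\<Inter>x. {a :: ((real, 'x1) vec, 's) vec. 0 \<le> a $ s $ x}) \<inter> {a. (\<Sum>x\<in>UNIV. a $ s $ x) = 1})"
      by (intro closed_INT closed_Int ballI closed_Collect_le closed_Collect_eq continuous_intros)
    ultimately show "closed D" by simp
    have "E = (\<Inter>x. {b. 0 \<le> b $ x}) \<inter> {b. (\<Sum>x\<in>UNIV. b $ x) = 1}"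
      by (auto simp: E_def)
    moreover have "closed ((\<Inter>x. {b :: (real, 'x2) vec. 0 \<le> b $ x}) \<inter> {b. (\<Sum>x\<in>UNIV. b $ x) = 1})"
      by (intro closed_INT closed_Int ballI closed_Collect_le closed_Collect_eq continuous_intros)
    ultimately show "closed E" by simp
  qed
  \<comment> \<open>The norm is at most the sum of the norms of the entries. That sum is 1 for a
    probability vector, and a stochastic matrix is bounded by its number of rows.\<close>
  have nle: "norm v \<le> (\<Sum>x\<in>UNIV. norm (v $ x))" for v :: "('e::real_normed_vector, 'f::finite) vec"
    by (simp add: norm_vec_def L2_set_le_sum)
  have "bounded D"
    unfolding bounded_iff
  proof (intro exI ballI)
    fix a assume a: "a \<in> D"
    have "norm a \<le> (\<Sum>s\<in>UNIV. \<Sum>x\<in>UNIV. norm (a $ s $ x))"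
      by (rule order.trans[OF nle sum_mono[OF nle]])
    also have "\<dots> = (\<Sum>s\<in>(UNIV :: 's set). 1)"
      using a by (intro sum.cong) (auto simp: D_def)
    finally show "norm a \<le> (\<Sum>s\<in>(UNIV :: 's set). 1)" .
  qed
  moreover have "bounded E"
    unfolding bounded_iff
  proof (intro exI ballI)
    fix b assume b: "b \<in> E"
    have "norm b \<le> (\<Sum>x\<in>UNIV. norm (b $ x))" by (rule nle)
    then show "norm b \<le> 1" using b by (simp add: E_def)
  qed
  ultimately have K: "compact (D \<times> E)"
    using closed by (intro compact_Times) (auto simp: compact_eq_bounded_closed)
  have f0: "0 \<le> f c w" if "c \<in> D \<times> E" for c w
    using that by (auto simp: f_def D_def E_def split: prod.splits)
  have fc: "continuous_on (D \<times> E) (\<lambda>c. f c w)" for w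
    by (cases w) (auto simp: f_def case_prod_unfold intro!: continuous_intros)
  have cw: "continuous_on (D \<times> E) (\<lambda>c. wvec_ent (f c) X)" for X :: "_ \<Rightarrow> 'e"
    by (rule continuous_on_wvec_ent[where f = f, OF fc f0])
  have "continuous_on (D \<times> E) G"
    unfolding G_def Let_def by (intro continuous_on_Pair continuous_on_diff continuous_on_add cw)
  then have "compact (G ` (D \<times> E))" using K by (rule compact_continuous_image)
  moreover have "G ` (D \<times> E) = rate_vecs pS y1 t1 y2"
  proof -
    have G: "rate_vec y1 t1 y2 (input_pmf pS k p) = G (a, b)"
      if "\<And>s x. pmf (k s) x = a $ s $ x" "\<And>x. pmf p x = b $ x" for a b k p
    proof -
      have "pmf (input_pmf pS k p) = f (a, b)" unfolding pmf_input_pmf f_def using that by simp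
      then show ?thesis by (simp add: rate_vec_def G_def Let_def cent_def ent_eq_wvec_ent)
    qed
    show ?thesis
    proof (intro equalityI subsetI)
      fix v assume "v \<in> G ` (D \<times> E)"
      then obtain a b where ab: "a \<in> D" "b \<in> E" "v = G (a, b)" by auto
      have "\<exists>q. \<forall>x. pmf q x = a $ s $ x" for s
        by (rule pmf_exists[of "\<lambda>x. a $ s $ x"]) (use ab(1) in \<open>auto simp: D_def\<close>)
      then have "\<exists>k. \<forall>s x. pmf (k s) x = a $ s $ x"
        by (intro choice allI)
      then obtain k where k: "\<And>s x. pmf (k s) x = a $ s $ x" by blast
      obtain p where p: "\<And>x. pmf p x = b $ x"
        by (rule pmf_exists[of "\<lambda>x. b $ x"]) (use ab(2) in \<open>auto simp: E_def\<close>)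
      show "v \<in> rate_vecs pS y1 t1 y2"
        unfolding rate_vecs_def ab(3) G[OF k p, symmetric] by blast
    next
      fix v assume "v \<in> rate_vecs pS y1 t1 y2"
      then obtain k p where v: "v = rate_vec y1 t1 y2 (input_pmf pS k p)" by (auto simp: rate_vecs_def)
      let ?a = "\<chi> s x. pmf (k s) x" and ?b = "\<chi> x. pmf p x"
      have "v = G (?a, ?b)" unfolding v by (rule G) simp_all
      moreover have "?a \<in> D" "?b \<in> E" by (simp_all add: D_def E_def sum_pmf_eq_1)
      ultimately show "v \<in> G ` (D \<times> E)" by blast
    qed
  qed
  ultimately show ?thesis by simp
qed

lemma rate_region_eq_hull:
  fixes pS :: "'s::finite pmf"
    and y1 :: "'x1::finite \<Rightarrow> 's \<Rightarrow> 'y1::finite"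
    and t1 :: "'x1 \<Rightarrow> 's \<Rightarrow> 't1::finite"
    and y2 :: "'x2::finite \<Rightarrow> 't1 \<Rightarrow> 'y2::finite"
  shows "rate_region pS y1 t1 y2 =
    {R. 0 \<le> fst R \<and> 0 \<le> snd R \<and> (\<exists>w\<in>convex hull (rate_vecs pS y1 t1 y2). meets R w)}"
proof (intro equalityI subsetI)
  let ?V = "rate_vecs pS y1 t1 y2"
  fix R assume "R \<in> rate_region pS y1 t1 y2"
  moreover obtain R1 R2 where R: "R = (R1, R2)" by (cases R)
  ultimately obtain pQ :: "4 pmf" and k p where *: "0 \<le> R1" "0 \<le> R2"
    "meets (R1, R2) (\<Sum>q\<in>UNIV. pmf pQ q *\<^sub>R rate_vec y1 t1 y2 (input_pmf pS (k q) (p q)))"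
    by (auto simp: rate_region_iff)
  have "(\<Sum>q\<in>UNIV. pmf pQ q *\<^sub>R rate_vec y1 t1 y2 (input_pmf pS (k q) (p q))) \<in> convex hull ?V"
    by (intro convex_sum) (auto simp: sum_pmf_eq_1 rate_vecs_def intro!: hull_inc)
  then show "R \<in> {R. 0 \<le> fst R \<and> 0 \<le> snd R \<and> (\<exists>w\<in>convex hull ?V. meets R w)}"
    using * R by auto
next
  let ?V = "rate_vecs pS y1 t1 y2"
  fix R assume "R \<in> {R. 0 \<le> fst R \<and> 0 \<le> snd R \<and> (\<exists>w\<in>convex hull ?V. meets R w)}"
  moreover obtain R1 R2 where R: "R = (R1, R2)" by (cases R)
  ultimately obtain w where *: "0 \<le> R1" "0 \<le> R2" "w \<in> convex hull ?V" "meets (R1, R2) w" by auto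
  let ?e = "(1, 1, 1, 1) :: real \<times> real \<times> real \<times> real"
  obtain t S u where t: "0 \<le> t" "finite S" "S \<subseteq> ?V" "card S \<le> DIM(real \<times> real \<times> real \<times> real)"
    "\<And>x. x \<in> S \<Longrightarrow> 0 \<le> u x" "sum u S = 1" "w + t *\<^sub>R ?e = (\<Sum>v\<in>S. u v *\<^sub>R v)"
    using convex_hull_push_caratheodory[OF compact_rate_vecs *(3), of ?e] by (auto simp: prod_eq_iff)
  have "card S \<le> CARD(4)" using t(4) by simp
  \<comment> \<open>The at most four points are labelled by elements of the type \<open>4\<close>.
    Labels left over get probability 0 in \<open>pQ\<close>, so the value of h there has no
    influence.\<close>
  then obtain g :: "real \<times> real \<times> real \<times> real \<Rightarrow> 4" where g: "inj_on g S"
    using card_le_inj[OF t(2), of "UNIV :: 4 set"] by auto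
  have "\<forall>v\<in>S. \<exists>k p. v = rate_vec y1 t1 y2 (input_pmf pS k p)"
    using t(3) by (auto simp: rate_vecs_def)
  then obtain k p where kp: "\<And>v. v \<in> S \<Longrightarrow> v = rate_vec y1 t1 y2 (input_pmf pS (k v) (p v))"
    by metis
  define h where "h = the_inv_into S g"
  have h: "h (g v) = v" if "v \<in> S" for v using that g by (simp add: h_def the_inv_into_f_f)
  let ?f = "\<lambda>q. if q \<in> g ` S then u (h q) else 0"
  have img: "(\<Sum>q\<in>UNIV. (if q \<in> g ` S then F (h q) else 0)) = (\<Sum>v\<in>S. F v)" for F :: "_ \<Rightarrow> 'e::comm_monoid_add"
    using h by (simp add: sum.If_cases sum.reindex[OF g])
  obtain pQ where pQ: "\<And>q. pmf pQ q = ?f q"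
  proof (rule pmf_exists[of ?f])
    show "0 \<le> ?f q" for q using t(5) h by auto
    show "(\<Sum>q\<in>UNIV. ?f q) = 1" using img[of u] t(6) by simp
  qed blast
  have "(\<Sum>q\<in>UNIV. pmf pQ q *\<^sub>R rate_vec y1 t1 y2 (input_pmf pS (k (h q)) (p (h q))))
      = (\<Sum>q\<in>UNIV. if q \<in> g ` S then u (h q) *\<^sub>R rate_vec y1 t1 y2 (input_pmf pS (k (h q)) (p (h q))) else 0)"
    by (intro sum.cong) (auto simp: pQ)
  also have "\<dots> = (\<Sum>v\<in>S. u v *\<^sub>R v)"
    using kp by (subst img) (simp cong: sum.cong)
  also have "\<dots> = w + t *\<^sub>R ?e" using t(7) by simp
  finally have "(\<Sum>q\<in>UNIV. pmf pQ q *\<^sub>R rate_vec y1 t1 y2 (input_pmf pS (k (h q)) (p (h q)))) = w + t *\<^sub>R ?e" .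
  \<comment> \<open>The shift t is nonnegative and enters all four bounds, so domination is
    preserved.\<close>
  moreover have "meets (R1, R2) (w + t *\<^sub>R ?e)"
    using *(4) t(1) by (cases w) (auto simp: meets_def)
  ultimately have "meets (R1, R2) (\<Sum>q\<in>UNIV. pmf pQ q *\<^sub>R rate_vec y1 t1 y2 (input_pmf pS (k (h q)) (p (h q))))"
    by simp
  then show "R \<in> rate_region pS y1 t1 y2"
    unfolding R rate_region_iff using *(1,2)
    by (intro conjI exI[of _ pQ] exI[of _ "\<lambda>q. k (h q)"] exI[of _ "\<lambda>q. p (h q)"]) auto
qed

text \<open>R is dominated by a point of C iff (R1, R2, R2, R1 + R2) lies in C plus the nonpositive
  orthant. A compact set plus a closed set is closed, and the embedding of R is continuous.\<close>

lemma closed_meets: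
  fixes C :: "(real \<times> real \<times> real \<times> real) set"
  assumes "compact C"
  shows "closed {R. \<exists>w\<in>C. meets R w}"
proof -
  let ?N = "{v :: real \<times> real \<times> real \<times> real. fst v \<le> 0 \<and> fst (snd v) \<le> 0 \<and> fst (snd (snd v)) \<le> 0 \<and> snd (snd (snd v)) \<le> 0}"
  define D where "D = (\<Union>x\<in>C. \<Union>y\<in>?N. {x + y})"
  have "closed ?N"
    by (intro closed_Collect_conj closed_Collect_le continuous_intros)
  then have D: "closed D" unfolding D_def using assms by (intro compact_closed_sums)
  have "(\<exists>w\<in>C. meets R w) \<longleftrightarrow> (fst R, snd R, snd R, fst R + snd R) \<in> D" for R
  proof
    assume "\<exists>w\<in>C. meets R w"
    then obtain w where w: "w \<in> C" "meets R w" by blast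
    have "(fst R, snd R, snd R, fst R + snd R) - w \<in> ?N"
      using w(2) by (cases w; cases R) (auto simp: meets_def)
    moreover have "(fst R, snd R, snd R, fst R + snd R) = w + ((fst R, snd R, snd R, fst R + snd R) - w)"
      by simp
    ultimately show "(fst R, snd R, snd R, fst R + snd R) \<in> D" unfolding D_def using w(1) by blast
  next
    assume "(fst R, snd R, snd R, fst R + snd R) \<in> D"
    then obtain w y where "w \<in> C" "y \<in> ?N" "(fst R, snd R, snd R, fst R + snd R) = w + y"
      unfolding D_def by blast
    moreover from this have "meets R w"
      by (cases w; cases R; cases y) (auto simp: meets_def)
    ultimately show "\<exists>w\<in>C. meets R w" by blast
  qed
  then have "{R. \<exists>w\<in>C. meets R w} = (\<lambda>R. (fst R, snd R, snd R, fst R + snd R)) -` D" by auto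
  then show ?thesis by (auto intro!: closed_vimage[OF D] continuous_intros)
qed

lemma closed_rate_region:
  fixes pS :: "'s::finite pmf"
    and y1 :: "'x1::finite \<Rightarrow> 's \<Rightarrow> 'y1::finite"
    and t1 :: "'x1 \<Rightarrow> 's \<Rightarrow> 't1::finite"
    and y2 :: "'x2::finite \<Rightarrow> 't1 \<Rightarrow> 'y2::finite"
  shows "closed (rate_region pS y1 t1 y2)"
  unfolding rate_region_eq_hull
  by (intro closed_Collect_conj closed_Collect_le continuous_intros closed_meets compact_convex_hull
      compact_rate_vecs)

section \<open>Converse\<close>

text \<open>Disintegration along A. It extracts a kernel p(x1|s) from a code, in which X1 depends on
  the message and the whole state sequence and not only on the current state.\<close>

lemma map_pmf_eq_bind_cond:
  "map_pmf (\<lambda>w. (A w, B w)) J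
   = bind_pmf (map_pmf A J) (\<lambda>a. map_pmf (Pair a) (map_pmf B (cond_pmf J {w. A w = a})))"
proof -
  have "J = bind_pmf (map_pmf A J) (\<lambda>a. cond_pmf J {w. A w = a})"
  proof (rule bind_cond_pmf_cancel[symmetric])
    fix a w assume "a \<in> set_pmf (map_pmf A J)" "w \<in> set_pmf J" "A w = a"
    have "measure (measure_pmf (map_pmf A J)) {x. A w = x} = measure (measure_pmf J) (A -` {x. A w = x})"
      by simp
    also have "A -` {x. A w = x} = {w. A w = a}" using \<open>A w = a\<close> by auto
    finally show "measure (measure_pmf J) {w. A w = a} = measure (measure_pmf (map_pmf A J)) {x. A w = x}"
      by simp
  qed auto
  then have "map_pmf (\<lambda>w. (A w, B w)) J
      = bind_pmf (map_pmf A J) (\<lambda>a. map_pmf (\<lambda>w. (A w, B w)) (cond_pmf J {w. A w = a}))"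
    by (metis (mono_tags, lifting) map_bind_pmf bind_pmf_cong)
  also have "\<dots> = bind_pmf (map_pmf A J) (\<lambda>a. map_pmf (Pair a) (map_pmf B (cond_pmf J {w. A w = a})))"
  proof (rule bind_pmf_cong[OF refl])
    fix a assume "a \<in> set_pmf (map_pmf A J)"
    then have "set_pmf J \<inter> {w. A w = a} \<noteq> {}" by auto
    then have "set_pmf (cond_pmf J {w. A w = a}) \<subseteq> {w. A w = a}" by (simp add: set_cond_pmf)
    then show "map_pmf (\<lambda>w. (A w, B w)) (cond_pmf J {w. A w = a})
        = map_pmf (Pair a) (map_pmf B (cond_pmf J {w. A w = a}))"
      unfolding pmf.map_comp by (intro map_pmf_cong) auto
  qed
  finally show ?thesis .
qed

text \<open>A joint law with state marginal pS in which X2 is independent of (S, X1) is an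
  admissible input law; this places the single letters of a code in
  \<open>rate_vecs\<close>.\<close>

lemma map_pmf_eq_input_pmf:
  assumes "map_pmf A J = pS"
    and "map_pmf (\<lambda>w. ((A w, B w), C w)) J = pair_pmf (map_pmf (\<lambda>w. (A w, B w)) J) (map_pmf C J)"
  shows "\<exists>k p. map_pmf (\<lambda>w. (A w, B w, C w)) J = input_pmf pS k p"
proof -
  let ?k = "\<lambda>a. map_pmf B (cond_pmf J {w. A w = a})"
  have "map_pmf (\<lambda>w. (A w, B w, C w)) J = map_pmf (\<lambda>((a, b), c). (a, b, c)) (map_pmf (\<lambda>w. ((A w, B w), C w)) J)"
    by (simp add: pmf.map_comp o_def)
  also have "\<dots> = map_pmf (\<lambda>((a, b), c). (a, b, c)) (pair_pmf (bind_pmf pS (\<lambda>a. map_pmf (Pair a) (?k a))) (map_pmf C J))"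
    unfolding assms(2) map_pmf_eq_bind_cond[of A B J] assms(1) ..
  also have "\<dots> = input_pmf pS ?k (map_pmf C J)"
    by (simp add: input_pmf_def pair_pmf_def map_bind_pmf bind_assoc_pmf bind_map_pmf map_pmf_def[of _ "map_pmf C J"] bind_return_pmf)
  finally show ?thesis by blast
qed

lemma map_nth_replicate_pmf: "i < n \<Longrightarrow> map_pmf (\<lambda>s. s ! i) (replicate_pmf n p) = p"
proof (induction n arbitrary: i)
  case (Suc n)
  show ?case
  proof (cases i)
    case 0
    then show ?thesis by (simp add: map_bind_pmf bind_return_pmf')
  next
    case (Suc j)
    then show ?thesis
      using Suc.IH[of j] Suc.prems by (simp add: map_bind_pmf) (simp add: map_pmf_def)
  qed
qed simp

lemma finite_set_replicate_pmf: "finite (set_pmf p) \<Longrightarrow> finite (set_pmf (replicate_pmf n p))"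
  by (induction n) auto

lemma ent_replicate_pmf:
  assumes fin: "finite (set_pmf p)"
  shows "ent (replicate_pmf n p) (\<lambda>s. s) = n * ent p (\<lambda>s. s)"
proof (induction n)
  case 0
  then show ?case by (simp add: ent_def)
next
  case (Suc n)
  let ?J = "pair_pmf p (replicate_pmf n p)"
  have finJ: "finite (set_pmf ?J)" using fin by (simp add: finite_set_replicate_pmf)
  have "replicate_pmf (Suc n) p = map_pmf (\<lambda>(x, xs). x # xs) ?J"
    by (simp add: pair_pmf_def map_bind_pmf)
  then have "ent (replicate_pmf (Suc n) p) (\<lambda>s. s) = ent ?J (\<lambda>(x, xs). x # xs)"
    by (simp only: ent_map)
  also have "\<dots> = ent ?J (\<lambda>w. (fst w, snd w))"
    by (rule ent_eq_of_function[OF finJ, where f = "\<lambda>(x, xs). x # xs" and g = "\<lambda>xs. (hd xs, tl xs)"]) auto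
  also have "\<dots> = ent ?J fst + ent ?J snd"
    by (rule ent_indep[OF finJ]) (simp add: map_fst_pair_pmf map_snd_pair_pmf)
  also have "ent ?J fst = ent p (\<lambda>s. s)"
    by (rule ent_cong_distr) (simp add: map_fst_pair_pmf)
  also have "ent ?J snd = ent (replicate_pmf n p) (\<lambda>s. s)"
    by (rule ent_cong_distr) (simp add: map_snd_pair_pmf)
  finally show ?case using Suc.IH by (simp add: algebra_simps)
qed

lemma cent_cong:
  assumes "\<And>w. w \<in> set_pmf P \<Longrightarrow> X w = X' w" "\<And>w. w \<in> set_pmf P \<Longrightarrow> Z w = Z' w"
  shows "cent P X Z = cent P X' Z'"
  unfolding cent_def by (intro arg_cong2[where f = "(-)"] ent_cong) (auto simp: assms)

lemma finite_msgs [simp]: "finite (msgs n R)" by (simp add: msgs_def)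

text \<open>Rounding up costs at most one bit: for R >= 0 the argument of the ceiling is at least 1,
  so the ceiling at most doubles it.\<close>

lemma card_msgs: "real (card (msgs n R)) \<ge> 2 powr (n * R)" "0 \<le> R \<Longrightarrow> real (card (msgs n R)) \<le> 2 powr (n * R + 1)"
proof -
  have c: "real (card (msgs n R)) = of_int \<lceil>2 powr (n * R)\<rceil>"
    by (simp add: msgs_def)
  show "real (card (msgs n R)) \<ge> 2 powr (n * R)" unfolding c by simp
  assume "0 \<le> R"
  then have "1 \<le> 2 powr (n * R)" by (simp add: ge_one_powr_ge_zero)
  moreover have "2 powr (n * R + 1) = 2 * 2 powr (n * R)" by (simp add: powr_add)
  ultimately show "real (card (msgs n R)) \<le> 2 powr (n * R + 1)"
    unfolding c using of_int_ceiling_le_add_one[of "2 powr (n * R)"] by linarith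
qed

lemma msgs_nonempty [simp]: "msgs n R \<noteq> {}"
  using card_msgs(1)[of n R] by (auto simp: not_le[symmetric])

text \<open>Sender 2 knows neither the state nor \<open>m1\<close>. In the converse this separates
  T1^n from M2, and the pair (S, X1) at time i from X2 at time i.\<close>

lemma source_pmf_indep:
  "map_pmf (\<lambda>(m1, m2, s). (F m1 s, G m2)) (source_pmf pS n R1 R2) =
   pair_pmf (map_pmf (\<lambda>(m1, m2, s). F m1 s) (source_pmf pS n R1 R2)) (map_pmf (\<lambda>(m1, m2, s). G m2) (source_pmf pS n R1 R2))"
proof -
  let ?U1 = "pmf_of_set (msgs n R1)" and ?U2 = "pmf_of_set (msgs n R2)"
  let ?J = "pair_pmf (pair_pmf ?U1 (replicate_pmf n pS)) ?U2"
  have J: "source_pmf pS n R1 R2 = map_pmf (\<lambda>((m1, s), m2). (m1, m2, s)) ?J"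
    unfolding source_pmf_def pair_pmf_def map_bind_pmf bind_assoc_pmf
    by (simp add: bind_return_pmf bind_commute_pmf[of ?U2])
  have "map_pmf (\<lambda>(m1, m2, s). (F m1 s, G m2)) (source_pmf pS n R1 R2) = map_pmf (\<lambda>(a, b). ((\<lambda>(m1, s). F m1 s) a, G b)) ?J"
    unfolding J by (simp add: pmf.map_comp o_def case_prod_unfold)
  also have "\<dots> = pair_pmf (map_pmf (\<lambda>(m1, s). F m1 s) (map_pmf fst ?J)) (map_pmf G (map_pmf snd ?J))"
    unfolding map_pair map_fst_pair_pmf map_snd_pair_pmf ..
  also have "\<dots> = pair_pmf (map_pmf (\<lambda>(m1, m2, s). F m1 s) (source_pmf pS n R1 R2)) (map_pmf (\<lambda>(m1, m2, s). G m2) (source_pmf pS n R1 R2))"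
    unfolding J by (simp add: pmf.map_comp o_def case_prod_unfold)
  finally show ?thesis .
qed

text \<open>The letters of a code give n points of \<open>rate_vecs\<close>, and their average lies
  in the convex hull, so the uniform time index need not appear as a random variable. In
  \<open>\<eta>\<close>, the 2/n stands for Fano's bit and for the bit lost by rounding the message
  sets, the latter weighted by \<open>\<epsilon> \<le> 1\<close>.\<close>

lemma converse_block:
  fixes pS :: "'s::finite pmf"
    and y1 :: "'x1::finite \<Rightarrow> 's \<Rightarrow> 'y1::finite"
    and t1 :: "'x1 \<Rightarrow> 's \<Rightarrow> 't1::finite"
    and y2 :: "'x2::finite \<Rightarrow> 't1 \<Rightarrow> 'y2::finite"
  assumes injective: "\<And>x2. inj (y2 x2)"
    and code: "is_code pS y1 t1 y2 n R1 R2 \<epsilon> f1 f2 g1 g2"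
    and n: "0 < n" and R: "0 \<le> R1" "0 \<le> R2" and \<epsilon>: "0 \<le> \<epsilon>" "\<epsilon> \<le> 1"
  defines "\<eta> \<equiv> 2 / n + \<epsilon> * (R1 + R2)"
  shows "\<exists>w\<in>convex hull (rate_vecs pS y1 t1 y2). meets (R1 - \<eta>, R2 - \<eta>) w"
proof -
  define P where "P = source_pmf pS n R1 R2"
  define M1 :: "nat \<times> nat \<times> 's list \<Rightarrow> nat" where "M1 = (\<lambda>(m1, m2, s). m1)"
  define M2 :: "nat \<times> nat \<times> 's list \<Rightarrow> nat" where "M2 = (\<lambda>(m1, m2, s). m2)"
  define S :: "nat \<times> nat \<times> 's list \<Rightarrow> 's list" where "S = (\<lambda>(m1, m2, s). s)"
  define Si where "Si = (\<lambda>i w. S w ! i)"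
  \<comment> \<open>Positions in words count from 0, encoding functions from 1, hence
    \<open>Suc i\<close>.\<close>
  define Xi where "Xi = (\<lambda>i w. f1 (Suc i) (M1 w) (S w))"
  define Vi where "Vi = (\<lambda>i w. f2 (Suc i) (M2 w))"
  define Ti where "Ti = (\<lambda>i w. t1 (Xi i w) (Si i w))"
  define Yi where "Yi = (\<lambda>i w. y1 (Xi i w) (Si i w))"
  define Zi where "Zi = (\<lambda>i w. y2 (Vi i w) (Ti i w))"
  define T where "T = (\<lambda>w. map (\<lambda>i. Ti i w) [0..<n])"
  define Y where "Y = (\<lambda>w. map (\<lambda>i. Yi i w) [0..<n])"
  define Z where "Z = (\<lambda>w. map (\<lambda>i. Zi i w) [0..<n])"
  have fin: "finite (set_pmf P)"
    by (simp add: P_def source_pmf_def finite_set_replicate_pmf)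
  have len: "length (S w) = n" if "w \<in> set_pmf P" for w
    using that by (auto simp: P_def source_pmf_def S_def set_replicate_pmf)
  have S_map: "S w = map (\<lambda>i. Si i w) [0..<n]" if "w \<in> set_pmf P" for w
    using len[OF that] by (auto simp: Si_def intro!: nth_equalityI)
  have w1: "word1 n f1 (M1 w) (S w) = map (\<lambda>i. Xi i w) [0..<n]" for w
    unfolding word1_def Xi_def by (rule nth_equalityI) (auto simp del: upt_Suc)
  have w2: "word2 n f2 (M2 w) = map (\<lambda>i. Vi i w) [0..<n]" for w
    unfolding word2_def Vi_def by (rule nth_equalityI) (auto simp del: upt_Suc)
  have Tw: "map2 t1 (word1 n f1 (M1 w) (S w)) (S w) = T w" if "w \<in> set_pmf P" for w
    unfolding w1 by (rule nth_equalityI) (auto simp: T_def Ti_def Si_def len[OF that])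
  have Yw: "map2 y1 (word1 n f1 (M1 w) (S w)) (S w) = Y w" if "w \<in> set_pmf P" for w
    unfolding w1 by (rule nth_equalityI) (auto simp: Y_def Yi_def Si_def len[OF that])
  have Zw: "map2 y2 (word2 n f2 (M2 w)) (T w) = Z w" for w
    unfolding w2 by (auto simp: T_def Z_def Zi_def intro!: nth_equalityI)
  let ?F1 = "1 + \<epsilon> * log 2 (card (msgs n R1))" and ?F2 = "1 + \<epsilon> * log 2 (card (msgs n R2))"
  have M: "map_pmf M1 P = pmf_of_set (msgs n R1)" "map_pmf M2 P = pmf_of_set (msgs n R2)"
    "map_pmf S P = replicate_pmf n pS"
  proof -
    have "map_pmf M1 P = map_pmf fst P" "map_pmf M2 P = map_pmf fst (map_pmf snd P)"
      "map_pmf S P = map_pmf snd (map_pmf snd P)"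
      by (simp_all add: M1_def M2_def S_def pmf.map_comp o_def case_prod_unfold)
    then show "map_pmf M1 P = pmf_of_set (msgs n R1)" "map_pmf M2 P = pmf_of_set (msgs n R2)"
      "map_pmf S P = replicate_pmf n pS"
      by (simp_all only: P_def source_pmf_def map_fst_pair_pmf map_snd_pair_pmf)
  qed
  have entM: "ent P M1 = log 2 (card (msgs n R1))" "ent P M2 = log 2 (card (msgs n R2))"
    by (rule ent_uniform; simp add: M)+
  have supp: "M1 ` set_pmf P \<subseteq> msgs n R1" "M2 ` set_pmf P \<subseteq> msgs n R2"
    using M by (metis set_map_pmf set_pmf_of_set finite_msgs msgs_nonempty subset_refl)+
  have indS: "ent P (\<lambda>w. (M1 w, S w)) = ent P M1 + ent P S"
  proof (rule ent_indep[OF fin])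
    have "map_pmf (\<lambda>w. (M1 w, S w)) P = pair_pmf (pmf_of_set (msgs n R1)) (map_pmf snd (pair_pmf (pmf_of_set (msgs n R2)) (replicate_pmf n pS)))"
      unfolding P_def source_pmf_def pair_map_pmf2 by (auto simp: M1_def S_def intro!: map_pmf_cong)
    then show "map_pmf (\<lambda>w. (M1 w, S w)) P = pair_pmf (map_pmf M1 P) (map_pmf S P)"
      by (simp add: map_snd_pair_pmf M)
  qed
  have indT: "ent P (\<lambda>w. (M2 w, T w)) = ent P M2 + ent P T"
  proof -
    have "ent P (\<lambda>w. (T w, M2 w)) = ent P T + ent P M2"
    proof (rule ent_indep[OF fin])
      let ?F = "\<lambda>m1 s. map (\<lambda>i. t1 (f1 (Suc i) m1 s) (s ! i)) [0..<n]"
      have "T = (\<lambda>(m1, m2, s). ?F m1 s)" "M2 = (\<lambda>(m1, m2, s). m2)"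
        by (auto simp: T_def Ti_def Xi_def Si_def M1_def S_def M2_def fun_eq_iff)
      then show "map_pmf (\<lambda>w. (T w, M2 w)) P = pair_pmf (map_pmf T P) (map_pmf M2 P)"
        using source_pmf_indep[of ?F "\<lambda>m2. m2" pS n R1 R2] by (simp add: P_def case_prod_unfold)
    qed
    moreover have "ent P (\<lambda>w. (M2 w, T w)) = ent P (\<lambda>w. (T w, M2 w))"
      by (rule ent_eq_of_function[OF fin, where f = "\<lambda>(a, b). (b, a)" and g = "\<lambda>(a, b). (b, a)"]) auto
    ultimately show ?thesis by simp
  qed
  have fano1: "cent P M1 Y \<le> ?F1"
  proof (rule fano_inequality[OF fin _ _ supp(1), where g = g1])
    have "pr P {w. g1 (Y w) \<noteq> M1 w} = pr P {(m1, m2, s). g1 (map2 y1 (word1 n f1 m1 s) s) \<noteq> m1}"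
      by (rule measure_pmf.finite_measure_eq_AE)
        (use Yw in \<open>auto simp: AE_measure_pmf_iff M1_def S_def\<close>)
    then show "pr P {w. g1 (Y w) \<noteq> M1 w} \<le> \<epsilon>"
      using code by (simp add: is_code_def P_def)
  qed auto
  have fano2: "cent P M2 Z \<le> ?F2"
  proof (rule fano_inequality[OF fin _ _ supp(2), where g = g2])
    have "pr P {w. g2 (Z w) \<noteq> M2 w}
        = pr P {(m1, m2, s). g2 (map2 y2 (word2 n f2 m2) (map2 t1 (word1 n f1 m1 s) s)) \<noteq> m2}"
      by (rule measure_pmf.finite_measure_eq_AE)
        (use Tw Zw in \<open>auto simp: AE_measure_pmf_iff M1_def S_def M2_def\<close>)
    then show "pr P {w. g2 (Z w) \<noteq> M2 w} \<le> \<epsilon>"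
      using code by (simp add: is_code_def P_def)
  qed auto
  have b1: "ent P M1 \<le> cent P Y S + ?F1"
  proof -
    have "ent P (\<lambda>w. (M1 w, S w)) \<le> ent P (\<lambda>w. (M1 w, Y w, S w))"
      by (rule ent_le_of_function[OF fin, where f = "\<lambda>(m, y, s). (m, s)"]) auto
    moreover have "cent P M1 (\<lambda>w. (Y w, S w)) \<le> cent P M1 Y"
      using cent_comp_ge[OF fin, of M1 "\<lambda>w. (Y w, S w)" fst] by simp
    ultimately show ?thesis using fano1 indS by (simp add: cent_def)
  qed
  \<comment> \<open>T is revealed along with Y. The resulting term H(T|S) is kept because it
    combines with the -H(T) of \<open>b4\<close> to -I(T;S) in the sum-rate bound.\<close>
  have b2: "ent P M1 \<le> cent P Y (\<lambda>w. (T w, S w)) + ent P (\<lambda>w. (T w, S w)) - ent P S + ?F1"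
  proof -
    have "ent P (\<lambda>w. (M1 w, S w)) \<le> ent P (\<lambda>w. (M1 w, Y w, (T w, S w)))"
      by (rule ent_le_of_function[OF fin, where f = "\<lambda>(m, y, (t, s)). (m, s)"]) auto
    moreover have "cent P M1 (\<lambda>w. (Y w, (T w, S w))) \<le> cent P M1 Y"
      using cent_comp_ge[OF fin, of M1 "\<lambda>w. (Y w, (T w, S w))" fst] by simp
    ultimately show ?thesis using fano1 indS by (simp add: cent_def)
  qed
  have b3: "ent P M2 \<le> cent P Z T + ?F2"
  proof -
    have "ent P (\<lambda>w. (M2 w, T w)) \<le> ent P (\<lambda>w. (M2 w, Z w, T w))"
      by (rule ent_le_of_function[OF fin, where f = "\<lambda>(m, y, s). (m, s)"]) auto
    moreover have "cent P M2 (\<lambda>w. (Z w, T w)) \<le> cent P M2 Z"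
      using cent_comp_ge[OF fin, of M2 "\<lambda>w. (Z w, T w)" fst] by simp
    ultimately show ?thesis using fano2 indT by (simp add: cent_def)
  qed
  have b4: "ent P M2 \<le> ent P Z - ent P T + ?F2"
  proof -
    have "ent P (\<lambda>w. (M2 w, T w)) \<le> ent P (\<lambda>w. (M2 w, Z w))"
    proof (rule ent_le_of_function[OF fin, where f = "\<lambda>(m, z). (m, map2 (\<lambda>x z. inv (y2 x) z) (word2 n f2 m) z)"])
      fix w assume "w \<in> set_pmf P"
      have "map2 (\<lambda>x z. inv (y2 x) z) (word2 n f2 (M2 w)) (Z w) = T w"
        unfolding w2 by (auto simp: T_def Z_def Zi_def inv_f_f[OF injective] intro!: nth_equalityI)
      then show "(M2 w, T w) = (\<lambda>(m, z). (m, map2 (\<lambda>x z. inv (y2 x) z) (word2 n f2 m) z)) (M2 w, Z w)"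
        by simp
    qed
    then show ?thesis using fano2 indT by (simp add: cent_def)
  qed
  \<comment> \<open>Equivalently H(T) is at least I(T;S), which turns \<open>b4\<close> into the
    third bound.\<close>
  have TSn: "ent P S \<le> ent P (\<lambda>w. (T w, S w))"
    by (rule ent_le_of_function[OF fin, where f = snd]) auto
  have sum_list_upt: "(\<Sum>i\<leftarrow>[0..<n]. h i) = (\<Sum>i<n. h i)" for h :: "nat \<Rightarrow> real"
    by (simp add: interv_sum_list_conv_sum_set_nat atLeast0LessThan)
  have s1: "cent P Y S \<le> (\<Sum>i<n. cent P (Yi i) (Si i))"
    using cent_map_le_sum[OF fin, of Yi "[0..<n]" S "\<lambda>i s. s ! i"]
    unfolding Y_def Si_def sum_list_upt .
  have nthT: "T w ! i = Ti i w" if "i < n" for i w using that by (simp add: T_def)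
  have s2: "cent P Y (\<lambda>w. (T w, S w)) \<le> (\<Sum>i<n. cent P (Yi i) (\<lambda>w. (Ti i w, Si i w)))"
    using cent_map_le_sum[OF fin, of Yi "[0..<n]" "\<lambda>w. (T w, S w)" "\<lambda>i (t, s). (t ! i, s ! i)"]
    unfolding Y_def Si_def sum_list_upt by (simp add: nthT)
  have s3: "cent P Z T \<le> (\<Sum>i<n. cent P (Zi i) (Ti i))"
    using cent_map_le_sum[OF fin, of Zi "[0..<n]" T "\<lambda>i t. t ! i"]
    unfolding Z_def sum_list_upt by (simp add: nthT)
  have s4: "ent P Z \<le> (\<Sum>i<n. ent P (Zi i))"
    using ent_map_le_sum[OF fin, of Zi "[0..<n]"] unfolding Z_def sum_list_upt .
  have distS: "map_pmf (Si i) P = pS" if "i < n" for i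
  proof -
    have "map_pmf (Si i) P = map_pmf (\<lambda>s. s ! i) (map_pmf S P)" by (simp add: pmf.map_comp o_def Si_def)
    then show ?thesis using that by (simp add: M map_nth_replicate_pmf)
  qed
  have s5: "ent P S = (\<Sum>i<n. ent P (Si i))"
  proof -
    have "ent P S = ent (replicate_pmf n pS) (\<lambda>s. s)" by (rule ent_cong_distr) (simp add: M)
    also have "\<dots> = (\<Sum>i<n. ent pS (\<lambda>s. s))" by (simp add: ent_replicate_pmf)
    also have "\<dots> = (\<Sum>i<n. ent P (Si i))"
      by (intro sum.cong refl ent_cong_distr) (simp add: distS)
    finally show ?thesis .
  qed
  \<comment> \<open>H(S|T) is at most the sum of the letterwise H(S|T), while H(S) is exactly
    additive by \<open>s5\<close>. Hence I(T;S) is at least the sum of the letterwise informations,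
    the direction needed for a term with a minus sign.\<close>
  have s6: "ent P (\<lambda>w. (T w, S w)) - ent P T \<le> (\<Sum>i<n. ent P (\<lambda>w. (Ti i w, Si i w)) - ent P (Ti i))"
  proof -
    have sw: "cent P A B = ent P (\<lambda>w. (B w, A w)) - ent P B"
      for A :: "nat \<times> nat \<times> 's list \<Rightarrow> 'e" and B :: "nat \<times> nat \<times> 's list \<Rightarrow> 'f"
      unfolding cent_def
      by (subst ent_eq_of_function[OF fin, where f = "\<lambda>(a, b). (b, a)" and g = "\<lambda>(a, b). (b, a)"]) auto
    have "cent P S T = cent P (\<lambda>w. map (\<lambda>i. Si i w) [0..<n]) T"
      by (rule cent_cong) (auto simp: S_map)
    also have "\<dots> \<le> (\<Sum>i<n. cent P (Si i) (Ti i))"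
      using cent_map_le_sum[OF fin, of Si "[0..<n]" T "\<lambda>i t. t ! i"]
      unfolding sum_list_upt by (simp add: nthT)
    finally show ?thesis by (simp add: sw)
  qed
  define L where "L = (\<lambda>i w. (Si i w, Xi i w, Vi i w))"
  define v where "v = (\<lambda>i. rate_vec y1 t1 y2 (map_pmf (L i) P))"
  have v: "v i \<in> rate_vecs pS y1 t1 y2" if "i < n" for i
  proof -
    have "map_pmf (\<lambda>w. ((Si i w, Xi i w), Vi i w)) P = pair_pmf (map_pmf (\<lambda>w. (Si i w, Xi i w)) P) (map_pmf (Vi i) P)"
      using source_pmf_indep[of "\<lambda>m1 s. (s ! i, f1 (Suc i) m1 s)" "f2 (Suc i)" pS n R1 R2]
      by (simp add: P_def Si_def Xi_def Vi_def M1_def M2_def S_def case_prod_unfold)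
    from map_pmf_eq_input_pmf[OF distS[OF that] this] obtain k p
      where "map_pmf (L i) P = input_pmf pS k p" unfolding L_def by blast
    then have "v i = rate_vec y1 t1 y2 (input_pmf pS k p)" by (simp add: v_def)
    then show ?thesis unfolding rate_vecs_def by blast
  qed
  have veq: "v i = (cent P (Yi i) (Si i), cent P (Zi i) (Ti i),
      ent P (Zi i) - (ent P (Ti i) + ent P (Si i) - ent P (\<lambda>w. (Ti i w, Si i w))),
      cent P (Yi i) (\<lambda>w. (Ti i w, Si i w)) + ent P (Zi i) - (ent P (Ti i) + ent P (Si i) - ent P (\<lambda>w. (Ti i w, Si i w))))" for i
    unfolding v_def rate_vec_def Let_def cent_def ent_map
    by (simp add: L_def Yi_def Ti_def Zi_def case_prod_unfold)
  define w where "w = (\<Sum>i<n. (1 / n) *\<^sub>R v i)"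
  have "w \<in> convex hull (rate_vecs pS y1 t1 y2)"
    unfolding w_def using n v by (intro convex_sum) (auto intro!: hull_inc)
  moreover have "meets (R1 - \<eta>, R2 - \<eta>) w"
  proof -
    have pos: "0 < card (msgs n R)" for R by (simp add: card_gt_0_iff)
    have lo: "n * R1 \<le> ent P M1" "n * R2 \<le> ent P M2"
      unfolding entM using card_msgs(1)[of n R1] card_msgs(1)[of n R2]
      by (simp_all add: le_log_iff pos)
    have hi: "log 2 (card (msgs n R1)) \<le> n * R1 + 1" "log 2 (card (msgs n R2)) \<le> n * R2 + 1"
      using card_msgs(2)[OF R(1), of n] card_msgs(2)[OF R(2), of n] card_msgs(1)[of n R1] card_msgs(1)[of n R2]
      by (simp_all add: log_le_iff pos)
    have F: "?F1 \<le> n * \<eta>" "?F2 \<le> n * \<eta>"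
    proof -
      have "n * \<eta> = 2 + \<epsilon> * (n * R1 + n * R2)" using n by (simp add: \<eta>_def field_simps)
      moreover have "\<epsilon> * log 2 (card (msgs n R1)) \<le> \<epsilon> * (n * R1 + 1)"
        "\<epsilon> * log 2 (card (msgs n R2)) \<le> \<epsilon> * (n * R2 + 1)"
        using hi \<epsilon> by (intro mult_left_mono; simp)+
      moreover have "0 \<le> \<epsilon> * (n * R1)" "0 \<le> \<epsilon> * (n * R2)" using \<epsilon> R by simp_all
      ultimately show "?F1 \<le> n * \<eta>" "?F2 \<le> n * \<eta>" using \<epsilon> by (auto simp: algebra_simps)
    qed
    let ?I = "\<lambda>i. ent P (Ti i) + ent P (Si i) - ent P (\<lambda>w. (Ti i w, Si i w))"
    have m: "n * (R1 - \<eta>) \<le> (\<Sum>i<n. cent P (Yi i) (Si i))"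
      "n * (R2 - \<eta>) \<le> (\<Sum>i<n. cent P (Zi i) (Ti i))"
      "n * (R2 - \<eta>) \<le> (\<Sum>i<n. ent P (Zi i) - ?I i)"
      "n * ((R1 - \<eta>) + (R2 - \<eta>)) \<le> (\<Sum>i<n. cent P (Yi i) (\<lambda>w. (Ti i w, Si i w)) + ent P (Zi i) - ?I i)"
      using b1 b2 b3 b4 s1 s2 s3 s4 s5 s6 lo F TSn
      by (simp_all add: sum.distrib sum_subtractf right_diff_distrib distrib_left)
    have "meets (R1 - \<eta>, R2 - \<eta>) ((1 / n) *\<^sub>R (\<Sum>i<n. v i))"
      unfolding veq using m n
      by (simp add: meets_def case_prod_unfold fst_sum snd_sum pos_le_divide_eq mult.commute)
    then show ?thesis by (simp add: w_def scaleR_sum_right)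
  qed
  ultimately show ?thesis by blast
qed

lemma achievable_in_rate_region:
  fixes pS :: "'s::finite pmf"
    and y1 :: "'x1::finite \<Rightarrow> 's \<Rightarrow> 'y1::finite"
    and t1 :: "'x1 \<Rightarrow> 's \<Rightarrow> 't1::finite"
    and y2 :: "'x2::finite \<Rightarrow> 't1 \<Rightarrow> 'y2::finite"
  assumes injective: "\<And>x2. inj (y2 x2)" and ach: "achievable pS y1 t1 y2 R"
  shows "R \<in> rate_region pS y1 t1 y2"
proof -
  obtain R1 R2 where R: "R = (R1, R2)" by (cases R)
  have R0: "0 \<le> R1" "0 \<le> R2"
    and ex: "\<And>\<epsilon>. \<epsilon> > 0 \<Longrightarrow> \<forall>\<^sub>F n in sequentially. \<exists>f1 f2 g1 g2. is_code pS y1 t1 y2 n R1 R2 \<epsilon> f1 f2 g1 g2"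
    using ach unfolding achievable_def R by auto
  \<comment> \<open>No sign condition here, because the shifted pairs may have negative coordinates;
    nonnegativity of R itself is added at the end.\<close>
  let ?A = "{R. \<exists>w\<in>convex hull (rate_vecs pS y1 t1 y2). meets R w}"
  have A: "closed ?A" by (intro closed_meets compact_convex_hull compact_rate_vecs)
  have mem: "(R1 - \<delta>, R2 - \<delta>) \<in> ?A" if "0 < \<delta>" for \<delta>
  proof -
    \<comment> \<open>One half of \<delta> pays for \<open>\<epsilon> * (R1 + R2)\<close>, the other
      for 2/n; the added 1 keeps the denominator positive when both rates vanish.\<close>
    define \<epsilon> where "\<epsilon> = min 1 (\<delta> / (2 * (R1 + R2 + 1)))"
    have \<epsilon>: "0 < \<epsilon>" "\<epsilon> \<le> 1" using that R0 by (auto simp: \<epsilon>_def)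
    have "\<epsilon> * (R1 + R2) \<le> \<delta> / 2"
    proof -
      have "\<epsilon> * (R1 + R2) \<le> \<delta> / (2 * (R1 + R2 + 1)) * (R1 + R2 + 1)"
        using R0 that by (intro mult_mono) (auto simp: \<epsilon>_def)
      also have "\<dots> = \<delta> / 2" using R0 by (simp add: field_simps)
      finally show ?thesis .
    qed
    have "((\<lambda>n. 2 / real n) \<longlongrightarrow> 0) sequentially" by (rule lim_const_over_n)
    then have "\<forall>\<^sub>F n in sequentially. 2 / real n < \<delta> / 2"
      by (rule order_tendstoD) (use that in simp)
    then have "\<forall>\<^sub>F n in sequentially. 2 / real n < \<delta> / 2 \<and> 0 < n \<and>
        (\<exists>f1 f2 g1 g2. is_code pS y1 t1 y2 n R1 R2 \<epsilon> f1 f2 g1 g2)"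
      using ex[OF \<epsilon>(1)] eventually_gt_at_top[of 0] by (simp add: eventually_conj_iff)
    then obtain n f1 f2 g1 g2 where n: "2 / real n < \<delta> / 2" "0 < n" "is_code pS y1 t1 y2 n R1 R2 \<epsilon> f1 f2 g1 g2"
      by (auto dest!: eventually_happens)
    obtain w where w: "w \<in> convex hull (rate_vecs pS y1 t1 y2)"
      "meets (R1 - (2 / n + \<epsilon> * (R1 + R2)), R2 - (2 / n + \<epsilon> * (R1 + R2))) w"
      using converse_block[OF injective n(3,2) R0 less_imp_le[OF \<epsilon>(1)] \<epsilon>(2)] by blast
    moreover have "meets (R1 - \<delta>, R2 - \<delta>) w"
      using w(2) n(1) \<open>\<epsilon> * (R1 + R2) \<le> \<delta> / 2\<close> by (cases w) (simp add: meets_def)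
    ultimately show ?thesis by blast
  qed
  have "R \<in> ?A"
  proof (rule closed_sequentially[OF A])
    show "(R1 - 1 / real (Suc n), R2 - 1 / real (Suc n)) \<in> ?A" for n by (rule mem) simp
    have "(\<lambda>n. (R1 - 1 / real (Suc n), R2 - 1 / real (Suc n))) \<longlonglongrightarrow> (R1 - 0, R2 - 0)"
      by (intro tendsto_intros LIMSEQ_Suc[OF lim_1_over_n])
    then show "(\<lambda>n. (R1 - 1 / real (Suc n), R2 - 1 / real (Suc n))) \<longlonglongrightarrow> R" by (simp add: R)
  qed
  then show ?thesis using R0 unfolding rate_region_eq_hull by (simp add: R)
qed

section \<open>Soft covering and the likelihood encoder\<close>

lemma finite_set_Pi_pmf:
  assumes "finite A" "\<And>i. i \<in> A \<Longrightarrow> finite (set_pmf (p i))"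
  shows "finite (set_pmf (Pi_pmf A d p))"
  using assms by (auto simp: set_Pi_pmf)

lemma expect_Pi_pmf_insert:
  assumes "finite A" "i \<notin> A" "\<And>j. j \<in> insert i A \<Longrightarrow> finite (set_pmf (p j))"
  shows "expect (Pi_pmf (insert i A) d p) h = expect (p i) (\<lambda>x. expect (Pi_pmf A d p) (\<lambda>f. h (f(i := x))))"
proof -
  have "expect (Pi_pmf (insert i A) d p) h = expect (pair_pmf (p i) (Pi_pmf A d p)) (\<lambda>(x, f). h (f(i := x)))"
    unfolding Pi_pmf_insert[OF assms(1,2)] by (simp add: case_prod_unfold)
  then show ?thesis using assms by (simp add: expect_pair finite_set_Pi_pmf)
qed

lemma expect_Pi_pmf_component:
  assumes "finite A" "i \<in> A"
  shows "expect (Pi_pmf A d p) (\<lambda>f. h (f i)) = expect (p i) h"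
proof -
  have "expect (p i) h = expect (map_pmf (\<lambda>f. f i) (Pi_pmf A d p)) h"
    using assms by (simp only: Pi_pmf_component if_True)
  then show ?thesis by simp
qed

lemma expect_Pi_pmf_two:
  assumes fin: "finite A" and ij: "i \<in> A" "j \<in> A" "i \<noteq> j"
    and "\<And>i. i \<in> A \<Longrightarrow> finite (set_pmf (p i))"
  shows "expect (Pi_pmf A d p) (\<lambda>f. h (f i) (f j)) = expect (p i) (\<lambda>x. expect (p j) (h x))"
proof -
  have A: "A = insert i (A - {i})" using ij by auto
  have "expect (Pi_pmf A d p) (\<lambda>f. h (f i) (f j)) = expect (Pi_pmf (insert i (A - {i})) d p) (\<lambda>f. h (f i) (f j))"
    using A by simp
  also have "\<dots> = expect (p i) (\<lambda>x. expect (Pi_pmf (A - {i}) d p) (\<lambda>f. h x (f j)))"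
    using assms by (subst expect_Pi_pmf_insert) auto
  also have "\<dots> = expect (p i) (\<lambda>x. expect (p j) (h x))"
    using assms by (simp add: expect_Pi_pmf_component)
  finally show ?thesis .
qed

lemma expect_sum: "finite (set_pmf P) \<Longrightarrow> expect P (\<lambda>w. \<Sum>i\<in>I. f i w) = (\<Sum>i\<in>I. expect P (f i))"
  by (simp add: integrable_measure_pmf_finite)

text \<open>Peeling off one coordinate at a time, the cross terms factor by independence, which
  leaves the squared mean plus the variances.\<close>

lemma expect_Pi_pmf_sum_square:
  assumes "finite A" "\<And>i. i \<in> A \<Longrightarrow> finite (set_pmf (p i))"
  shows "expect (Pi_pmf A d p) (\<lambda>f. (\<Sum>i\<in>A. g i (f i))\<^sup>2)
    = (\<Sum>i\<in>A. expect (p i) (g i))\<^sup>2 + (\<Sum>i\<in>A. expect (p i) (\<lambda>x. (g i x)\<^sup>2) - (expect (p i) (g i))\<^sup>2)"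
  using assms
proof (induction A rule: finite_induct)
  case empty
  then show ?case by simp
next
  case (insert i A)
  have fins: "finite (set_pmf (p i))" "finite (set_pmf (Pi_pmf A d p))"
    using insert by (auto intro!: finite_set_Pi_pmf)
  have eq: "(\<Sum>j\<in>insert i A. g j ((f(i := x)) j)) = g i x + (\<Sum>j\<in>A. g j (f j))" for f x
    using insert by (simp cong: sum.cong add: sum.insert) (intro sum.cong, auto)
  have m1: "expect (Pi_pmf A d p) (\<lambda>f. \<Sum>j\<in>A. g j (f j)) = (\<Sum>j\<in>A. expect (p j) (g j))"
    using insert fins by (simp add: expect_sum expect_Pi_pmf_component)
  let ?X = "\<Sum>j\<in>A. expect (p j) (g j)" and ?Y = "expect (Pi_pmf A d p) (\<lambda>f. (\<Sum>j\<in>A. g j (f j))\<^sup>2)"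
  have "expect (Pi_pmf (insert i A) d p) (\<lambda>f. (\<Sum>j\<in>insert i A. g j (f j))\<^sup>2)
     = expect (p i) (\<lambda>x. expect (Pi_pmf A d p) (\<lambda>f. (g i x + (\<Sum>j\<in>A. g j (f j)))\<^sup>2))"
    using insert by (subst expect_Pi_pmf_insert) (auto simp only: eq)
  also have "\<dots> = expect (p i) (\<lambda>x. ((g i x)\<^sup>2 + ?Y) + 2 * ?X * g i x)"
    using fins by (simp add: power2_sum expect_add m1 mult_ac)
  also have "\<dots> = expect (p i) (\<lambda>x. (g i x)\<^sup>2) + ?Y + 2 * ?X * expect (p i) (g i)"
    using fins by (simp add: expect_add)
  finally show ?case
    using insert by (simp add: power2_sum algebra_simps)
qed

text \<open>Jensen's inequality, read off from the nonnegative variance of |f|.\<close>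

lemma expect_abs_le_of_square:
  assumes "finite (set_pmf P)" "expect P (\<lambda>w. (f w)\<^sup>2) \<le> c\<^sup>2" "0 \<le> c"
  shows "expect P (\<lambda>w. \<bar>f w\<bar>) \<le> c"
proof -
  let ?m = "expect P (\<lambda>w. \<bar>f w\<bar>)"
  have "0 \<le> expect P (\<lambda>w. (\<bar>f w\<bar> - ?m)\<^sup>2)" by simp
  also have "expect P (\<lambda>w. (\<bar>f w\<bar> - ?m)\<^sup>2) = expect P (\<lambda>w. ((f w)\<^sup>2 - 2 * ?m * \<bar>f w\<bar>) + ?m\<^sup>2)"
    by (intro expect_cong) (simp add: power2_diff mult_ac)
  also have "\<dots> = expect P (\<lambda>w. (f w)\<^sup>2) - ?m\<^sup>2"
    using assms(1) by (subst expect_add, simp, subst expect_diff, simp) (simp add: power2_eq_square)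
  finally have "?m\<^sup>2 \<le> c\<^sup>2" using assms(2) by simp
  then show ?thesis using assms(3) by (rule power2_le_imp_le)
qed

lemma sum_pmf_le_pmf_map:
  assumes "finite I" "inj_on g I" "\<And>i. i \<in> I \<Longrightarrow> f (g i) = c"
  shows "(\<Sum>i\<in>I. pmf W (g i)) \<le> pmf (map_pmf f W) c"
proof -
  have "(\<Sum>i\<in>I. pmf W (g i)) = measure (measure_pmf W) (g ` I)"
    using assms by (simp add: measure_measure_pmf_finite sum.reindex)
  also have "\<dots> \<le> measure (measure_pmf W) (f -` {c})"
    using assms by (intro measure_pmf.finite_measure_mono) auto
  finally show ?thesis by (simp add: pmf_map)
qed

lemma sum_pmf_eq_pmf_map:
  assumes "finite I" "inj_on g I" "\<And>i. i \<in> I \<Longrightarrow> f (g i) = c"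
    "\<And>x. x \<in> set_pmf W \<Longrightarrow> f x = c \<Longrightarrow> x \<in> g ` I"
  shows "(\<Sum>i\<in>I. pmf W (g i)) = pmf (map_pmf f W) c"
proof -
  have "(\<Sum>i\<in>I. pmf W (g i)) = measure (measure_pmf W) (g ` I)"
    using assms by (simp add: measure_measure_pmf_finite sum.reindex)
  also have "\<dots> = measure (measure_pmf W) (f -` {c})"
    using assms by (intro measure_pmf.finite_measure_eq_AE) (auto simp: AE_measure_pmf_iff)
  finally show ?thesis by (simp add: pmf_map)
qed

text \<open>The probabilistic method: random codebooks, colourings and time-sharing words are
  replaced by fixed ones through this lemma.\<close>

lemma exists_le_expect:
  assumes "finite (set_pmf P)" "expect P f \<le> c"
  shows "\<exists>w\<in>set_pmf P. f w \<le> c"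
proof (rule ccontr)
  assume "\<not> ?thesis"
  then have gt: "\<And>w. w \<in> set_pmf P \<Longrightarrow> c < f w" by force
  have "c = (\<Sum>w\<in>set_pmf P. pmf P w * c)"
    using assms(1) by (simp flip: sum_distrib_right add: sum_pmf_eq_1)
  also have "\<dots> < (\<Sum>w\<in>set_pmf P. pmf P w * f w)"
    using assms(1) gt by (intro sum_strict_mono) (auto simp: set_pmf_not_empty pmf_positive)
  also have "\<dots> \<le> c" using assms by (simp add: expect_eq_sum)
  finally show False by simp
qed

text \<open>A one-shot setting. In its application W is the law of (S^n, T1^n, Y1^n) given a fixed
  time-sharing word, so s, t and y stand for whole words.\<close>

locale covering =
  fixes W :: "('s \<times> 't \<times> 'y) pmf"
  assumes finW: "finite (set_pmf W)"
begin

definition "PS = map_pmf fst W"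
definition "PT = map_pmf (\<lambda>(s, t, y). t) W"
definition "Ss = set_pmf PS"
definition "Ts = set_pmf PT"
definition "Ys = (\<lambda>(s, t, y). y) ` set_pmf W"

text \<open>Conditional probability of (s, y) given t, cut down to a typical set A;
  \<open>mass\<close> is the joint probability cut down in the same way. Without truncation atypical
  words could dominate the second moments.\<close>

definition cw :: "('s \<times> 't \<times> 'y) set \<Rightarrow> 's \<Rightarrow> 't \<Rightarrow> 'y \<Rightarrow> real" where
  "cw A s t y = (if (s, t, y) \<in> A then pmf W (s, t, y) / pmf PT t else 0)"

definition mass :: "('s \<times> 't \<times> 'y) set \<Rightarrow> 's \<Rightarrow> 't \<Rightarrow> 'y \<Rightarrow> real" where
  "mass A s t y = (if (s, t, y) \<in> A then pmf W (s, t, y) else 0)"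

text \<open>
  The part on \<open>A\<close> of the law of the state \<open>s\<close> and the colour \<open>m\<close> of \<open>y\<close> when the word index is uniform
  on the codebook \<open>t\<close> and the pair \<open>(s, y)\<close> follows its conditional law given the codeword.
\<close>

definition synth :: "nat \<Rightarrow> ('s \<times> 't \<times> 'y) set \<Rightarrow> (nat \<Rightarrow> 't) \<Rightarrow> ('y \<Rightarrow> nat) \<Rightarrow> 's \<Rightarrow> nat \<Rightarrow> real" where
  "synth L A t b s m = (\<Sum>l<L. \<Sum>y\<in>Ys. cw A s (t l) y * of_bool (b y = m)) / L"

text \<open>The l1 distance between the synthesised law of (state, colour) and its target, in which
  the colour is a uniform message independent of the state.\<close>

definition dev :: "nat \<Rightarrow> nat \<Rightarrow> (nat \<Rightarrow> 't) \<Rightarrow> ('y \<Rightarrow> nat) \<Rightarrow> real" where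
  "dev L M t b = (\<Sum>s\<in>Ss. \<Sum>m=1..M. \<bar>synth L UNIV t b s m - pmf PS s / M\<bar>)"

definition codebook :: "nat \<Rightarrow> (nat \<Rightarrow> 't) pmf" where
  "codebook L = Pi_pmf {..<L} undefined (\<lambda>_. PT)"

text \<open>Colours are drawn only for words in the support; the default 1 keeps every value inside
  {1..M}, as the decoder of receiver 1 requires.\<close>

definition binning :: "nat \<Rightarrow> ('y \<Rightarrow> nat) pmf" where
  "binning M = Pi_pmf Ys 1 (\<lambda>_. pmf_of_set {1..M})"

lemma fin [simp]: "finite Ss" "finite Ts" "finite Ys" "finite (set_pmf PS)" "finite (set_pmf PT)"
  "finite (set_pmf W)"
  using finW by (auto simp: Ss_def Ts_def Ys_def PS_def PT_def)

lemma finite_codebook [simp]: "finite (set_pmf (codebook L))"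
  unfolding codebook_def by (rule finite_set_Pi_pmf) auto

lemma finite_binning [simp]: "0 < M \<Longrightarrow> finite (set_pmf (binning M))"
  unfolding binning_def by (rule finite_set_Pi_pmf) auto

lemma codebook_mem: "t \<in> set_pmf (codebook L) \<Longrightarrow> l < L \<Longrightarrow> t l \<in> Ts"
  unfolding codebook_def by (auto simp: set_Pi_pmf PiE_dflt_def Ts_def)

lemma binning_mem: "b \<in> set_pmf (binning M) \<Longrightarrow> 0 < M \<Longrightarrow> b y \<in> {1..M}"
  unfolding binning_def by (cases "y \<in> Ys") (auto simp: set_Pi_pmf PiE_dflt_def)

lemma supp: "(s, t, y) \<in> set_pmf W \<Longrightarrow> s \<in> Ss \<and> t \<in> Ts \<and> y \<in> Ys"
  by (auto simp: Ss_def Ts_def Ys_def PS_def PT_def image_iff intro!: bexI[of _ "(s, t, y)"])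

lemma PT_pos: "t \<in> Ts \<Longrightarrow> 0 < pmf PT t"
  by (simp add: Ts_def pmf_positive)

lemma mass_nonneg [simp]: "0 \<le> mass A s t y" by (simp add: mass_def)
lemma cw_nonneg [simp]: "0 \<le> cw A s t y" by (simp add: cw_def)
lemma synth_nonneg [simp]: "0 \<le> synth L A t b s m"
  unfolding synth_def by (intro divide_nonneg_nonneg sum_nonneg) auto

lemma cw_mass: "t \<in> Ts \<Longrightarrow> pmf PT t * cw A s t y = mass A s t y"
  using PT_pos[of t] by (simp add: cw_def mass_def)

lemma mass_UNIV: "mass UNIV s t y = mass A s t y + mass (- A) s t y"
  by (simp add: mass_def)

lemma synth_UNIV: "synth L UNIV t b s m = synth L A t b s m + synth L (- A) t b s m"
  unfolding synth_def add_divide_distrib[symmetric] sum.distrib[symmetric]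
  by (intro arg_cong2[where f = "(/)"] sum.cong refl) (simp add: cw_def)

lemma sum_mass_UNIV: "(\<Sum>t\<in>Ts. \<Sum>y\<in>Ys. mass UNIV s t y) = pmf PS s"
proof -
  have "(\<Sum>t\<in>Ts. \<Sum>y\<in>Ys. mass UNIV s t y) = (\<Sum>x\<in>Ts \<times> Ys. pmf W (s, x))"
    by (simp add: sum.cartesian_product mass_def case_prod_unfold)
  also have "\<dots> = pmf PS s"
    unfolding PS_def by (rule sum_pmf_eq_pmf_map) (auto simp: inj_on_def dest: supp)
  finally show ?thesis .
qed

lemma sum_mass_le: "(\<Sum>t\<in>Ts. \<Sum>y\<in>Ys. mass A s t y) \<le> pmf PS s"
  unfolding sum_mass_UNIV[symmetric] by (intro sum_mono) (simp add: mass_def)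

lemma sum_mass_total: "(\<Sum>s\<in>Ss. \<Sum>t\<in>Ts. \<Sum>y\<in>Ys. mass A s t y) \<le> pr W A"
proof -
  have "(\<Sum>s\<in>Ss. \<Sum>t\<in>Ts. \<Sum>y\<in>Ys. mass A s t y) = (\<Sum>x\<in>Ss \<times> Ts \<times> Ys. if x \<in> A then pmf W x else 0)"
    by (simp add: sum.cartesian_product mass_def)
  also have "\<dots> = (\<Sum>x\<in>(Ss \<times> Ts \<times> Ys) \<inter> A. pmf W x)"
    by (simp add: sum.inter_restrict)
  also have "\<dots> = pr W ((Ss \<times> Ts \<times> Ys) \<inter> A)"
    by (simp add: measure_measure_pmf_finite)
  also have "\<dots> \<le> pr W A"
    by (intro measure_pmf.finite_measure_mono) auto
  finally show ?thesis .
qed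

lemma expect_PT: "expect PT h = (\<Sum>t\<in>Ts. pmf PT t * h t)"
  unfolding Ts_def by (rule expect_eq_sum) simp

lemma expect_cw: "expect PT (\<lambda>t. cw A s t y) = (\<Sum>t\<in>Ts. mass A s t y)"
  unfolding expect_PT by (intro sum.cong refl cw_mass)

lemma expect_binning_component:
  assumes "0 < M" "m \<in> {1..M}" "y \<in> Ys"
  shows "expect (binning M) (\<lambda>b. of_bool (b y = m)) = 1 / M"
proof -
  have "expect (binning M) (\<lambda>b. of_bool (b y = m)) = expect (pmf_of_set {1..M}) (\<lambda>k. of_bool (k = m))"
    unfolding binning_def using assms by (subst expect_Pi_pmf_component) auto
  also have "\<dots> = 1 / M"
    using assms by (subst expect_eq_sum) (auto simp: sum.delta if_distrib of_bool_def cong: if_cong)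
  finally show ?thesis .
qed

text \<open>The indicators of one colour are independent over y, with mean 1/M and variance 1/M -
  1/M^2; the variance vanishes when M = 1.\<close>

lemma expect_binning_square:
  assumes M: "0 < M" "m \<in> {1..M}"
  shows "expect (binning M) (\<lambda>b. (\<Sum>y\<in>Ys. c y * of_bool (b y = m))\<^sup>2)
    = ((\<Sum>y\<in>Ys. c y) / M)\<^sup>2 + (1 / M - 1 / (real M)\<^sup>2) * (\<Sum>y\<in>Ys. (c y)\<^sup>2)"
proof -
  have e: "expect (pmf_of_set {1..M}) (\<lambda>k. a * of_bool (k = m)) = a / M" for a :: real
    using M by (subst expect_eq_sum) (auto simp: sum.delta if_distrib of_bool_def cong: if_cong)
  have sq: "(c y * of_bool (k = m))\<^sup>2 = (c y)\<^sup>2 * of_bool (k = m)" for y k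
    by simp
  have "expect (binning M) (\<lambda>b. (\<Sum>y\<in>Ys. c y * of_bool (b y = m))\<^sup>2)
      = (\<Sum>y\<in>Ys. c y / M)\<^sup>2 + (\<Sum>y\<in>Ys. (c y)\<^sup>2 / M - (c y / M)\<^sup>2)"
    unfolding binning_def using M
    by (subst expect_Pi_pmf_sum_square[where g = "\<lambda>y k. c y * of_bool (k = m)"]) (auto simp only: e sq fin, auto)
  also have "\<dots> = ((\<Sum>y\<in>Ys. c y) / M)\<^sup>2 + (1 / M - 1 / (real M)\<^sup>2) * (\<Sum>y\<in>Ys. (c y)\<^sup>2)"
    by (simp add: sum_divide_distrib sum_distrib_left power_divide left_diff_distrib)
  finally show ?thesis .
qed

lemma expect_codebook_square:
  assumes L: "0 < L"
  shows "expect (codebook L) (\<lambda>t. ((\<Sum>l<L. F (t l)) / L)\<^sup>2) \<le> (expect PT F)\<^sup>2 + expect PT (\<lambda>t. (F t)\<^sup>2) / L"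
proof -
  have "expect (codebook L) (\<lambda>t. ((\<Sum>l<L. F (t l)) / L)\<^sup>2) = expect (codebook L) (\<lambda>t. (\<Sum>l<L. F (t l))\<^sup>2) / L\<^sup>2"
    by (simp add: power_divide)
  also have "expect (codebook L) (\<lambda>t. (\<Sum>l<L. F (t l))\<^sup>2) = (L * expect PT F)\<^sup>2 + L * (expect PT (\<lambda>t. (F t)\<^sup>2) - (expect PT F)\<^sup>2)"
    unfolding codebook_def by (subst expect_Pi_pmf_sum_square[where g = "\<lambda>_. F"]) auto
  also have "\<dots> / L\<^sup>2 \<le> (expect PT F)\<^sup>2 + expect PT (\<lambda>t. (F t)\<^sup>2) / L"
    using L by (simp add: field_simps power2_eq_square)
  finally show ?thesis .
qed

text \<open>The synthesised weights are unbiased: averaging over a codeword turns p(s,y|t) into a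
  sum of joint probabilities, and averaging over the colour contributes 1/M. The deviations are
  therefore pure variance.\<close>

lemma expect_synth:
  assumes "0 < L" "0 < M" "m \<in> {1..M}"
  shows "expect (pair_pmf (codebook L) (binning M)) (\<lambda>(t, b). synth L A t b s m) = (\<Sum>t\<in>Ts. \<Sum>y\<in>Ys. mass A s t y) / M"
proof -
  have "expect (pair_pmf (codebook L) (binning M)) (\<lambda>(t, b). synth L A t b s m)
     = expect (codebook L) (\<lambda>t. expect (binning M) (\<lambda>b. synth L A t b s m))"
    using assms by (simp add: expect_pair)
  also have "\<dots> = expect (codebook L) (\<lambda>t. (\<Sum>l<L. \<Sum>y\<in>Ys. cw A s (t l) y / M) / L)"
    unfolding synth_def using assms
    by (simp add: expect_sum expect_binning_component del: sum_mult_of_bool_eq)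
  also have "\<dots> = (\<Sum>l<L. \<Sum>y\<in>Ys. expect (codebook L) (\<lambda>t. cw A s (t l) y) / M) / L"
    by (simp add: expect_sum)
  also have "\<dots> = (\<Sum>l<L. \<Sum>y\<in>Ys. (\<Sum>t\<in>Ts. mass A s t y) / M) / L"
    by (intro arg_cong2[where f = "(/)"] sum.cong refl)
      (simp add: codebook_def expect_Pi_pmf_component[where h = "\<lambda>v. cw A s v _"] expect_cw)
  also have "\<dots> = (\<Sum>t\<in>Ts. \<Sum>y\<in>Ys. mass A s t y) / M"
    using assms by (subst sum.swap) (simp add: sum_divide_distrib)
  finally show ?thesis .
qed

text \<open>The variance has three sources: the colouring with the codebook averaged out, the
  codebook with the colours averaged out, and both together. On A they are governed by p(y|s) <=
  \<alpha>, p(s,t) <= \<beta> p(s) p(t) and p(s,t,y) <= \<gamma> p(s) p(t). The terms due to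
  colouring carry the factor M - 1.\<close>

lemma expect_abs_synth_dev:
  assumes LM: "0 < L" "0 < M" "m \<in> {1..M}"
    and nn: "0 \<le> \<alpha>" "0 \<le> \<beta>" "0 \<le> \<gamma>"
    and A1: "\<And>s t y. (s, t, y) \<in> set_pmf W \<inter> A \<Longrightarrow> pmf (map_pmf (\<lambda>(s, t, y). (s, y)) W) (s, y) \<le> \<alpha> * pmf PS s"
    and A2: "\<And>s t y. (s, t, y) \<in> set_pmf W \<inter> A \<Longrightarrow> pmf (map_pmf (\<lambda>(s, t, y). (s, t)) W) (s, t) \<le> \<beta> * pmf PS s * pmf PT t"
    and A3: "\<And>s t y. (s, t, y) \<in> set_pmf W \<inter> A \<Longrightarrow> pmf W (s, t, y) \<le> \<gamma> * pmf PS s * pmf PT t"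
  shows "expect (pair_pmf (codebook L) (binning M)) (\<lambda>(t, b). \<bar>synth L A t b s m - (\<Sum>t\<in>Ts. \<Sum>y\<in>Ys. mass A s t y) / M\<bar>)
    \<le> pmf PS s * sqrt ((real M - 1) * \<alpha> + \<beta> / L + (real M - 1) * \<gamma> / L) / M"
proof -
  let ?C = "pair_pmf (codebook L) (binning M)"
  let ?w = "\<Sum>t\<in>Ts. \<Sum>y\<in>Ys. mass A s t y"
  let ?K = "(real M - 1) * \<alpha> + \<beta> / L + (real M - 1) * \<gamma> / L"
  let ?p = "pmf PS s"
  define a where "a y = (\<Sum>t\<in>Ts. mass A s t y)" for y
  define c where "c t = (\<Sum>y\<in>Ys. cw A s t y)" for t
  \<comment> \<open>Variance of a colour indicator, equal to (M - 1) / M^2.\<close>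
  define r where "r = 1 / real M - 1 / (real M)\<^sup>2"
  have r0: "0 \<le> r" using LM by (simp add: r_def field_simps power2_eq_square)
  have K0: "0 \<le> ?K" using nn LM by simp
  have fins: "finite (set_pmf ?C)" using LM by simp
  have wa: "?w = (\<Sum>y\<in>Ys. a y)" unfolding a_def by (rule sum.swap)
  have mass_nz: "(s, t, y) \<in> set_pmf W \<inter> A" if "mass A s t y \<noteq> 0" for t y
    using that by (auto simp: mass_def set_pmf_iff split: if_splits)
  \<comment> \<open>A sum of squares is at most the largest term times the total. The total is at
    most p(s), and a nonzero term certifies membership in A, which bounds it. \<open>b2\<close> and
    \<open>b3\<close> follow the same pattern.\<close>
  have b1: "(\<Sum>y\<in>Ys. (a y)\<^sup>2) \<le> \<alpha> * ?p\<^sup>2"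
  proof -
    have "(a y)\<^sup>2 \<le> \<alpha> * ?p * a y" for y
    proof (cases "a y = 0")
      case False
      then obtain t where "(s, t, y) \<in> set_pmf W \<inter> A" using mass_nz unfolding a_def by (meson sum.neutral)
      then have "pmf (map_pmf (\<lambda>(s, t, y). (s, y)) W) (s, y) \<le> \<alpha> * ?p" by (rule A1)
      moreover have "a y \<le> (\<Sum>t\<in>Ts. pmf W (s, t, y))" unfolding a_def by (intro sum_mono) (simp add: mass_def)
      moreover have "(\<Sum>t\<in>Ts. pmf W (s, t, y)) \<le> pmf (map_pmf (\<lambda>(s, t, y). (s, y)) W) (s, y)"
        by (rule sum_pmf_le_pmf_map) (auto simp: inj_on_def)
      ultimately have "a y \<le> \<alpha> * ?p" by linarith
      moreover have "0 \<le> a y" unfolding a_def by (simp add: sum_nonneg)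
      ultimately show ?thesis unfolding power2_eq_square by (rule mult_right_mono)
    qed simp
    then have "(\<Sum>y\<in>Ys. (a y)\<^sup>2) \<le> (\<Sum>y\<in>Ys. \<alpha> * ?p * a y)" by (rule sum_mono)
    also have "\<dots> = \<alpha> * ?p * ?w" unfolding wa sum_distrib_left ..
    also have "\<dots> \<le> \<alpha> * ?p * ?p" using nn by (intro mult_left_mono sum_mass_le) auto
    finally show ?thesis by (simp add: power2_eq_square mult.assoc)
  qed
  have b2: "expect PT (\<lambda>t. (c t)\<^sup>2) \<le> \<beta> * ?p\<^sup>2"
  proof -
    have "pmf PT t * (c t)\<^sup>2 \<le> \<beta> * ?p * (\<Sum>y\<in>Ys. mass A s t y)" if t: "t \<in> Ts" for t
    proof (cases "(\<Sum>y\<in>Ys. mass A s t y) = 0")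
      case True
      have "pmf PT t * c t = (\<Sum>y\<in>Ys. mass A s t y)"
        unfolding c_def sum_distrib_left by (intro sum.cong refl cw_mass[OF t])
      then show ?thesis using True PT_pos[OF t] by simp
    next
      case False
      then obtain y where "(s, t, y) \<in> set_pmf W \<inter> A" using mass_nz by (meson sum.neutral)
      then have "pmf (map_pmf (\<lambda>(s, t, y). (s, t)) W) (s, t) \<le> \<beta> * ?p * pmf PT t" by (rule A2)
      moreover have "(\<Sum>y\<in>Ys. mass A s t y) \<le> (\<Sum>y\<in>Ys. pmf W (s, t, y))" by (intro sum_mono) (simp add: mass_def)
      moreover have "(\<Sum>y\<in>Ys. pmf W (s, t, y)) \<le> pmf (map_pmf (\<lambda>(s, t, y). (s, t)) W) (s, t)"
        by (rule sum_pmf_le_pmf_map) (auto simp: inj_on_def)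
      moreover have pc: "pmf PT t * c t = (\<Sum>y\<in>Ys. mass A s t y)"
        unfolding c_def sum_distrib_left by (intro sum.cong refl cw_mass[OF t])
      ultimately have "pmf PT t * c t \<le> pmf PT t * (\<beta> * ?p)" by (simp add: mult_ac)
      then have "c t \<le> \<beta> * ?p" using PT_pos[OF t] by simp
      moreover have "0 \<le> pmf PT t * c t" unfolding pc by (simp add: sum_nonneg)
      ultimately have "c t * (pmf PT t * c t) \<le> \<beta> * ?p * (pmf PT t * c t)" by (rule mult_right_mono)
      then show ?thesis unfolding pc[symmetric] by (simp add: power2_eq_square mult_ac)
    qed
    then have "expect PT (\<lambda>t. (c t)\<^sup>2) \<le> (\<Sum>t\<in>Ts. \<beta> * ?p * (\<Sum>y\<in>Ys. mass A s t y))"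
      unfolding expect_PT by (rule sum_mono)
    also have "\<dots> = \<beta> * ?p * ?w" by (simp only: sum_distrib_left)
    also have "\<dots> \<le> \<beta> * ?p * ?p" using nn by (intro mult_left_mono sum_mass_le) auto
    finally show ?thesis by (simp add: power2_eq_square mult.assoc)
  qed
  have b3: "expect PT (\<lambda>t. \<Sum>y\<in>Ys. (cw A s t y)\<^sup>2) \<le> \<gamma> * ?p\<^sup>2"
  proof -
    have "pmf PT t * (cw A s t y)\<^sup>2 \<le> \<gamma> * ?p * mass A s t y" if t: "t \<in> Ts" for t y
    proof (cases "mass A s t y = 0")
      case True
      then show ?thesis using cw_mass[OF t, of A s y] PT_pos[OF t] by simp
    next
      case False
      then have m: "(s, t, y) \<in> set_pmf W \<inter> A" by (rule mass_nz)
      then have "pmf W (s, t, y) \<le> \<gamma> * ?p * pmf PT t" by (rule A3)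
      then have "cw A s t y \<le> \<gamma> * ?p"
        using m PT_pos[OF t] by (simp add: cw_def pos_divide_le_eq)
      then have "cw A s t y * (pmf PT t * cw A s t y) \<le> \<gamma> * ?p * (pmf PT t * cw A s t y)"
        by (rule mult_right_mono) simp
      then show ?thesis unfolding cw_mass[OF t, symmetric] by (simp add: power2_eq_square mult_ac)
    qed
    then have "expect PT (\<lambda>t. \<Sum>y\<in>Ys. (cw A s t y)\<^sup>2) \<le> (\<Sum>t\<in>Ts. \<Sum>y\<in>Ys. \<gamma> * ?p * mass A s t y)"
      unfolding expect_PT sum_distrib_left by (intro sum_mono)
    also have "\<dots> = \<gamma> * ?p * ?w" by (simp only: sum_distrib_left)
    also have "\<dots> \<le> \<gamma> * ?p * ?p" using nn by (intro mult_left_mono sum_mass_le) auto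
    finally show ?thesis by (simp add: power2_eq_square mult.assoc)
  qed
  \<comment> \<open>For a fixed colouring the codebook is averaged out, leaving (E F)^2 + E F^2 / L;
    both terms are then averaged over colourings by \<open>expect_binning_square\<close>.\<close>
  have second: "expect ?C (\<lambda>(t, b). (synth L A t b s m)\<^sup>2)
     \<le> ((?w / M)\<^sup>2 + r * (\<Sum>y\<in>Ys. (a y)\<^sup>2)) + (expect PT (\<lambda>t. (c t)\<^sup>2) / M\<^sup>2 + r * expect PT (\<lambda>t. \<Sum>y\<in>Ys. (cw A s t y)\<^sup>2)) / L"
  proof -
    let ?F = "\<lambda>b t. \<Sum>y\<in>Ys. cw A s t y * of_bool (b y = m)"
    have "expect ?C (\<lambda>(t, b). (synth L A t b s m)\<^sup>2) = expect (pair_pmf (binning M) (codebook L)) (\<lambda>(b, t). (synth L A t b s m)\<^sup>2)"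
      by (subst pair_commute_pmf) (simp add: case_prod_unfold)
    also have "\<dots> = expect (binning M) (\<lambda>b. expect (codebook L) (\<lambda>t. ((\<Sum>l<L. ?F b (t l)) / L)\<^sup>2))"
      using LM by (simp add: expect_pair synth_def)
    also have "\<dots> \<le> expect (binning M) (\<lambda>b. (expect PT (?F b))\<^sup>2 + expect PT (\<lambda>t. (?F b t)\<^sup>2) / L)"
      using LM by (intro expect_mono expect_codebook_square) auto
    also have "\<dots> = expect (binning M) (\<lambda>b. (expect PT (?F b))\<^sup>2) + expect (binning M) (\<lambda>b. expect PT (\<lambda>t. (?F b t)\<^sup>2)) / L"
      using LM by (simp add: expect_add)
    also have "expect (binning M) (\<lambda>b. (expect PT (?F b))\<^sup>2) = expect (binning M) (\<lambda>b. (\<Sum>y\<in>Ys. a y * of_bool (b y = m))\<^sup>2)"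
      by (simp add: expect_sum expect_cw a_def)
    also have "\<dots> = (?w / M)\<^sup>2 + r * (\<Sum>y\<in>Ys. (a y)\<^sup>2)"
      unfolding r_def wa using LM by (intro expect_binning_square) auto
    also have "expect (binning M) (\<lambda>b. expect PT (\<lambda>t. (?F b t)\<^sup>2)) = expect PT (\<lambda>t. expect (binning M) (\<lambda>b. (?F b t)\<^sup>2))"
      unfolding expect_PT using LM by (simp add: expect_sum)
    also have "\<dots> = expect PT (\<lambda>t. (c t / M)\<^sup>2 + r * (\<Sum>y\<in>Ys. (cw A s t y)\<^sup>2))"
      unfolding r_def c_def using LM by (simp add: expect_binning_square del: sum_mult_of_bool_eq)
    also have "\<dots> = expect PT (\<lambda>t. (c t)\<^sup>2) / M\<^sup>2 + r * expect PT (\<lambda>t. \<Sum>y\<in>Ys. (cw A s t y)\<^sup>2)"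
      by (subst expect_add) (simp_all add: power_divide)
    finally show ?thesis .
  qed
  have "expect ?C (\<lambda>(t, b). (synth L A t b s m - ?w / M)\<^sup>2) = expect ?C (\<lambda>x. (case x of (t, b) \<Rightarrow> (synth L A t b s m)\<^sup>2) - (2 * (?w / M)) * (case x of (t, b) \<Rightarrow> synth L A t b s m) + (?w / M)\<^sup>2)"
    by (intro expect_cong) (auto simp: power2_diff)
  also have "\<dots> = expect ?C (\<lambda>(t, b). (synth L A t b s m)\<^sup>2) - (2 * (?w / M)) * expect ?C (\<lambda>(t, b). synth L A t b s m) + (?w / M)\<^sup>2"
    using fins by (simp only: expect_add expect_diff) simp
  also have "\<dots> = expect ?C (\<lambda>(t, b). (synth L A t b s m)\<^sup>2) - (?w / M)\<^sup>2"
    unfolding expect_synth[OF LM] by (simp add: power2_eq_square)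
  also have "\<dots> \<le> r * (\<alpha> * ?p\<^sup>2) + (\<beta> * ?p\<^sup>2 / M\<^sup>2 + r * (\<gamma> * ?p\<^sup>2)) / L"
  proof -
    have "r * (\<Sum>y\<in>Ys. (a y)\<^sup>2) \<le> r * (\<alpha> * ?p\<^sup>2)" using b1 r0 by (rule mult_left_mono)
    moreover have "(expect PT (\<lambda>t. (c t)\<^sup>2) / M\<^sup>2 + r * expect PT (\<lambda>t. \<Sum>y\<in>Ys. (cw A s t y)\<^sup>2)) / L
        \<le> (\<beta> * ?p\<^sup>2 / M\<^sup>2 + r * (\<gamma> * ?p\<^sup>2)) / L"
      using b2 b3 r0 by (intro divide_right_mono add_mono mult_left_mono) auto
    ultimately show ?thesis using second by linarith
  qed
  also have "\<dots> = (?p * sqrt ?K / M)\<^sup>2"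
  proof -
    have r: "r = (real M - 1) / (real M)\<^sup>2" using LM by (simp add: r_def field_simps power2_eq_square)
    have "(?p * sqrt ?K / M)\<^sup>2 = ?p\<^sup>2 * ?K / M\<^sup>2" using K0 by (simp add: power_mult_distrib power_divide)
    also have "\<dots> = r * (\<alpha> * ?p\<^sup>2) + (\<beta> * ?p\<^sup>2 / M\<^sup>2 + r * (\<gamma> * ?p\<^sup>2)) / L"
      unfolding r using LM by (simp add: field_simps of_nat_diff)
    finally show ?thesis by simp
  qed
  finally have "expect ?C (\<lambda>x. (case x of (t, b) \<Rightarrow> synth L A t b s m - ?w / M)\<^sup>2) \<le> (?p * sqrt ?K / M)\<^sup>2"
    by (simp add: case_prod_unfold)
  from expect_abs_le_of_square[OF fins this] show ?thesis
    using K0 by (simp add: case_prod_unfold)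
qed

text \<open>Outside A no cancellation is sought: synthesised and target weight are both counted in
  full, each with total mean at most the probability of the complement, whence the factor 2. Inside
  A the bound is p(s)/M times a constant, and summing over s and m leaves the constant.\<close>

lemma expect_dev_le:
  assumes LM: "0 < L" "0 < M"
    and nn: "0 \<le> \<alpha>" "0 \<le> \<beta>" "0 \<le> \<gamma>"
    and A: "\<And>s t y. (s, t, y) \<in> set_pmf W \<inter> A \<Longrightarrow> pmf (map_pmf (\<lambda>(s, t, y). (s, y)) W) (s, y) \<le> \<alpha> * pmf PS s"
      "\<And>s t y. (s, t, y) \<in> set_pmf W \<inter> A \<Longrightarrow> pmf (map_pmf (\<lambda>(s, t, y). (s, t)) W) (s, t) \<le> \<beta> * pmf PS s * pmf PT t"
      "\<And>s t y. (s, t, y) \<in> set_pmf W \<inter> A \<Longrightarrow> pmf W (s, t, y) \<le> \<gamma> * pmf PS s * pmf PT t"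
  shows "expect (pair_pmf (codebook L) (binning M)) (\<lambda>(t, b). dev L M t b)
    \<le> 2 * pr W (- A) + sqrt ((real M - 1) * \<alpha> + \<beta> / L + (real M - 1) * \<gamma> / L)"
proof -
  let ?C = "pair_pmf (codebook L) (binning M)"
  let ?w = "\<lambda>A s. \<Sum>t\<in>Ts. \<Sum>y\<in>Ys. mass A s t y"
  let ?K = "(real M - 1) * \<alpha> + \<beta> / L + (real M - 1) * \<gamma> / L"
  have fins: "finite (set_pmf ?C)" using LM by simp
  have "expect ?C (\<lambda>(t, b). dev L M t b) = (\<Sum>s\<in>Ss. \<Sum>m=1..M. expect ?C (\<lambda>(t, b). \<bar>synth L UNIV t b s m - pmf PS s / M\<bar>))"
    unfolding dev_def case_prod_unfold using fins by (simp only: expect_sum)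
  also have "\<dots> \<le> (\<Sum>s\<in>Ss. \<Sum>m=1..M. pmf PS s * sqrt ?K / M + 2 * (?w (- A) s / M))"
  proof (intro sum_mono)
    fix s m assume s: "s \<in> Ss" and m: "m \<in> {1..M}"
    have "expect ?C (\<lambda>(t, b). \<bar>synth L UNIV t b s m - pmf PS s / M\<bar>)
      \<le> expect ?C (\<lambda>x. (case x of (t, b) \<Rightarrow> \<bar>synth L A t b s m - ?w A s / M\<bar>) + ((case x of (t, b) \<Rightarrow> synth L (- A) t b s m) + ?w (- A) s / M))"
    proof (rule expect_mono[OF fins], clarify)
      fix t b
      have "pmf PS s = ?w A s + ?w (- A) s"
        unfolding sum_mass_UNIV[symmetric] sum.distrib[symmetric] by (intro sum.cong refl mass_UNIV)
      moreover have "0 \<le> ?w (- A) s / M" by (intro divide_nonneg_nonneg sum_nonneg) auto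
      moreover have "0 \<le> synth L (- A) t b s m" by simp
      ultimately show "\<bar>synth L UNIV t b s m - pmf PS s / M\<bar>
          \<le> \<bar>synth L A t b s m - ?w A s / M\<bar> + (synth L (- A) t b s m + ?w (- A) s / M)"
        unfolding synth_UNIV[of _ _ _ _ _ A] by (simp only: add_divide_distrib)
    qed
    also have "\<dots> = expect ?C (\<lambda>(t, b). \<bar>synth L A t b s m - ?w A s / M\<bar>) + (expect ?C (\<lambda>(t, b). synth L (- A) t b s m) + ?w (- A) s / M)"
      using fins by (simp only: expect_add) simp
    also have "\<dots> \<le> pmf PS s * sqrt ?K / M + 2 * (?w (- A) s / M)"
      using expect_abs_synth_dev[where A = A and s = s, OF LM m nn A] expect_synth[OF LM m, where A = "- A" and s = s] by simp
    finally show "expect ?C (\<lambda>(t, b). \<bar>synth L UNIV t b s m - pmf PS s / M\<bar>) \<le> pmf PS s * sqrt ?K / M + 2 * (?w (- A) s / M)" .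
  qed
  also have "\<dots> = (\<Sum>s\<in>Ss. pmf PS s * sqrt ?K + 2 * ?w (- A) s)"
    using LM by (simp add: distrib_left)
  also have "\<dots> = (\<Sum>s\<in>Ss. pmf PS s) * sqrt ?K + 2 * (\<Sum>s\<in>Ss. ?w (- A) s)"
    by (simp only: sum.distrib sum_distrib_left sum_distrib_right)
  also have "(\<Sum>s\<in>Ss. pmf PS s) = 1"
    by (rule sum_pmf_eq_1) (auto simp: Ss_def)
  finally show ?thesis using sum_mass_total[of "- A"] by simp
qed

text \<open>
  The sampling encoder is derandomised by minimising \<open>e\<close>, the error probability of receiver 2 given the
  codeword. If no admissible choice exists, both receivers may fail, hence the cost 2.
\<close>

lemma encoder_exists:
  fixes e :: "'t \<Rightarrow> real"
  assumes LM: "0 < L" "0 < M" and t: "\<And>l. l < L \<Longrightarrow> t l \<in> Ts" and b: "\<And>y. b y \<in> {1..M}"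
    and e: "\<And>x. 0 \<le> e x" "\<And>x. e x \<le> 1"
  obtains enc :: "nat \<Rightarrow> 's \<Rightarrow> 't \<times> 'y" where
    "\<And>m s. (s, enc m s) \<in> set_pmf W \<Longrightarrow> b (snd (enc m s)) = m \<Longrightarrow> \<exists>l<L. fst (enc m s) = t l"
    "(\<Sum>s\<in>Ss. \<Sum>m=1..M. pmf PS s / M *
        (if (s, enc m s) \<in> set_pmf W \<and> b (snd (enc m s)) = m then e (fst (enc m s)) else 2))
      \<le> 2 * dev L M t b + (\<Sum>l<L. e (t l)) / L"
proof -
  \<comment> \<open>Candidates for state s and message m: a codeword together with a compatible y of
    colour m.\<close>
  define G where "G m s = {(t l, y) | l y. l < L \<and> (s, t l, y) \<in> set_pmf W \<and> b y = m}" for m s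
  have "G m s \<subseteq> t ` {..<L} \<times> Ys" for m s by (auto simp: G_def dest: supp)
  then have finG: "finite (G m s)" for m s by (rule finite_subset) simp
  \<comment> \<open>The \<open>SOME\<close> predicate is always satisfiable, for instance by a pair
    starting with \<open>t 0\<close>; when there is no candidate it forces the pair to leave the
    support or to have a wrong colour.\<close>
  define enc where "enc m s = (if G m s = {} then SOME p. (s, p) \<notin> set_pmf W \<or> b (snd p) \<noteq> m \<or> (\<exists>l<L. fst p = t l)
     else arg_min_on (e \<circ> fst) (G m s))" for m s
  have encG: "enc m s \<in> G m s" "\<And>p. p \<in> G m s \<Longrightarrow> e (fst (enc m s)) \<le> e (fst p)" if "G m s \<noteq> {}" for m s
    using that arg_min_if_finite(1)[OF finG that, of "e \<circ> fst"] arg_min_least[OF finG that, of _ "e \<circ> fst"]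
    by (auto simp: enc_def)
  have "\<exists>p. (s, p) \<notin> set_pmf W \<or> b (snd p) \<noteq> m \<or> (\<exists>l<L. fst p = t l)" for m s
    using LM by (intro exI[of _ "(t 0, undefined)"]) auto
  from someI_ex[OF this] have encE: "(s, enc m s) \<notin> set_pmf W \<or> b (snd (enc m s)) \<noteq> m" if "G m s = {}" for m s
    using that unfolding enc_def by (simp add: G_def) (metis (mono_tags, lifting) prod.collapse)
  let ?valid = "\<lambda>m s. (s, enc m s) \<in> set_pmf W \<and> b (snd (enc m s)) = m"
  have valid: "?valid m s \<longleftrightarrow> G m s \<noteq> {}" for m s
  proof
    assume "G m s \<noteq> {}"
    from encG(1)[OF this] show "?valid m s" by (auto simp: G_def)
  qed (use encE in blast)
  let ?g = "\<lambda>s m. (\<Sum>l<L. \<Sum>y\<in>Ys. cw UNIV s (t l) y * of_bool (b y = m) * e (t l)) / L"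
  \<comment> \<open>If candidates exist, the minimal error is at most the average of e under the
    synthesised weights, and replacing the true weight p(s)/M by the synthesised one costs at most
    the deviation. If none exists, the synthesised weight is 0, the deviation is all of p(s)/M, and
    twice the deviation pays the cost 2.\<close>
  have step: "pmf PS s / M * (if ?valid m s then e (fst (enc m s)) else 2)
      \<le> 2 * \<bar>synth L UNIV t b s m - pmf PS s / M\<bar> + ?g s m" for s m
  proof (cases "G m s = {}")
    case True
    have "synth L UNIV t b s m = 0"
      unfolding synth_def
    proof (intro divide_eq_0_iff[THEN iffD2] disjI1 sum.neutral ballI)
      fix l y assume "l \<in> {..<L}" "y \<in> Ys"
      then show "cw UNIV s (t l) y * of_bool (b y = m) = 0"
        using True by (auto simp: G_def cw_def set_pmf_iff)
    qed
    moreover have "0 \<le> ?g s m" using e by (intro divide_nonneg_nonneg sum_nonneg) auto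
    moreover have "\<not> ?valid m s" using True valid[of s m] by blast
    ultimately show ?thesis by (simp only: if_not_P) (simp add: mult.commute)
  next
    case False
    let ?e = "e (fst (enc m s))"
    have "synth L UNIV t b s m * ?e \<le> ?g s m"
      unfolding synth_def times_divide_eq_left sum_distrib_right
    proof (intro divide_right_mono sum_mono)
      fix l y assume "l \<in> {..<L}" "y \<in> Ys"
      then show "cw UNIV s (t l) y * of_bool (b y = m) * ?e \<le> cw UNIV s (t l) y * of_bool (b y = m) * e (t l)"
      proof (cases "pmf W (s, t l, y) \<noteq> 0 \<and> b y = m")
        case True
        then have "(t l, y) \<in> G m s" using \<open>l \<in> {..<L}\<close> by (auto simp: G_def set_pmf_iff)
        from encG(2)[OF False this] show ?thesis by (intro mult_left_mono) auto
      qed (auto simp: cw_def)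
    qed simp
    moreover have "(pmf PS s / M - synth L UNIV t b s m) * ?e \<le> \<bar>synth L UNIV t b s m - pmf PS s / M\<bar> * 1"
      using e by (intro mult_mono) auto
    moreover have "pmf PS s / M * ?e = synth L UNIV t b s m * ?e + (pmf PS s / M - synth L UNIV t b s m) * ?e"
      by (simp add: left_diff_distrib)
    moreover have "x \<le> d + g" if "b \<le> g" "c \<le> d * 1" "x = b + c" for x b c d g :: real
      using that by simp
    ultimately have "pmf PS s / M * ?e \<le> \<bar>synth L UNIV t b s m - pmf PS s / M\<bar> + ?g s m"
      by blast
    then have "pmf PS s / M * ?e \<le> 2 * \<bar>synth L UNIV t b s m - pmf PS s / M\<bar> + ?g s m"
      by (rule order.trans) simp
    moreover have "?valid m s" using valid[of s m] False by blast
    ultimately show ?thesis by (simp only: if_P)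
  qed
  show thesis
  proof (rule that[of enc])
    show "\<exists>l<L. fst (enc m s) = t l" if "(s, enc m s) \<in> set_pmf W" "b (snd (enc m s)) = m" for m s
      using encG(1)[of m s] valid[of s m] that by (auto simp: G_def)
    \<comment> \<open>Summed over states and colours, the synthesised weights give each index at
      most 1/L, which leaves the plain average of e over the codebook.\<close>
    have "(\<Sum>s\<in>Ss. \<Sum>m=1..M. ?g s m) \<le> (\<Sum>l<L. e (t l)) / L"
    proof -
      have "(\<Sum>s\<in>Ss. \<Sum>m=1..M. ?g s m)
          = (\<Sum>s\<in>Ss. \<Sum>l<L. \<Sum>y\<in>Ys. \<Sum>m=1..M. cw UNIV s (t l) y * of_bool (b y = m) * e (t l)) / L"
        unfolding sum_divide_distrib[symmetric]
        by (rule arg_cong2[where f = "(/)", OF _ refl], rule sum.cong[OF refl], subst sum.swap)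
          (intro sum.cong refl sum.swap)
      also have "\<dots> = (\<Sum>s\<in>Ss. \<Sum>l<L. \<Sum>y\<in>Ys. cw UNIV s (t l) y * e (t l)) / L"
      proof -
        have "(\<Sum>m=1..M. x * of_bool (b y = m) * z) = x * z" for x z :: real and y
        proof -
          have "(\<Sum>m=1..M. x * of_bool (b y = m) * z) = (\<Sum>m=1..M. if b y = m then x * z else 0)"
            by (intro sum.cong) auto
          then show ?thesis using b[of y] by simp
        qed
        then show ?thesis by simp
      qed
      also have "\<dots> = (\<Sum>l<L. e (t l) * (\<Sum>s\<in>Ss. \<Sum>y\<in>Ys. cw UNIV s (t l) y)) / L"
        unfolding sum_distrib_left by (subst sum.swap) (simp add: mult.commute)
      also have "\<dots> \<le> (\<Sum>l<L. e (t l) * 1) / L"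
      proof (intro divide_right_mono sum_mono mult_left_mono e)
        fix l assume "l \<in> {..<L}"
        then have l: "t l \<in> Ts" using t by simp
        have "(\<Sum>s\<in>Ss. \<Sum>y\<in>Ys. cw UNIV s (t l) y) = (\<Sum>x\<in>Ss \<times> Ys. pmf W (fst x, t l, snd x)) / pmf PT (t l)"
          by (simp add: cw_def sum.cartesian_product case_prod_unfold sum_divide_distrib)
        also have "(\<Sum>x\<in>Ss \<times> Ys. pmf W (fst x, t l, snd x)) \<le> pmf PT (t l)"
          unfolding PT_def by (rule sum_pmf_le_pmf_map) (auto simp: inj_on_def)
        finally show "(\<Sum>s\<in>Ss. \<Sum>y\<in>Ys. cw UNIV s (t l) y) \<le> 1"
          using PT_pos[OF l] by (simp add: pos_divide_le_eq divide_right_mono)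
      qed simp
      finally show ?thesis by simp
    qed
    moreover have "(\<Sum>s\<in>Ss. \<Sum>m=1..M. pmf PS s / M * (if ?valid m s then e (fst (enc m s)) else 2))
        \<le> (\<Sum>s\<in>Ss. \<Sum>m=1..M. 2 * \<bar>synth L UNIV t b s m - pmf PS s / M\<bar> + ?g s m)"
      by (intro sum_mono step)
    ultimately show "(\<Sum>s\<in>Ss. \<Sum>m=1..M. pmf PS s / M * (if ?valid m s then e (fst (enc m s)) else 2))
        \<le> 2 * dev L M t b + (\<Sum>l<L. e (t l)) / L"
      by (simp add: dev_def sum.distrib sum_distrib_left)
  qed
qed

end

section \<open>Packing\<close>

lemma expect_of_bool: "expect P (\<lambda>w. of_bool (Q w)) = pr P {w. Q w}"
proof -
  have "(\<lambda>w. of_bool (Q w)) = indicat_real {w. Q w}" by (auto simp: indicator_def)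
  then show ?thesis by simp
qed

lemma expect_le_const:
  assumes "finite (set_pmf P)" "\<And>w. w \<in> set_pmf P \<Longrightarrow> f w \<le> c"
  shows "expect P f \<le> c"
  using expect_mono[of P f "\<lambda>_. c"] assms by simp

lemma expect_swap:
  assumes "finite (set_pmf P)" "finite (set_pmf R)"
  shows "expect P (\<lambda>x. expect R (f x)) = expect R (\<lambda>y. expect P (\<lambda>x. f x y))"
  unfolding expect_eq_sum[OF assms(1)] using assms(2) by (simp add: expect_sum)

text \<open>Receiver 2 looks for a message that explains its output together with some codeword;
  this is the event that a wrong message does so too.\<close>

definition collide :: "('v \<Rightarrow> 't \<Rightarrow> 'z) \<Rightarrow> nat \<Rightarrow> nat \<Rightarrow> (nat \<Rightarrow> 't) \<Rightarrow> (nat \<Rightarrow> 'v) \<Rightarrow> 't \<Rightarrow> nat \<Rightarrow> bool" where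
  "collide \<phi> L N t x \<tau> m \<longleftrightarrow> (\<exists>m'\<in>{1..N}. m' \<noteq> m \<and> (\<exists>l<L. \<phi> (x m') (t l) = \<phi> (x m) \<tau>))"

text \<open>Union bound over wrong messages and codeword indices. A wrong explanation with the true
  codeword involves one fresh word (\<kappa>), one with another codeword two fresh words (\<nu>, for
  each of the L indices). The set B holds the pairs for which these probabilities are small.\<close>

lemma packing:
  fixes L N :: nat and \<kappa> \<nu> :: real and PT :: "'t pmf" and V :: "'v pmf" and \<phi> :: "'v \<Rightarrow> 't \<Rightarrow> 'z"
  assumes fin: "finite (set_pmf PT)" "finite (set_pmf V)" and LN: "0 < L" "0 < N"
    and nn: "0 \<le> \<kappa>" "0 \<le> \<nu>"
    and B1: "\<And>\<tau> v. \<tau> \<in> set_pmf PT \<Longrightarrow> v \<in> set_pmf V \<Longrightarrow> (\<tau>, v) \<in> B \<Longrightarrow>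
      pr V {v'. \<phi> v' \<tau> = \<phi> v \<tau>} \<le> \<kappa>"
    and B2: "\<And>\<tau> v. \<tau> \<in> set_pmf PT \<Longrightarrow> v \<in> set_pmf V \<Longrightarrow> (\<tau>, v) \<in> B \<Longrightarrow>
      pr (pair_pmf PT V) {(\<tau>', v'). \<phi> v' \<tau>' = \<phi> v \<tau>} \<le> \<nu>"
  shows "expect (pair_pmf (Pi_pmf {..<L} d (\<lambda>_. PT)) (Pi_pmf {1..N} d' (\<lambda>_. V)))
      (\<lambda>(t, x). (\<Sum>l<L. (\<Sum>m=1..N. of_bool (collide \<phi> L N t x (t l) m)) / N) / L)
    \<le> pr (pair_pmf PT V) (- B) + (real N - 1) * (\<kappa> + L * \<nu>)"
proof -
  let ?Ct = "Pi_pmf {..<L} d (\<lambda>_. PT)" and ?Cx = "Pi_pmf {1..N} d' (\<lambda>_. V)"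
  let ?C = "pair_pmf ?Ct ?Cx"
  have finC: "finite (set_pmf ?Ct)" "finite (set_pmf ?Cx)" "finite (set_pmf ?C)"
    using fin by (simp_all add: finite_set_Pi_pmf)
  let ?\<rho> = "pr (pair_pmf PT V) (- B) + (real N - 1) * (\<kappa> + L * \<nu>)"
  have one: "expect ?C (\<lambda>(t, x). of_bool (collide \<phi> L N t x (t l) m)) \<le> ?\<rho>" if l: "l < L" and m: "m \<in> {1..N}" for l m
  proof -
    let ?hit = "\<lambda>\<tau> v \<tau>' v'. of_bool ((\<tau>, v) \<in> B \<and> \<phi> v' \<tau>' = \<phi> v \<tau>) :: real"
    have "expect ?C (\<lambda>(t, x). of_bool (collide \<phi> L N t x (t l) m))
      \<le> expect ?C (\<lambda>w. (case w of (t, x) \<Rightarrow> of_bool ((t l, x m) \<notin> B)) +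
          (\<Sum>m'\<in>{1..N} - {m}. \<Sum>l'<L. (case w of (t, x) \<Rightarrow> ?hit (t l) (x m) (t l') (x m'))))"
    proof (rule expect_mono[OF finC(3)], clarify)
      fix t x
      let ?S = "\<Sum>m'\<in>{1..N} - {m}. \<Sum>l'<L. ?hit (t l) (x m) (t l') (x m')"
      have S0: "0 \<le> ?S" by (intro sum_nonneg) auto
      show "of_bool (collide \<phi> L N t x (t l) m) \<le> (of_bool ((t l, x m) \<notin> B) + ?S :: real)"
      proof (cases "collide \<phi> L N t x (t l) m \<and> (t l, x m) \<in> B")
        case True
        then obtain m' l' where "m' \<in> {1..N} - {m}" "l' < L" "\<phi> (x m') (t l') = \<phi> (x m) (t l)"
          by (auto simp: collide_def)
        then have "1 \<le> ?hit (t l) (x m) (t l') (x m')" using True by simp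
        also have "\<dots> \<le> (\<Sum>l'<L. ?hit (t l) (x m) (t l') (x m'))"
          using \<open>l' < L\<close> by (intro member_le_sum) auto
        also have "\<dots> \<le> ?S"
          using \<open>m' \<in> {1..N} - {m}\<close> by (intro member_le_sum[where f = "\<lambda>m'. \<Sum>l'<L. ?hit (t l) (x m) (t l') (x m')"] sum_nonneg) auto
        finally have "1 \<le> ?S" .
        moreover have "of_bool (collide \<phi> L N t x (t l) m) \<le> (1 :: real)" "0 \<le> (of_bool ((t l, x m) \<notin> B) :: real)"
          by simp_all
        ultimately show ?thesis by linarith
      next
        case False
        then show ?thesis using S0 by auto
      qed
    qed
    also have "\<dots> = expect ?C (\<lambda>(t, x). of_bool ((t l, x m) \<notin> B)) +
        (\<Sum>m'\<in>{1..N} - {m}. \<Sum>l'<L. expect ?C (\<lambda>(t, x). ?hit (t l) (x m) (t l') (x m')))"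
      using finC(3) by (simp only: expect_add expect_sum)
    also have "expect ?C (\<lambda>(t, x). of_bool ((t l, x m) \<notin> B)) = pr (pair_pmf PT V) (- B)"
    proof -
      have "expect ?C (\<lambda>(t, x). of_bool ((t l, x m) \<notin> B)) = expect ?Ct (\<lambda>t. expect ?Cx (\<lambda>x. of_bool ((t l, x m) \<notin> B)))"
        using finC by (simp add: expect_pair)
      also have "\<dots> = expect ?Ct (\<lambda>t. expect V (\<lambda>v. of_bool ((t l, v) \<notin> B)))"
        using m by (intro expect_cong expect_Pi_pmf_component[where h = "\<lambda>v. of_bool ((_, v) \<notin> B)"]) auto
      also have "\<dots> = expect PT (\<lambda>\<tau>. expect V (\<lambda>v. of_bool ((\<tau>, v) \<notin> B)))"
        using l by (intro expect_Pi_pmf_component[where h = "\<lambda>\<tau>. expect V (\<lambda>v. of_bool ((\<tau>, v) \<notin> B))"]) auto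
      also have "\<dots> = expect (pair_pmf PT V) (\<lambda>w. of_bool (w \<notin> B))"
        using fin by (simp add: expect_pair)
      finally show ?thesis by (simp add: expect_of_bool Compl_eq)
    qed
    \<comment> \<open>\<nu> is granted to l' = l as well, so the sum over l' is exactly \<kappa> + L
      \<nu>.\<close>
    also have "(\<Sum>m'\<in>{1..N} - {m}. \<Sum>l'<L. expect ?C (\<lambda>(t, x). ?hit (t l) (x m) (t l') (x m')))
       \<le> (\<Sum>m'\<in>{1..N} - {m}. \<Sum>l'<L. (if l' = l then \<kappa> else 0) + \<nu>)"
    proof (intro sum_mono)
      fix m' l' assume m': "m' \<in> {1..N} - {m}" and l': "l' \<in> {..<L}"
      have two: "expect ?Cx (\<lambda>x. ?hit \<tau> (x m) \<tau>' (x m')) = expect V (\<lambda>v. expect V (\<lambda>v'. ?hit \<tau> v \<tau>' v'))" for \<tau> \<tau>'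
        using m m' fin by (intro expect_Pi_pmf_two[where h = "\<lambda>v v'. ?hit \<tau> v \<tau>' v'"]) auto
      have C: "expect ?C (\<lambda>(t, x). ?hit (t l) (x m) (t l') (x m')) = expect ?Ct (\<lambda>t. expect V (\<lambda>v. expect V (\<lambda>v'. ?hit (t l) v (t l') v')))"
        using finC by (simp only: expect_pair split two)
      show "expect ?C (\<lambda>(t, x). ?hit (t l) (x m) (t l') (x m')) \<le> (if l' = l then \<kappa> else 0) + \<nu>"
      proof (cases "l' = l")
        case True
        have "expect ?Ct (\<lambda>t. expect V (\<lambda>v. expect V (\<lambda>v'. ?hit (t l) v (t l) v'))) = expect PT (\<lambda>\<tau>. expect V (\<lambda>v. expect V (\<lambda>v'. ?hit \<tau> v \<tau> v')))"
          using l by (intro expect_Pi_pmf_component[where h = "\<lambda>\<tau>. expect V (\<lambda>v. expect V (\<lambda>v'. ?hit \<tau> v \<tau> v'))"]) auto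
        also have "\<dots> \<le> \<kappa>"
        proof (rule expect_le_const[OF fin(1)], rule expect_le_const[OF fin(2)])
          fix \<tau> v assume "\<tau> \<in> set_pmf PT" "v \<in> set_pmf V"
          then show "expect V (\<lambda>v'. ?hit \<tau> v \<tau> v') \<le> \<kappa>"
            using B1[of \<tau> v] nn by (cases "(\<tau>, v) \<in> B") (simp_all add: expect_of_bool del: of_bool_conj)
        qed
        finally show ?thesis using True C nn by simp
      next
        case False
        have "expect ?Ct (\<lambda>t. expect V (\<lambda>v. expect V (\<lambda>v'. ?hit (t l) v (t l') v')))
            = expect PT (\<lambda>\<tau>. expect PT (\<lambda>\<tau>'. expect V (\<lambda>v. expect V (\<lambda>v'. ?hit \<tau> v \<tau>' v'))))"
          using l l' False fin
          by (intro expect_Pi_pmf_two[where h = "\<lambda>\<tau> \<tau>'. expect V (\<lambda>v. expect V (\<lambda>v'. ?hit \<tau> v \<tau>' v'))"]) auto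
        \<comment> \<open>The transmitted pair is moved outside, so that the fresh pair is averaged
          with the transmitted one held fixed, as \<open>B2\<close> requires.\<close>
        also have "\<dots> = expect PT (\<lambda>\<tau>. expect V (\<lambda>v. expect PT (\<lambda>\<tau>'. expect V (\<lambda>v'. ?hit \<tau> v \<tau>' v'))))"
          by (intro expect_cong expect_swap fin)
        also have "\<dots> \<le> \<nu>"
        proof (rule expect_le_const[OF fin(1)], rule expect_le_const[OF fin(2)])
          fix \<tau> v assume *: "\<tau> \<in> set_pmf PT" "v \<in> set_pmf V"
          have "expect PT (\<lambda>\<tau>'. expect V (\<lambda>v'. ?hit \<tau> v \<tau>' v')) = expect (pair_pmf PT V) (\<lambda>(\<tau>', v'). ?hit \<tau> v \<tau>' v')"
            using fin by (simp only: expect_pair split)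
          also have "\<dots> = pr (pair_pmf PT V) {(\<tau>', v'). (\<tau>, v) \<in> B \<and> \<phi> v' \<tau>' = \<phi> v \<tau>}"
            unfolding case_prod_unfold by (rule expect_of_bool)
          also have "\<dots> \<le> \<nu>"
            using B2[of \<tau> v] nn * by (cases "(\<tau>, v) \<in> B") simp_all
          finally show "expect PT (\<lambda>\<tau>'. expect V (\<lambda>v'. ?hit \<tau> v \<tau>' v')) \<le> \<nu>" .
        qed
        finally show ?thesis using False C by simp
      qed
    qed
    also have "\<dots> = (real N - 1) * (\<kappa> + L * \<nu>)"
      using l m LN by (simp add: sum.distrib of_nat_diff)
    finally show ?thesis by simp
  qed
  have "expect ?C (\<lambda>(t, x). (\<Sum>l<L. (\<Sum>m=1..N. of_bool (collide \<phi> L N t x (t l) m)) / N) / L)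
      = (\<Sum>l<L. (\<Sum>m=1..N. expect ?C (\<lambda>(t, x). of_bool (collide \<phi> L N t x (t l) m))) / N) / L"
    unfolding case_prod_unfold by (simp only: integral_divide_zero expect_sum[OF finC(3)])
  also have "\<dots> \<le> (\<Sum>l<L. (\<Sum>m=1..N. ?\<rho>) / N) / L"
    by (intro divide_right_mono sum_mono one) auto
  also have "\<dots> = ?\<rho>" using LN by simp
  finally show ?thesis .
qed

lemma expect_uniform: "0 < M \<Longrightarrow> expect (pmf_of_set {1..M}) f = (\<Sum>m=1..M. f m) / M" for M :: nat
  by (subst integral_pmf_of_set) auto

context covering
begin

text \<open>A first-moment argument over codebook, colouring and input words. The deviation does not
  see the input words and the collisions do not see the colouring, so the bounds add. The encoder is
  built only once the random objects are fixed, with e the fraction of messages \<open>m2\<close>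
  that suffer a collision.\<close>

lemma one_shot_code:
  fixes L M N :: nat and \<alpha> \<beta> \<gamma> \<kappa> \<nu> :: real and V :: "'v pmf" and \<phi> :: "'v \<Rightarrow> 't \<Rightarrow> 'z"
  assumes finV: "finite (set_pmf V)" and LMN: "0 < L" "0 < M" "0 < N"
    and nn: "0 \<le> \<alpha>" "0 \<le> \<beta>" "0 \<le> \<gamma>" "0 \<le> \<kappa>" "0 \<le> \<nu>"
    and A: "\<And>s t y. (s, t, y) \<in> set_pmf W \<inter> A \<Longrightarrow> pmf (map_pmf (\<lambda>(s, t, y). (s, y)) W) (s, y) \<le> \<alpha> * pmf PS s"
      "\<And>s t y. (s, t, y) \<in> set_pmf W \<inter> A \<Longrightarrow> pmf (map_pmf (\<lambda>(s, t, y). (s, t)) W) (s, t) \<le> \<beta> * pmf PS s * pmf PT t"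
      "\<And>s t y. (s, t, y) \<in> set_pmf W \<inter> A \<Longrightarrow> pmf W (s, t, y) \<le> \<gamma> * pmf PS s * pmf PT t"
    and B: "\<And>\<tau> v. \<tau> \<in> set_pmf PT \<Longrightarrow> v \<in> set_pmf V \<Longrightarrow> (\<tau>, v) \<in> B \<Longrightarrow>
        pr V {v'. \<phi> v' \<tau> = \<phi> v \<tau>} \<le> \<kappa>"
      "\<And>\<tau> v. \<tau> \<in> set_pmf PT \<Longrightarrow> v \<in> set_pmf V \<Longrightarrow> (\<tau>, v) \<in> B \<Longrightarrow>
        pr (pair_pmf PT V) {(\<tau>', v'). \<phi> v' \<tau>' = \<phi> v \<tau>} \<le> \<nu>"
  obtains enc b cb dec where "\<And>y. b y \<in> {1..M}" "\<And>z. dec z \<in> {1..N}" "\<And>m. m \<in> {1..N} \<Longrightarrow> cb m \<in> set_pmf V"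
    "expect (pair_pmf (pmf_of_set {1..M}) (pair_pmf (pmf_of_set {1..N}) PS))
      (\<lambda>(m1, m2, s). if (s, enc m1 s) \<in> set_pmf W \<and> b (snd (enc m1 s)) = m1
        then of_bool (dec (\<phi> (cb m2) (fst (enc m1 s))) \<noteq> m2) else 2)
     \<le> 2 * (2 * pr W (- A) + sqrt ((real M - 1) * \<alpha> + \<beta> / L + (real M - 1) * \<gamma> / L))
       + (pr (pair_pmf PT V) (- B) + (real N - 1) * (\<kappa> + L * \<nu>))"
proof -
  let ?Ct = "codebook L" and ?Cb = "binning M" and ?Cx = "Pi_pmf {1..N} undefined (\<lambda>_. V)"
  let ?C = "pair_pmf ?Ct (pair_pmf ?Cb ?Cx)"
  let ?bA = "2 * pr W (- A) + sqrt ((real M - 1) * \<alpha> + \<beta> / L + (real M - 1) * \<gamma> / L)"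
  let ?bB = "pr (pair_pmf PT V) (- B) + (real N - 1) * (\<kappa> + L * \<nu>)"
  let ?e = "\<lambda>t x \<tau>. (\<Sum>m=1..N. of_bool (collide \<phi> L N t x \<tau> m)) / N :: real"
  have finC: "finite (set_pmf ?Ct)" "finite (set_pmf ?Cb)" "finite (set_pmf ?Cx)" "finite (set_pmf ?C)"
    using LMN finV by (simp_all add: finite_set_Pi_pmf)
  have "expect ?C (\<lambda>(t, b, x). 2 * dev L M t b + (\<Sum>l<L. ?e t x (t l)) / L)
      = expect ?Ct (\<lambda>t. expect ?Cb (\<lambda>b. expect ?Cx (\<lambda>x. 2 * dev L M t b + (\<Sum>l<L. ?e t x (t l)) / L)))"
    using finC by (simp only: expect_pair set_pair_pmf finite_cartesian_product split)
  also have "\<dots> = expect ?Ct (\<lambda>t. expect ?Cb (\<lambda>b. 2 * dev L M t b) + expect ?Cx (\<lambda>x. (\<Sum>l<L. ?e t x (t l)) / L))"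
    using finC by (simp only: expect_add) simp
  also have "\<dots> = 2 * expect (pair_pmf ?Ct ?Cb) (\<lambda>(t, b). dev L M t b) + expect (pair_pmf ?Ct ?Cx) (\<lambda>(t, x). (\<Sum>l<L. ?e t x (t l)) / L)"
    using finC by (simp only: expect_add expect_pair split integral_mult_right_zero)
  also have "\<dots> \<le> 2 * ?bA + ?bB"
  proof (intro add_mono mult_left_mono)
    show "expect (pair_pmf ?Ct ?Cb) (\<lambda>(t, b). dev L M t b) \<le> ?bA"
      by (rule expect_dev_le[OF LMN(1,2) nn(1-3) A])
    show "expect (pair_pmf ?Ct ?Cx) (\<lambda>(t, x). (\<Sum>l<L. ?e t x (t l)) / L) \<le> ?bB"
      unfolding codebook_def by (rule packing[OF fin(5) finV LMN(1,3) nn(4,5) B])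
  qed simp
  finally obtain t b x where C: "(t, b, x) \<in> set_pmf ?C" "2 * dev L M t b + (\<Sum>l<L. ?e t x (t l)) / L \<le> 2 * ?bA + ?bB"
    using exists_le_expect[OF finC(4), of "\<lambda>(t, b, x). 2 * dev L M t b + (\<Sum>l<L. ?e t x (t l)) / L" "2 * ?bA + ?bB"]
    by auto
  have t: "t l \<in> Ts" if "l < L" for l using C(1) that codebook_mem by auto
  have b: "b y \<in> {1..M}" for y using C(1) LMN binning_mem by auto
  have x: "x m \<in> set_pmf V" if "m \<in> {1..N}" for m
    using C(1) that by (auto simp: set_Pi_pmf PiE_dflt_def)
  have e1: "?e t x \<tau> \<le> 1" for \<tau>
  proof -
    have "(\<Sum>m=1..N. of_bool (collide \<phi> L N t x \<tau> m)) \<le> (\<Sum>m=1..N. 1 :: real)" by (intro sum_mono) auto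
    then show ?thesis using LMN by (simp add: pos_divide_le_eq del: sum_of_bool_eq)
  qed
  have e0: "0 \<le> ?e t x \<tau>" for \<tau> by (intro divide_nonneg_nonneg sum_nonneg) auto
  obtain enc where enc: "\<And>m s. (s, enc m s) \<in> set_pmf W \<Longrightarrow> b (snd (enc m s)) = m \<Longrightarrow> \<exists>l<L. fst (enc m s) = t l"
    "(\<Sum>s\<in>Ss. \<Sum>m=1..M. pmf PS s / M *
        (if (s, enc m s) \<in> set_pmf W \<and> b (snd (enc m s)) = m then ?e t x (fst (enc m s)) else 2))
      \<le> 2 * dev L M t b + (\<Sum>l<L. ?e t x (t l)) / L"
    using encoder_exists[where t = t and b = b and e = "?e t x", OF LMN(1,2) t b e0 e1] by blast
  \<comment> \<open>Any message explaining the output is accepted; without a collision the true one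
    is the only candidate. The default 1 keeps the value in the message set.\<close>
  define dec where "dec z = (if \<exists>m\<in>{1..N}. \<exists>l<L. \<phi> (x m) (t l) = z
      then SOME m. m \<in> {1..N} \<and> (\<exists>l<L. \<phi> (x m) (t l) = z) else 1)" for z
  have decS: "dec z \<in> {1..N} \<and> (\<exists>l<L. \<phi> (x (dec z)) (t l) = z)" if "\<exists>m\<in>{1..N}. \<exists>l<L. \<phi> (x m) (t l) = z" for z
  proof -
    have "\<exists>m. m \<in> {1..N} \<and> (\<exists>l<L. \<phi> (x m) (t l) = z)" using that by blast
    from someI_ex[OF this] show ?thesis using that by (simp add: dec_def)
  qed
  have dec: "dec z \<in> {1..N}" for z
    using decS[of z] LMN by (cases "\<exists>m\<in>{1..N}. \<exists>l<L. \<phi> (x m) (t l) = z") (auto simp: dec_def)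
  have dec_ok: "dec (\<phi> (x m) (t l)) = m" if "m \<in> {1..N}" "l < L" "\<not> collide \<phi> L N t x (t l) m" for m l
    using decS[of "\<phi> (x m) (t l)"] that unfolding collide_def by blast
  let ?valid = "\<lambda>m s. (s, enc m s) \<in> set_pmf W \<and> b (snd (enc m s)) = m"
  let ?cost = "\<lambda>m1 m2 s. if ?valid m1 s then of_bool (dec (\<phi> (x m2) (fst (enc m1 s))) \<noteq> m2) else 2 :: real"
  have "expect (pair_pmf (pmf_of_set {1..M}) (pair_pmf (pmf_of_set {1..N}) PS)) (\<lambda>(m1, m2, s). ?cost m1 m2 s)
      = (\<Sum>m1=1..M. (\<Sum>m2=1..N. \<Sum>s\<in>Ss. pmf PS s * ?cost m1 m2 s) / N) / M"
  proof -
    have fU: "finite (set_pmf (pmf_of_set {1..K}))" if "0 < K" for K :: nat using that by simp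
    show ?thesis
      by (simp only: expect_pair set_pair_pmf finite_cartesian_product fU[OF LMN(2)] fU[OF LMN(3)] fin split
          expect_uniform[OF LMN(2)] expect_uniform[OF LMN(3)] expect_eq_sum[OF fin(4), folded Ss_def])
  qed
  also have "\<dots> = (\<Sum>s\<in>Ss. \<Sum>m1=1..M. pmf PS s / M * ((\<Sum>m2=1..N. ?cost m1 m2 s) / N))"
  proof -
    have "(\<Sum>m1=1..M. (\<Sum>m2=1..N. \<Sum>s\<in>Ss. pmf PS s * ?cost m1 m2 s) / N) / M
       = (\<Sum>m1=1..M. \<Sum>m2=1..N. \<Sum>s\<in>Ss. pmf PS s / M * (?cost m1 m2 s / N))"
      unfolding sum_divide_distrib by (intro sum.cong refl) simp
    also have "\<dots> = (\<Sum>m1=1..M. \<Sum>s\<in>Ss. \<Sum>m2=1..N. pmf PS s / M * (?cost m1 m2 s / N))"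
      by (intro sum.cong[OF refl] sum.swap)
    also have "\<dots> = (\<Sum>s\<in>Ss. \<Sum>m1=1..M. \<Sum>m2=1..N. pmf PS s / M * (?cost m1 m2 s / N))"
      by (rule sum.swap)
    finally show ?thesis by (simp only: sum_distrib_left sum_divide_distrib)
  qed
  also have "\<dots> \<le> (\<Sum>s\<in>Ss. \<Sum>m=1..M. pmf PS s / M * (if ?valid m s then ?e t x (fst (enc m s)) else 2))"
  proof (intro sum_mono mult_left_mono)
    fix s m
    show "(\<Sum>m2=1..N. ?cost m m2 s) / N \<le> (if ?valid m s then ?e t x (fst (enc m s)) else 2)"
    proof (cases "?valid m s")
      case True
      then obtain l where l: "l < L" "fst (enc m s) = t l" using enc(1) by blast
      have "(\<Sum>m2=1..N. of_bool (dec (\<phi> (x m2) (t l)) \<noteq> m2)) \<le> (\<Sum>m2=1..N. of_bool (collide \<phi> L N t x (t l) m2) :: real)"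
        using dec_ok[OF _ l(1)] by (intro sum_mono) (auto simp: of_bool_def)
      then have "(\<Sum>m2=1..N. ?cost m m2 s) / N \<le> ?e t x (t l)"
        using True by (simp only: if_P l) (rule divide_right_mono, simp_all)
      then show ?thesis using True by (simp only: if_P l)
    next
      case False
      then show ?thesis using LMN by (simp only: if_not_P) simp
    qed
  qed simp
  also have "\<dots> \<le> 2 * ?bA + ?bB" using enc(2) C(2) by linarith
  finally show thesis using that[of b dec x enc] b dec x by blast
qed

end

section \<open>Product distributions and typicality\<close>

text \<open>Independent letters that need not be identically distributed: one law for each letter of
  the time-sharing word.\<close>

primrec list_pmf :: "'a pmf list \<Rightarrow> 'a list pmf" where
  "list_pmf [] = return_pmf []"
| "list_pmf (p # ps) = map_pmf (\<lambda>(x, xs). x # xs) (pair_pmf p (list_pmf ps))"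

lemma finite_set_list_pmf: "(\<And>p. p \<in> set ps \<Longrightarrow> finite (set_pmf p)) \<Longrightarrow> finite (set_pmf (list_pmf ps))"
  by (induction ps) auto

lemma length_list_pmf: "xs \<in> set_pmf (list_pmf ps) \<Longrightarrow> length xs = length ps"
  by (induction ps arbitrary: xs) auto

lemma map_list_pmf: "map_pmf (map f) (list_pmf ps) = list_pmf (map (map_pmf f) ps)"
proof (induction ps)
  case (Cons p ps)
  have "map_pmf (map f) (list_pmf (p # ps)) = map_pmf (\<lambda>(x, xs). x # xs) (map_pmf (\<lambda>(x, xs). (f x, map f xs)) (pair_pmf p (list_pmf ps)))"
    by (simp add: pmf.map_comp o_def case_prod_unfold)
  also have "\<dots> = map_pmf (\<lambda>(x, xs). x # xs) (pair_pmf (map_pmf f p) (map_pmf (map f) (list_pmf ps)))"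
    by (simp only: map_pair)
  finally show ?case using Cons.IH by simp
qed simp

lemma list_pmf_replicate: "list_pmf (replicate n p) = replicate_pmf n p"
  by (induction n) (simp_all add: pair_pmf_def map_bind_pmf)

lemma pmf_list_pmf_Cons: "pmf (list_pmf (p # ps)) (x # xs) = pmf p x * pmf (list_pmf ps) xs"
proof -
  have "inj_on (\<lambda>(x, xs). x # xs) (UNIV :: ('a \<times> 'a list) set)" by (auto simp: inj_on_def)
  then have "pmf (list_pmf (p # ps)) ((\<lambda>(x, xs). x # xs) (x, xs)) = pmf (pair_pmf p (list_pmf ps)) (x, xs)"
    unfolding list_pmf.simps by (rule pmf_map_inj')
  then show ?thesis by (simp add: pmf_pair)
qed

text \<open>Log-probability of a single letter. Summed along a word it gives the logarithm of a
  block probability, so bounds on block probabilities become bounds on sums.\<close>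

definition log_mass :: "('q \<Rightarrow> 'w pmf) \<Rightarrow> ('w \<Rightarrow> 'a) \<Rightarrow> 'q \<times> 'w \<Rightarrow> real" where
  "log_mass K F = (\<lambda>(q, w). log 2 (pmf (map_pmf F (K q)) (F w)))"

lemma pmf_list_pmf_map:
  assumes "ws \<in> set_pmf (list_pmf (map K qs))"
  shows "pmf (list_pmf (map (\<lambda>q. map_pmf F (K q)) qs)) (map F ws)
    = 2 powr (\<Sum>z\<leftarrow>zip qs ws. log_mass K F z)"
  using assms
proof (induction qs arbitrary: ws)
  case (Cons q qs)
  then obtain v vs where ws: "ws = v # vs" "v \<in> set_pmf (K q)" "vs \<in> set_pmf (list_pmf (map K qs))" by auto
  have "pmf (map_pmf F (K q)) (F v) = 2 powr log_mass K F (q, v)"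
    using pmf_map_pos[OF ws(2), of F] by (simp add: log_mass_def)
  then show ?case
    using Cons.IH[OF ws(3)] unfolding ws by (simp add: pmf_list_pmf_Cons powr_add del: list_pmf.simps)
qed simp

lemma word_pmf:
  assumes "ws \<in> set_pmf (list_pmf (map K qs))"
  shows "pmf (map_pmf (map F) (list_pmf (map K qs))) (map F ws) = 2 powr (\<Sum>z\<leftarrow>zip qs ws. log_mass K F z)"
  using pmf_list_pmf_map[OF assms, of F] by (simp add: map_list_pmf o_def)

text \<open>A tuple of words such as (S^n, T1^n) is not a word of tuples: h produces the former and
  F the letters of the latter. The hypothesis says that both identify the same words with
  \<open>ws\<close>.\<close>

lemma word_pmf_of_letters:
  assumes ws: "ws \<in> set_pmf (list_pmf (map K qs))"
    and iff: "\<And>l. h l = h ws \<longleftrightarrow> map F l = map F ws"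
  shows "pmf (map_pmf h (list_pmf (map K qs))) (h ws) = 2 powr (\<Sum>z\<leftarrow>zip qs ws. log_mass K F z)"
proof -
  have "h -` {h ws} = map F -` {map F ws}" using iff by auto
  then show ?thesis unfolding word_pmf[OF ws, symmetric] by (simp add: pmf_map)
qed

lemma word_pmf_pair:
  assumes "ws \<in> set_pmf (list_pmf (map K qs))"
  shows "pmf (map_pmf (\<lambda>l. (map F l, map G l)) (list_pmf (map K qs))) (map F ws, map G ws)
    = 2 powr (\<Sum>z\<leftarrow>zip qs ws. log_mass K (\<lambda>w. (F w, G w)) z)"
  by (rule word_pmf_of_letters[OF assms]) (auto simp: list_eq_iff_nth_eq)

lemma word_pmf_triple:
  assumes "ws \<in> set_pmf (list_pmf (map K qs))"
  shows "pmf (map_pmf (\<lambda>l. (map F l, map G l, map H l)) (list_pmf (map K qs))) (map F ws, map G ws, map H ws)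
    = 2 powr (\<Sum>z\<leftarrow>zip qs ws. log_mass K (\<lambda>w. (F w, G w, H w)) z)"
  by (rule word_pmf_of_letters[OF assms]) (auto simp: list_eq_iff_nth_eq)

text \<open>Independence within each letter passes to the words. It identifies the product of the
  two codeword laws with a marginal of the joint word law.\<close>

lemma list_pmf_pair:
  assumes "\<And>q. q \<in> set qs \<Longrightarrow> map_pmf (\<lambda>w. (F w, G w)) (K q) = pair_pmf (map_pmf F (K q)) (map_pmf G (K q))"
  shows "map_pmf (\<lambda>l. (map F l, map G l)) (list_pmf (map K qs))
    = pair_pmf (map_pmf (map F) (list_pmf (map K qs))) (map_pmf (map G) (list_pmf (map K qs)))"
  using assms
proof (induction qs)
  case Nil
  then show ?case by simp
next
  case (Cons q qs)
  let ?R = "list_pmf (map K qs)"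
  let ?c = "\<lambda>((a, b), (as, bs)). (a # as, b # bs)"
  have IH: "map_pmf (\<lambda>l. (map F l, map G l)) ?R = pair_pmf (map_pmf (map F) ?R) (map_pmf (map G) ?R)"
    using Cons by simp
  have "map_pmf (\<lambda>l. (map F l, map G l)) (list_pmf (map K (q # qs)))
      = map_pmf ?c (map_pmf (\<lambda>(x, l). ((F x, G x), (map F l, map G l))) (pair_pmf (K q) ?R))"
    by (simp add: pmf.map_comp o_def case_prod_unfold)
  also have "\<dots> = map_pmf ?c (pair_pmf (map_pmf (\<lambda>w. (F w, G w)) (K q)) (map_pmf (\<lambda>l. (map F l, map G l)) ?R))"
    by (simp only: map_pair)
  also have "\<dots> = map_pmf ?c (pair_pmf (pair_pmf (map_pmf F (K q)) (map_pmf G (K q))) (pair_pmf (map_pmf (map F) ?R) (map_pmf (map G) ?R)))"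
    using Cons.prems IH by simp
  also have "\<dots> = pair_pmf (map_pmf (\<lambda>(x, xs). x # xs) (pair_pmf (map_pmf F (K q)) (map_pmf (map F) ?R)))
      (map_pmf (\<lambda>(x, xs). x # xs) (pair_pmf (map_pmf G (K q)) (map_pmf (map G) ?R)))"
    unfolding pair_pmf_def map_bind_pmf bind_assoc_pmf bind_return_pmf bind_map_pmf map_return_pmf split
    by (subst (2) bind_commute_pmf) (rule refl)
  also have "\<dots> = pair_pmf (map_pmf (map F) (list_pmf (map K (q # qs)))) (map_pmf (map G) (list_pmf (map K (q # qs))))"
    by (simp only: map_list_pmf) (simp only: list.map list_pmf.simps(2) map_map o_def)
  finally show ?case .
qed

text \<open>Drawing the time-sharing word and then the letters given it amounts to drawing n i.i.d.
  pairs, so concentration is needed for i.i.d. sequences only.\<close>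

lemma list_pmf_mixture:
  "bind_pmf (replicate_pmf n R) (\<lambda>qs. map_pmf (zip qs) (list_pmf (map K qs)))
    = replicate_pmf n (bind_pmf R (\<lambda>q. map_pmf (Pair q) (K q)))"
proof (induction n)
  case (Suc n)
  let ?J = "bind_pmf R (\<lambda>q. map_pmf (Pair q) (K q))"
  have "bind_pmf (replicate_pmf (Suc n) R) (\<lambda>qs. map_pmf (zip qs) (list_pmf (map K qs)))
    = bind_pmf R (\<lambda>q. bind_pmf (replicate_pmf n R) (\<lambda>qs. bind_pmf (K q) (\<lambda>w. bind_pmf (list_pmf (map K qs)) (\<lambda>ws. return_pmf ((q, w) # zip qs ws)))))"
    by (simp add: pair_pmf_def map_bind_pmf bind_assoc_pmf bind_return_pmf)
  also have "\<dots> = bind_pmf R (\<lambda>q. bind_pmf (K q) (\<lambda>w. bind_pmf (replicate_pmf n R) (\<lambda>qs. bind_pmf (list_pmf (map K qs)) (\<lambda>ws. return_pmf ((q, w) # zip qs ws)))))"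
    by (intro bind_pmf_cong refl bind_commute_pmf)
  also have "\<dots> = bind_pmf ?J (\<lambda>z. bind_pmf (bind_pmf (replicate_pmf n R) (\<lambda>qs. map_pmf (zip qs) (list_pmf (map K qs)))) (\<lambda>zs. return_pmf (z # zs)))"
    by (simp add: bind_assoc_pmf bind_map_pmf)
  also have "\<dots> = replicate_pmf (Suc n) ?J"
    unfolding Suc.IH by simp
  finally show ?case .
qed (simp add: bind_return_pmf)

lemma expect_replicate_sum_square:
  assumes fin: "finite (set_pmf p)" and mean: "expect p h = 0"
  shows "expect (replicate_pmf n p) (\<lambda>xs. (\<Sum>x\<leftarrow>xs. h x)\<^sup>2) = n * expect p (\<lambda>x. (h x)\<^sup>2)"
proof (induction n)
  case (Suc n)
  let ?J = "replicate_pmf n p"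
  have finJ: "finite (set_pmf ?J)" using fin by (rule finite_set_replicate_pmf)
  have "expect (replicate_pmf (Suc n) p) (\<lambda>xs. (\<Sum>x\<leftarrow>xs. h x)\<^sup>2) = expect p (\<lambda>x. expect ?J (\<lambda>xs. (h x + (\<Sum>x\<leftarrow>xs. h x))\<^sup>2))"
    using fin finJ by (simp add: expect_bind)
  also have "\<dots> = expect p (\<lambda>x. ((h x)\<^sup>2 + expect ?J (\<lambda>xs. (\<Sum>x\<leftarrow>xs. h x)\<^sup>2)) + h x * (2 * expect ?J (\<lambda>xs. \<Sum>x\<leftarrow>xs. h x)))"
    using finJ by (simp add: power2_sum expect_add mult_ac)
  also have "\<dots> = (expect p (\<lambda>x. (h x)\<^sup>2) + expect ?J (\<lambda>xs. (\<Sum>x\<leftarrow>xs. h x)\<^sup>2)) + expect p h * (2 * expect ?J (\<lambda>xs. \<Sum>x\<leftarrow>xs. h x))"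
    using fin by (simp only: expect_add) simp
  finally show ?case using Suc.IH mean by (simp add: algebra_simps)
qed simp

text \<open>The upper tail alone is estimated, since typicality serves only to bound probabilities
  of words from above.\<close>

lemma chebyshev_replicate:
  assumes fin: "finite (set_pmf p)" and n: "0 < n" and \<delta>: "0 < \<delta>"
  shows "pr (replicate_pmf n p) {xs. (\<Sum>x\<leftarrow>xs. f x) > n * (expect p f + \<delta>)}
    \<le> expect p (\<lambda>x. (f x - expect p f)\<^sup>2) / (n * \<delta>\<^sup>2)"
proof -
  let ?m = "expect p f" and ?J = "replicate_pmf n p"
  let ?h = "\<lambda>x. f x - ?m"
  have finJ: "finite (set_pmf ?J)" using fin by (rule finite_set_replicate_pmf)
  have "pr ?J {xs. (\<Sum>x\<leftarrow>xs. f x) > n * (?m + \<delta>)} = expect ?J (\<lambda>xs. of_bool ((\<Sum>x\<leftarrow>xs. f x) > n * (?m + \<delta>)))"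
    by (simp only: expect_of_bool)
  also have "\<dots> \<le> expect ?J (\<lambda>xs. (\<Sum>x\<leftarrow>xs. ?h x)\<^sup>2 / (n * \<delta>)\<^sup>2)"
  proof (rule expect_mono[OF finJ])
    fix xs assume "xs \<in> set_pmf ?J"
    then have len: "length xs = n" by (simp add: set_replicate_pmf)
    have s: "(\<Sum>x\<leftarrow>xs. ?h x) = (\<Sum>x\<leftarrow>xs. f x) - n * ?m"
      unfolding len[symmetric] by (simp add: sum_list_subtractf sum_list_triv)
    show "of_bool ((\<Sum>x\<leftarrow>xs. f x) > n * (?m + \<delta>)) \<le> (\<Sum>x\<leftarrow>xs. ?h x)\<^sup>2 / (n * \<delta>)\<^sup>2"
    proof (cases "(\<Sum>x\<leftarrow>xs. f x) > n * (?m + \<delta>)")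
      case True
      then have "n * \<delta> \<le> (\<Sum>x\<leftarrow>xs. ?h x)" unfolding s by (simp add: algebra_simps)
      then have "(n * \<delta>)\<^sup>2 \<le> (\<Sum>x\<leftarrow>xs. ?h x)\<^sup>2" using n \<delta> by (intro power_mono) auto
      then show ?thesis using True n \<delta> by simp
    qed simp
  qed
  also have "\<dots> = (n * expect p (\<lambda>x. (?h x)\<^sup>2)) / (n * \<delta>)\<^sup>2"
  proof -
    have "expect p ?h = 0" using fin by (simp add: expect_diff)
    from expect_replicate_sum_square[OF fin this, of n] show ?thesis by simp
  qed
  also have "\<dots> = expect p (\<lambda>x. (?h x)\<^sup>2) / (n * \<delta>\<^sup>2)"
    using n by (simp add: power2_eq_square)
  finally show ?thesis .
qed

lemma prob_bind:
  assumes "finite (set_pmf P)" "\<And>x. x \<in> set_pmf P \<Longrightarrow> finite (set_pmf (K x))"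
  shows "pr (bind_pmf P K) A = expect P (\<lambda>x. pr (K x) A)"
proof -
  have "expect (bind_pmf P K) (indicat_real A) = expect P (\<lambda>x. expect (K x) (indicat_real A))"
    by (rule expect_bind[OF assms])
  then show ?thesis by simp
qed

text \<open>Encoders and decoders share no randomness, so one time-sharing word has to be fixed. The
  mean over \<open>qs\<close> of the conditional bad probability is an i.i.d. tail probability, and
  some \<open>qs\<close> is no worse than the mean.\<close>

lemma exists_typical_time_sharing:
  fixes R :: "'q pmf" and K :: "'q \<Rightarrow> 'w pmf" and f :: "'i \<Rightarrow> 'q \<times> 'w \<Rightarrow> real"
  assumes fin: "finite (set_pmf R)" "\<And>q. finite (set_pmf (K q))" and n: "0 < n" and \<delta>: "0 < \<delta>" and I: "finite I"
  defines "J \<equiv> bind_pmf R (\<lambda>q. map_pmf (Pair q) (K q))"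
  obtains qs where "length qs = n" "qs \<in> set_pmf (replicate_pmf n R)"
    "pr (list_pmf (map K qs)) {ws. \<exists>i\<in>I. (\<Sum>z\<leftarrow>zip qs ws. f i z) > n * (expect J (f i) + \<delta>)}
      \<le> (\<Sum>i\<in>I. expect J (\<lambda>z. (f i z - expect J (f i))\<^sup>2)) / (n * \<delta>\<^sup>2)"
proof -
  let ?E = "{zs. \<exists>i\<in>I. (\<Sum>z\<leftarrow>zs. f i z) > n * (expect J (f i) + \<delta>)}"
  let ?c = "(\<Sum>i\<in>I. expect J (\<lambda>z. (f i z - expect J (f i))\<^sup>2)) / (n * \<delta>\<^sup>2)"
  have finJ: "finite (set_pmf J)" using fin by (simp add: J_def)
  have finL: "finite (set_pmf (list_pmf (map K qs)))" for qs
    using fin by (intro finite_set_list_pmf) auto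
  have "expect (replicate_pmf n R) (\<lambda>qs. pr (list_pmf (map K qs)) (zip qs -` ?E))
      = pr (replicate_pmf n J) ?E"
    unfolding J_def list_pmf_mixture[symmetric]
    by (subst prob_bind) (use fin finL in \<open>simp_all add: finite_set_replicate_pmf\<close>)
  also have "pr (replicate_pmf n J) ?E
      \<le> (\<Sum>i\<in>I. pr (replicate_pmf n J) {zs. (\<Sum>z\<leftarrow>zs. f i z) > n * (expect J (f i) + \<delta>)})"
  proof -
    have "?E = (\<Union>i\<in>I. {zs. (\<Sum>z\<leftarrow>zs. f i z) > n * (expect J (f i) + \<delta>)})" by auto
    then show ?thesis
      by (simp only:) (rule measure_pmf.finite_measure_subadditive_finite[OF I], simp)
  qed
  also have "\<dots> \<le> (\<Sum>i\<in>I. expect J (\<lambda>z. (f i z - expect J (f i))\<^sup>2) / (n * \<delta>\<^sup>2))"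
    by (intro sum_mono chebyshev_replicate finJ n \<delta>)
  also have "\<dots> = ?c" by (simp add: sum_divide_distrib)
  finally have "expect (replicate_pmf n R) (\<lambda>qs. pr (list_pmf (map K qs)) (zip qs -` ?E)) \<le> ?c" .
  then obtain qs where qs: "qs \<in> set_pmf (replicate_pmf n R)" "pr (list_pmf (map K qs)) (zip qs -` ?E) \<le> ?c"
    using exists_le_expect[OF finite_set_replicate_pmf[OF fin(1)], of n _ ?c] by blast
  have "zip qs -` ?E = {ws. \<exists>i\<in>I. (\<Sum>z\<leftarrow>zip qs ws. f i z) > n * (expect J (f i) + \<delta>)}" by auto
  then show thesis using qs by (intro that[of qs]) (auto simp: set_replicate_pmf)
qed

section \<open>Achievability\<close>

lemma input_pmf_eq_pair:
  "input_pmf pS k p = map_pmf (\<lambda>((s, x1), x2). (s, x1, x2)) (pair_pmf (bind_pmf pS (\<lambda>s. map_pmf (Pair s) (k s))) p)"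
  by (simp add: input_pmf_def pair_pmf_def map_bind_pmf bind_assoc_pmf bind_map_pmf map_pmf_def[of _ p] bind_return_pmf)

lemma input_pmf_indep:
  "map_pmf (\<lambda>w. ((\<lambda>(s, x1, x2). F s x1) w, (\<lambda>(s, x1, x2). x2) w)) (input_pmf pS k p)
   = pair_pmf (map_pmf (\<lambda>(s, x1, x2). F s x1) (input_pmf pS k p)) (map_pmf (\<lambda>(s, x1, x2). x2) (input_pmf pS k p))"
proof -
  let ?J = "pair_pmf (bind_pmf pS (\<lambda>s. map_pmf (Pair s) (k s))) p"
  have "map_pmf (\<lambda>w. ((\<lambda>(s, x1, x2). F s x1) w, (\<lambda>(s, x1, x2). x2) w)) (input_pmf pS k p)
      = map_pmf (\<lambda>(a, b). ((\<lambda>(s, x1). F s x1) a, id b)) ?J"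
    unfolding input_pmf_eq_pair by (simp add: pmf.map_comp o_def case_prod_unfold)
  also have "\<dots> = pair_pmf (map_pmf (\<lambda>(s, x1). F s x1) (map_pmf fst ?J)) (map_pmf id (map_pmf snd ?J))"
    unfolding map_pair map_fst_pair_pmf map_snd_pair_pmf ..
  also have "\<dots> = pair_pmf (map_pmf (\<lambda>(s, x1, x2). F s x1) (input_pmf pS k p)) (map_pmf (\<lambda>(s, x1, x2). x2) (input_pmf pS k p))"
    unfolding input_pmf_eq_pair by (simp add: pmf.map_comp o_def case_prod_unfold)
  finally show ?thesis .
qed

lemma map_fst_input_pmf: "map_pmf (\<lambda>(s, x1, x2). s) (input_pmf pS k p) = pS"
  by (simp add: input_pmf_def map_bind_pmf pmf.map_comp o_def bind_return_pmf')

text \<open>Used with a the T1-word and b the input word of sender 2: dividing by p(a) gives the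
  probability that a fresh input word reproduces the output while the T1-word is kept.\<close>

lemma pmf_map_pair_graph:
  assumes fin: "finite (set_pmf P)" "finite (set_pmf R)"
  shows "pmf (map_pmf (\<lambda>(a, b). (a, h b a)) (pair_pmf P R)) (a, c) = pmf P a * pr R {b. h b a = c}"
proof -
  have "pmf (map_pmf (\<lambda>(a, b). (a, h b a)) (pair_pmf P R)) (a, c) = pr (pair_pmf P R) {z. fst z = a \<and> h (snd z) a = c}"
    by (auto simp: pmf_map vimage_def case_prod_unfold intro!: arg_cong[where f = "pr (pair_pmf P R)"])
  also have "\<dots> = expect (pair_pmf P R) (\<lambda>z. of_bool (fst z = a \<and> h (snd z) a = c))"
    by (simp only: expect_of_bool)
  also have "\<dots> = expect P (\<lambda>a'. expect R (\<lambda>b. of_bool (a' = a) * of_bool (h b a = c)))"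
    using fin by (simp add: expect_pair of_bool_conj)
  also have "\<dots> = expect P (\<lambda>a'. of_bool (a' = a)) * pr R {b. h b a = c}"
    by (simp add: expect_of_bool)
  also have "expect P (\<lambda>a'. of_bool (a' = a)) = pmf P a"
    by (simp add: expect_of_bool pmf.rep_eq)
  finally show ?thesis .
qed

lemma expect_log_mass:
  assumes "finite (set_pmf R)" "\<And>q. finite (set_pmf (K q))"
  shows "expect (bind_pmf R (\<lambda>q. map_pmf (Pair q) (K q))) (log_mass K F) = - expect R (\<lambda>q. ent (K q) F)"
  using assms by (simp add: expect_bind log_mass_def ent_def)

lemma pmf_map_eq_prob: "pmf (map_pmf f P) c = pr P {x. f x = c}"
  by (simp add: pmf_map vimage_def)

text \<open>\<open>f0\<close> to \<open>f4\<close> are the per-letter exponents behind \<alpha>,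
  \<beta>, \<gamma>, \<kappa> and \<nu>. Their means are -H(Y1|S,Q), I(T1;S|Q), I(T1;S|Q) -
  H(Y1|T1,S,Q), -H(Y2|T1,Q) and -H(Y2|Q). In \<open>5 * pe\<close>, four parts come from the
  covering bound and one from packing.\<close>

lemma block_code_exists:
  fixes pS :: "'s::finite pmf" and pQ :: "'q::finite pmf" and k :: "'q \<Rightarrow> 's \<Rightarrow> 'x1::finite pmf" and p :: "'q \<Rightarrow> 'x2::finite pmf"
    and y1 :: "'x1 \<Rightarrow> 's \<Rightarrow> 'y1" and t1 :: "'x1 \<Rightarrow> 's \<Rightarrow> 't1" and y2 :: "'x2 \<Rightarrow> 't1 \<Rightarrow> 'y2"
    and L M N n :: nat and \<delta> pe :: real and ex :: "('q \<times> 's \<times> 'x1 \<times> 'x2 \<Rightarrow> real) \<Rightarrow> real"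
  defines "K \<equiv> \<lambda>q. input_pmf pS (k q) (p q)"
    and "S \<equiv> \<lambda>(s :: 's, x1 :: 'x1, x2 :: 'x2). s" and "T \<equiv> \<lambda>(s :: 's, x1 :: 'x1, x2 :: 'x2). t1 x1 s" and "Y \<equiv> \<lambda>(s :: 's, x1 :: 'x1, x2 :: 'x2). y1 x1 s"
    and "X \<equiv> \<lambda>(s :: 's, x1 :: 'x1, x2 :: 'x2). x2" and "Z \<equiv> \<lambda>(s :: 's, x1 :: 'x1, x2 :: 'x2). y2 x2 (t1 x1 s)"
  defines "J \<equiv> bind_pmf pQ (\<lambda>q. map_pmf (Pair q) (K q))"
  defines "f0 \<equiv> \<lambda>z. log_mass K (\<lambda>w. (S w, Y w)) z - log_mass K S z"
    and "f1 \<equiv> \<lambda>z. log_mass K (\<lambda>w. (S w, T w)) z - log_mass K S z - log_mass K T z"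
    and "f2 \<equiv> \<lambda>z. log_mass K (\<lambda>w. (S w, T w, Y w)) z - log_mass K S z - log_mass K T z"
    and "f3 \<equiv> \<lambda>z. log_mass K (\<lambda>w. (T w, Z w)) z - log_mass K T z"
    and "f4 \<equiv> log_mass K Z"
  defines "I \<equiv> {f0, f1, f2, f3, f4}"
  defines "pe \<equiv> (\<Sum>f\<in>I. expect J (\<lambda>z. (f z - expect J f)\<^sup>2)) / (n * \<delta>\<^sup>2)"
    and "ex \<equiv> \<lambda>f. 2 powr (n * (expect J f + \<delta>))"
  assumes pos: "0 < L" "0 < M" "0 < N" "0 < n" "0 < \<delta>"
  obtains enc :: "nat \<Rightarrow> 's list \<Rightarrow> 'x1 list" and cb :: "nat \<Rightarrow> 'x2 list" and b :: "'y1 list \<Rightarrow> nat" and dec :: "'y2 list \<Rightarrow> nat"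
  where "\<And>ys. b ys \<in> {1..M}" "\<And>zs. dec zs \<in> {1..N}"
    "\<And>m s. length s = n \<Longrightarrow> length (enc m s) = n" "\<And>m. m \<in> {1..N} \<Longrightarrow> length (cb m) = n"
    "pr (pair_pmf (pmf_of_set {1..M}) (pair_pmf (pmf_of_set {1..N}) (replicate_pmf n pS)))
      {(m1, m2, s). b (map2 y1 (enc m1 s) s) \<noteq> m1}
     \<le> 5 * pe + 2 * sqrt ((real M - 1) * ex f0 + ex f1 / L + (real M - 1) * ex f2 / L) + (real N - 1) * (ex f3 + L * ex f4)"
    "pr (pair_pmf (pmf_of_set {1..M}) (pair_pmf (pmf_of_set {1..N}) (replicate_pmf n pS)))
      {(m1, m2, s). dec (map2 y2 (cb m2) (map2 t1 (enc m1 s) s)) \<noteq> m2}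
     \<le> 5 * pe + 2 * sqrt ((real M - 1) * ex f0 + ex f1 / L + (real M - 1) * ex f2 / L) + (real N - 1) * (ex f3 + L * ex f4)"
proof -
  obtain qs where qs: "length qs = n"
    "pr (list_pmf (map K qs)) {ws. \<exists>f\<in>I. (\<Sum>z\<leftarrow>zip qs ws. f z) > n * (expect J f + \<delta>)} \<le> pe"
    using exists_typical_time_sharing[where f = "\<lambda>f. f" and I = I and R = pQ and K = K and n = n and \<delta> = \<delta>] pos
    unfolding J_def[symmetric] pe_def by (auto simp: I_def)
  define D where "D = list_pmf (map K qs)"
  have finD: "finite (set_pmf D)" unfolding D_def by (rule finite_set_list_pmf) simp
  define W where "W = map_pmf (\<lambda>l. (map S l, map T l, map Y l)) D"
  define V where "V = map_pmf (map X) D"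
  define \<phi> where "\<phi> = (\<lambda>(v :: 'x2 list) (t :: 't1 list). map2 y2 v t)"
  interpret covering W by standard (simp add: W_def finD)
  have finV: "finite (set_pmf V)" by (simp add: V_def finD)
  have PS: "PS = map_pmf (map S) D" unfolding PS_def by (simp add: W_def pmf.map_comp o_def)
  have PT: "PT = map_pmf (map T) D" unfolding PT_def by (simp add: W_def pmf.map_comp o_def case_prod_unfold)
  have PSr: "PS = replicate_pmf n pS"
    unfolding PS D_def map_list_pmf
    by (simp add: K_def S_def map_fst_input_pmf o_def map_replicate_const qs(1) list_pmf_replicate)
  have PTV: "pair_pmf PT V = map_pmf (\<lambda>l. (map T l, map X l)) D"
    unfolding PT V_def D_def
    by (rule list_pmf_pair[symmetric]) (simp add: K_def T_def X_def input_pmf_indep)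
  have PSY: "map_pmf (\<lambda>(s, t, y). (s, y)) W = map_pmf (\<lambda>l. (map S l, map Y l)) D"
    and PST: "map_pmf (\<lambda>(s, t, y). (s, t)) W = map_pmf (\<lambda>l. (map S l, map T l)) D"
    by (simp_all add: W_def pmf.map_comp o_def case_prod_unfold)
  have \<phi>Z: "\<phi> (map X l) (map T l) = map Z l" for l
    by (auto simp: \<phi>_def Z_def X_def T_def case_prod_unfold intro!: nth_equalityI)
  \<comment> \<open>The typical sets are defined by the very inequalities that covering and packing
    ask for; typicality of the letters only has to imply membership.\<close>
  define A where "A = {(s, t, y). pmf (map_pmf (\<lambda>(s, t, y). (s, y)) W) (s, y) \<le> ex f0 * pmf PS s
    \<and> pmf (map_pmf (\<lambda>(s, t, y). (s, t)) W) (s, t) \<le> ex f1 * pmf PS s * pmf PT t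
    \<and> pmf W (s, t, y) \<le> ex f2 * pmf PS s * pmf PT t}"
  define B where "B = {(\<tau>, v). pr V {v'. \<phi> v' \<tau> = \<phi> v \<tau>} \<le> ex f3
    \<and> pr (pair_pmf PT V) {(\<tau>', v'). \<phi> v' \<tau>' = \<phi> v \<tau>} \<le> ex f4}"
  let ?bad = "{ws. \<exists>f\<in>I. (\<Sum>z\<leftarrow>zip qs ws. f z) > n * (expect J f + \<delta>)}"
  have good: "(map S l, map T l, map Y l) \<in> A" "(map T l, map X l) \<in> B" if l: "l \<in> set_pmf D" and ok: "l \<notin> ?bad" for l
  proof -
    have l': "l \<in> set_pmf (list_pmf (map K qs))" using l by (simp add: D_def)
    let ?s = "\<lambda>F. \<Sum>z\<leftarrow>zip qs l. log_mass K F z"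
    have f: "(\<Sum>z\<leftarrow>zip qs l. f z) \<le> n * (expect J f + \<delta>)" if "f \<in> I" for f using ok that by force
    have exf: "2 powr a \<le> ex f * 2 powr c" if "f \<in> I" "a - c = (\<Sum>z\<leftarrow>zip qs l. f z)" for f a c
      using f[OF that(1)] that(2) by (simp add: ex_def powr_add[symmetric])
    have s: "pmf PS (map S l) = 2 powr ?s S" unfolding PS D_def by (rule word_pmf[OF l'])
    have t: "pmf PT (map T l) = 2 powr ?s T" unfolding PT D_def by (rule word_pmf[OF l'])
    have sy: "pmf (map_pmf (\<lambda>(s, t, y). (s, y)) W) (map S l, map Y l) = 2 powr ?s (\<lambda>w. (S w, Y w))"
      unfolding PSY D_def by (rule word_pmf_pair[OF l'])
    have st: "pmf (map_pmf (\<lambda>(s, t, y). (s, t)) W) (map S l, map T l) = 2 powr ?s (\<lambda>w. (S w, T w))"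
      unfolding PST D_def by (rule word_pmf_pair[OF l'])
    have sty: "pmf W (map S l, map T l, map Y l) = 2 powr ?s (\<lambda>w. (S w, T w, Y w))"
      unfolding W_def D_def by (rule word_pmf_triple[OF l'])
    have c0: "2 powr ?s (\<lambda>w. (S w, Y w)) \<le> ex f0 * 2 powr ?s S"
      by (rule exf) (simp_all add: I_def f0_def sum_list_subtractf)
    have c1: "2 powr ?s (\<lambda>w. (S w, T w)) \<le> ex f1 * 2 powr (?s S + ?s T)"
      by (rule exf) (simp_all add: I_def f1_def sum_list_subtractf)
    have c2: "2 powr ?s (\<lambda>w. (S w, T w, Y w)) \<le> ex f2 * 2 powr (?s S + ?s T)"
      by (rule exf) (simp_all add: I_def f2_def sum_list_subtractf)
    show "(map S l, map T l, map Y l) \<in> A"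
      unfolding A_def using c0 c1 c2 by (simp add: s t sy st sty powr_add mult.assoc)
    \<comment> \<open>Given the T1-word, a fresh input word reproduces the output with probability
      p(z|t) = p(t,z) / p(t).\<close>
    have "pmf PT (map T l) * pr V {v'. \<phi> v' (map T l) = map Z l}
        = pmf (map_pmf (\<lambda>(a, b). (a, \<phi> b a)) (pair_pmf PT V)) (map T l, map Z l)"
      by (rule pmf_map_pair_graph[symmetric]) (simp_all add: finV)
    also have "\<dots> = pmf (map_pmf (\<lambda>l. (map T l, map Z l)) D) (map T l, map Z l)"
      unfolding PTV by (simp add: pmf.map_comp o_def \<phi>Z)
    also have "\<dots> = 2 powr ?s (\<lambda>w. (T w, Z w))"
      unfolding D_def by (rule word_pmf_pair[OF l'])
    also have "\<dots> \<le> ex f3 * 2 powr ?s T"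
      by (rule exf) (simp_all add: I_def f3_def sum_list_subtractf)
    finally have c3: "pr V {v'. \<phi> v' (map T l) = map Z l} \<le> ex f3"
      by (simp add: t mult.commute)
    have "pr (pair_pmf PT V) {(\<tau>', v'). \<phi> v' \<tau>' = map Z l}
        = pmf (map_pmf (\<lambda>(\<tau>, v). \<phi> v \<tau>) (pair_pmf PT V)) (map Z l)"
      by (simp add: pmf_map_eq_prob case_prod_unfold)
    also have "\<dots> = pmf (map_pmf (map Z) D) (map Z l)"
      unfolding PTV by (simp add: pmf.map_comp o_def \<phi>Z)
    also have "\<dots> = 2 powr ?s Z" unfolding D_def by (rule word_pmf[OF l'])
    also have "\<dots> \<le> ex f4 * 2 powr 0"
      by (rule exf) (simp_all add: I_def f4_def)
    finally have c4: "pr (pair_pmf PT V) {(\<tau>', v'). \<phi> v' \<tau>' = map Z l} \<le> ex f4" by simp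
    show "(map T l, map X l) \<in> B" unfolding B_def using c3 c4 by (simp add: \<phi>Z)
  qed
  have pA: "pr W (- A) \<le> pe"
  proof -
    have "pr W (- A) = pr D {l. (map S l, map T l, map Y l) \<notin> A}"
      by (simp add: W_def vimage_def)
    also have "\<dots> \<le> pr D ?bad"
      by (rule measure_pmf.finite_measure_mono_AE) (use good(1) in \<open>auto simp: AE_measure_pmf_iff\<close>)
    finally show ?thesis using qs(2) by (simp add: D_def)
  qed
  have pB: "pr (pair_pmf PT V) (- B) \<le> pe"
  proof -
    have "pr (pair_pmf PT V) (- B) = pr D {l. (map T l, map X l) \<notin> B}"
      by (simp add: PTV vimage_def)
    also have "\<dots> \<le> pr D ?bad"
      by (rule measure_pmf.finite_measure_mono_AE) (use good(2) in \<open>auto simp: AE_measure_pmf_iff\<close>)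
    finally show ?thesis using qs(2) by (simp add: D_def)
  qed
  let ?U = "pair_pmf (pmf_of_set {1..M}) (pair_pmf (pmf_of_set {1..N}) PS)"
  let ?bound = "5 * pe + 2 * sqrt ((real M - 1) * ex f0 + ex f1 / L + (real M - 1) * ex f2 / L) + (real N - 1) * (ex f3 + L * ex f4)"
  obtain enc b cb dec where code: "\<And>y. b y \<in> {1..M}" "\<And>z. dec z \<in> {1..N}" "\<And>m. m \<in> {1..N} \<Longrightarrow> cb m \<in> set_pmf V"
    and cost: "expect ?U (\<lambda>(m1, m2, s). if (s, enc m1 s) \<in> set_pmf W \<and> b (snd (enc m1 s)) = m1
        then of_bool (dec (\<phi> (cb m2) (fst (enc m1 s))) \<noteq> m2) else 2)
     \<le> 2 * (2 * pr W (- A) + sqrt ((real M - 1) * ex f0 + ex f1 / L + (real M - 1) * ex f2 / L))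
       + (pr (pair_pmf PT V) (- B) + (real N - 1) * (ex f3 + L * ex f4))"
    by (rule one_shot_code[OF finV pos(1-3), where A = A and B = B and \<alpha> = "ex f0" and \<beta> = "ex f1" and \<gamma> = "ex f2"
          and \<kappa> = "ex f3" and \<nu> = "ex f4" and \<phi> = \<phi>])
      (auto simp: A_def B_def ex_def)
  \<comment> \<open>An input word that realises the prescribed T1- and Y1-words. It exists because
    the triple lies in the support of W; the default also has length n, so the length never depends
    on validity.\<close>
  define x where "x m s = (if (s, enc m s) \<in> set_pmf W
     then SOME xs. length xs = n \<and> map2 t1 xs s = fst (enc m s) \<and> map2 y1 xs s = snd (enc m s)
     else replicate n undefined)" for m s
  have x: "length (x m s) = n \<and> map2 t1 (x m s) s = fst (enc m s) \<and> map2 y1 (x m s) s = snd (enc m s)"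
    if "(s, enc m s) \<in> set_pmf W" for m s
  proof -
    from that obtain l where "l \<in> set_pmf D" "(s, enc m s) = (map S l, map T l, map Y l)"
      unfolding W_def set_map_pmf by blast
    then have l: "l \<in> set_pmf D" "s = map S l" "enc m s = (map T l, map Y l)" unfolding prod.inject by blast+
    have "length l = n" using length_list_pmf[of l "map K qs"] l(1) by (simp add: D_def qs(1))
    then have "length (map (\<lambda>(s, x1, x2). x1) l) = n \<and> map2 t1 (map (\<lambda>(s, x1, x2). x1) l) s = fst (enc m s)
        \<and> map2 y1 (map (\<lambda>(s, x1, x2). x1) l) s = snd (enc m s)"
      unfolding l(3) unfolding l(2) by (auto simp: S_def T_def Y_def case_prod_unfold intro!: nth_equalityI)
    then have "\<exists>xs. length xs = n \<and> map2 t1 xs s = fst (enc m s) \<and> map2 y1 xs s = snd (enc m s)" by blast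
    from someI_ex[OF this] show ?thesis using that by (simp add: x_def)
  qed
  have xlen: "length (x m s) = n" for m s
    using x[of s m] by (cases "(s, enc m s) \<in> set_pmf W") (auto simp: x_def)
  have cblen: "length (cb m) = n" if "m \<in> {1..N}" for m
    using code(3)[OF that] length_list_pmf[of _ "map K qs"] by (auto simp: V_def D_def qs(1))
  have finU: "finite (set_pmf ?U)" using pos by simp
  let ?cost = "\<lambda>(m1, m2, s). if (s, enc m1 s) \<in> set_pmf W \<and> b (snd (enc m1 s)) = m1
        then of_bool (dec (\<phi> (cb m2) (fst (enc m1 s))) \<noteq> m2) else 2 :: real"
  \<comment> \<open>The cost 2 exceeds either error indicator, and on valid pairs the colour is
    right, so receiver 1 does not err. One bound thus serves both receivers.\<close>
  have le: "pr ?U {w. E w} \<le> ?bound" if "\<And>m1 m2 s. of_bool (E (m1, m2, s)) \<le> ?cost (m1, m2, s)" for E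
  proof -
    have "pr ?U {w. E w} = expect ?U (\<lambda>w. of_bool (E w))" by (simp only: expect_of_bool)
    also have "\<dots> \<le> expect ?U ?cost"
    proof (rule expect_mono[OF finU])
      fix w :: "nat \<times> nat \<times> 's list"
      obtain m1 m2 s where "w = (m1, m2, s)" by (rule prod_cases3)
      then show "of_bool (E w) \<le> ?cost w" using that[of m1 m2 s] by (simp only:)
    qed
    also have "\<dots> \<le> ?bound" using cost pA pB by simp
    finally show ?thesis .
  qed
  have e1: "pr ?U {w. (\<lambda>(m1, m2, s). b (map2 y1 (x m1 s) s) \<noteq> m1) w} \<le> ?bound"
    by (rule le) (auto simp: x)
  have e2: "pr ?U {w. (\<lambda>(m1, m2, s). dec (map2 y2 (cb m2) (map2 t1 (x m1 s) s)) \<noteq> m2) w} \<le> ?bound"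
    by (rule le) (auto simp: x \<phi>_def)
  show thesis
    by (rule that[of b dec x cb]) (use code(1,2) xlen cblen e1 e2 in \<open>simp_all add: PSr case_prod_unfold\<close>)
qed

section \<open>From block codes to achievable rates\<close>

lemma is_code_of_words:
  fixes b :: "'y1 list \<Rightarrow> nat" and dec :: "'y2 list \<Rightarrow> nat"
  assumes b: "\<And>ys. b ys \<in> msgs n R1" and dec: "\<And>zs. dec zs \<in> msgs n R2"
    and len: "\<And>m s. length s = n \<Longrightarrow> length (enc m s) = n" "\<And>m. m \<in> msgs n R2 \<Longrightarrow> length (cb m) = n"
    and e1: "pr (source_pmf pS n R1 R2) {(m1, m2, s). b (map2 y1 (enc m1 s) s) \<noteq> m1} \<le> \<epsilon>"
    and e2: "pr (source_pmf pS n R1 R2) {(m1, m2, s). dec (map2 y2 (cb m2) (map2 t1 (enc m1 s) s)) \<noteq> m2} \<le> \<epsilon>"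
  shows "\<exists>f1 f2 g1 g2. is_code pS y1 t1 y2 n R1 R2 \<epsilon> f1 f2 g1 g2"
proof -
  \<comment> \<open>Encoding functions are indexed from 1, list positions from 0.\<close>
  let ?f1 = "\<lambda>i m s. enc m s ! (i - 1)" and ?f2 = "\<lambda>i m. cb m ! (i - 1)"
  have nth: "map (\<lambda>i. xs ! (i - 1)) [1..<Suc n] = xs" if "length xs = n" for xs :: "'e list"
    using that by (intro nth_equalityI) (auto simp del: upt_Suc)
  have w1: "word1 n ?f1 m s = enc m s" if "length s = n" for m s
    unfolding word1_def using len(1)[OF that] by (rule nth)
  have w2: "word2 n ?f2 m = cb m" if "m \<in> msgs n R2" for m
    unfolding word2_def using len(2)[OF that] by (rule nth)
  have supp: "length s = n \<and> m2 \<in> msgs n R2" if "(m1, m2, s) \<in> set_pmf (source_pmf pS n R1 R2)" for m1 m2 s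
    using that by (auto simp: source_pmf_def set_replicate_pmf)
  have "pr (source_pmf pS n R1 R2) {(m1, m2, s). b (map2 y1 (word1 n ?f1 m1 s) s) \<noteq> m1}
      = pr (source_pmf pS n R1 R2) {(m1, m2, s). b (map2 y1 (enc m1 s) s) \<noteq> m1}"
    by (rule measure_pmf.finite_measure_eq_AE) (use w1 supp in \<open>force simp: AE_measure_pmf_iff\<close>)+
  moreover have "pr (source_pmf pS n R1 R2) {(m1, m2, s). dec (map2 y2 (word2 n ?f2 m2) (map2 t1 (word1 n ?f1 m1 s) s)) \<noteq> m2}
      = pr (source_pmf pS n R1 R2) {(m1, m2, s). dec (map2 y2 (cb m2) (map2 t1 (enc m1 s) s)) \<noteq> m2}"
    by (rule measure_pmf.finite_measure_eq_AE) (use w1 w2 supp in \<open>force simp: AE_measure_pmf_iff\<close>)+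
  ultimately have "is_code pS y1 t1 y2 n R1 R2 \<epsilon> ?f1 ?f2 b dec"
    unfolding is_code_def using b dec e1 e2 by simp
  then show ?thesis by blast
qed

text \<open>At rate 0 there is exactly one message, so error terms with the factor M - 1 or N - 1
  vanish.\<close>

lemma msgs_minus_one:
  assumes "0 \<le> R"
  shows "real (nat \<lceil>2 powr (real n * R)\<rceil>) - 1 \<le> (if R = 0 then 0 else 2 powr (n * R))"
  using assms of_int_ceiling_le_add_one[of "2 powr (real n * R)"] by simp

text \<open>r is the rate of the T1-codebook. Of each margin 2 \<delta>, one \<delta> absorbs the
  slack of the typicality bounds and the other leaves the decay 2^(-n \<delta>). Conditions
  involving a message rate are imposed only if that rate is nonzero.\<close>

lemma achievable_of_exponents:
  fixes pS :: "'s::finite pmf" and pQ :: "'q::finite pmf" and k :: "'q \<Rightarrow> 's \<Rightarrow> 'x1::finite pmf" and p :: "'q \<Rightarrow> 'x2::finite pmf"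
    and y1 :: "'x1 \<Rightarrow> 's \<Rightarrow> 'y1" and t1 :: "'x1 \<Rightarrow> 's \<Rightarrow> 't1" and y2 :: "'x2 \<Rightarrow> 't1 \<Rightarrow> 'y2"
    and \<delta> r R1 R2 :: real
  defines "K \<equiv> \<lambda>q. input_pmf pS (k q) (p q)"
    and "S \<equiv> \<lambda>(s :: 's, x1 :: 'x1, x2 :: 'x2). s" and "T \<equiv> \<lambda>(s :: 's, x1 :: 'x1, x2 :: 'x2). t1 x1 s"
    and "Y \<equiv> \<lambda>(s :: 's, x1 :: 'x1, x2 :: 'x2). y1 x1 s" and "Z \<equiv> \<lambda>(s :: 's, x1 :: 'x1, x2 :: 'x2). y2 x2 (t1 x1 s)"
  defines "J \<equiv> bind_pmf pQ (\<lambda>q. map_pmf (Pair q) (input_pmf pS (k q) (p q)))"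
  defines "f0 \<equiv> \<lambda>z. log_mass K (\<lambda>w. (S w, Y w)) z - log_mass K S z"
    and "f1 \<equiv> \<lambda>z. log_mass K (\<lambda>w. (S w, T w)) z - log_mass K S z - log_mass K T z"
    and "f2 \<equiv> \<lambda>z. log_mass K (\<lambda>w. (S w, T w, Y w)) z - log_mass K S z - log_mass K T z"
    and "f3 \<equiv> \<lambda>z. log_mass K (\<lambda>w. (T w, Z w)) z - log_mass K T z"
    and "f4 \<equiv> log_mass K Z"
  assumes \<delta>: "0 < \<delta>" and r: "0 \<le> r" and R: "0 \<le> R1" "0 \<le> R2"
    and c0: "R1 \<noteq> 0 \<Longrightarrow> R1 + expect J f0 + 2 * \<delta> \<le> 0" and c1: "expect J f1 + 2 * \<delta> \<le> r"
    and c2: "R1 \<noteq> 0 \<Longrightarrow> R1 + expect J f2 + 2 * \<delta> \<le> r" and c3: "R2 \<noteq> 0 \<Longrightarrow> R2 + expect J f3 + 2 * \<delta> \<le> 0"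
    and c4: "R2 \<noteq> 0 \<Longrightarrow> R2 + r + expect J f4 + 2 * \<delta> \<le> 0"
  shows "achievable pS y1 t1 y2 (R1, R2)"
  unfolding achievable_def split
proof (intro conjI R allI impI)
  fix \<epsilon> :: real assume \<epsilon>: "0 < \<epsilon>"
  let ?C = "\<Sum>f\<in>{f0, f1, f2, f3, f4}. expect J (\<lambda>z. (f z - expect J f)\<^sup>2)"
  define u where "u = 2 powr (- \<delta>)"
  have u: "0 < u" "u < 1" using \<delta> by (auto simp: u_def powr_less_one)
  have pw: "2 powr (- (real n * \<delta>)) = u ^ n" for n
    by (simp add: u_def powr_realpow[symmetric] powr_powr mult.commute)
  \<comment> \<open>The first summand is Chebyshev's bound. Under the root stand three terms of size
    at most u^n; packing gives u^n + 2 u^n, the 2 coming from rounding up L.\<close>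
  let ?bd = "\<lambda>n. 5 * (?C / (real n * \<delta>\<^sup>2)) + 2 * sqrt (3 * u ^ n) + 3 * u ^ n"
  have "?bd \<longlonglongrightarrow> 5 * (?C / \<delta>\<^sup>2 * 0) + 2 * sqrt (3 * 0) + 3 * 0"
  proof (intro tendsto_intros LIMSEQ_power_zero)
    have "(\<lambda>n. ?C / \<delta>\<^sup>2 * (1 / real n)) \<longlonglongrightarrow> ?C / \<delta>\<^sup>2 * 0"
      by (intro tendsto_intros lim_1_over_n)
    then show "(\<lambda>n. ?C / (real n * \<delta>\<^sup>2)) \<longlonglongrightarrow> ?C / \<delta>\<^sup>2 * 0" by (simp add: mult.commute)
  qed (use u in auto)
  then have "\<forall>\<^sub>F n in sequentially. ?bd n < \<epsilon>"
    by (rule order_tendstoD) (use \<epsilon> in simp)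
  moreover have "\<forall>\<^sub>F n in sequentially. 0 < (n :: nat)" by (rule eventually_gt_at_top)
  ultimately show "\<forall>\<^sub>F n in sequentially. \<exists>f1 f2 g1 g2. is_code pS y1 t1 y2 n R1 R2 \<epsilon> f1 f2 g1 g2"
  proof eventually_elim
    case (elim n)
    define L where "L = nat \<lceil>2 powr (real n * r)\<rceil>"
    define M where "M = nat \<lceil>2 powr (real n * R1)\<rceil>"
    define N where "N = nat \<lceil>2 powr (real n * R2)\<rceil>"
    have msgs: "msgs n R1 = {1..M}" "msgs n R2 = {1..N}" by (simp_all add: msgs_def M_def N_def)
    have pos: "0 < L" "0 < M" "0 < N" by (simp_all add: L_def M_def N_def)
    have M1: "real M - 1 \<le> (if R1 = 0 then 0 else 2 powr (n * R1))"
      and N1: "real N - 1 \<le> (if R2 = 0 then 0 else 2 powr (n * R2))"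
      unfolding M_def N_def using R by (intro msgs_minus_one; simp)+
    have L1: "2 powr (n * r) \<le> L" "real L \<le> 2 * 2 powr (n * r)"
      using card_msgs(1)[of n r] card_msgs(2)[OF r, of n] by (simp_all add: msgs_def L_def powr_add)
    let ?ex = "\<lambda>f. 2 powr (n * (expect J f + \<delta>))"
    let ?pe = "?C / (real n * \<delta>\<^sup>2)"
    have powr_le: "2 powr a \<le> u ^ n" if "a \<le> - (real n * \<delta>)" for a
      unfolding pw[symmetric] using that by simp
    have nle: "real n * a \<le> - (real n * \<delta>)" if "a + \<delta> \<le> 0" for a
      using mult_left_mono[OF that, of "real n"] by (simp add: algebra_simps)
    have u0: "0 \<le> u ^ n" using u by simp
    have t0: "(real M - 1) * ?ex f0 \<le> u ^ n"
    proof (cases "R1 = 0")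
      case False
      have "(real M - 1) * ?ex f0 \<le> 2 powr (n * R1) * ?ex f0"
        using M1 False by (intro mult_right_mono) auto
      also have "\<dots> = 2 powr (n * (R1 + (expect J f0 + \<delta>)))" by (simp add: powr_add[symmetric] algebra_simps)
      also have "\<dots> \<le> u ^ n" using c0[OF False] by (intro powr_le nle) simp
      finally show ?thesis .
    next
      case True
      then have "real M - 1 = 0" using M1 pos by simp
      then show ?thesis using u0 by simp
    qed
    have t1: "?ex f1 / L \<le> u ^ n"
    proof -
      have "?ex f1 / L \<le> ?ex f1 / 2 powr (n * r)"
        by (rule divide_left_mono[OF L1(1)]) (use pos M1 in auto)
      also have "\<dots> = 2 powr (n * (expect J f1 + \<delta> - r))" by (simp add: powr_diff[symmetric] algebra_simps)
      also have "\<dots> \<le> u ^ n" using c1 by (intro powr_le nle) simp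
      finally show ?thesis .
    qed
    have t2: "(real M - 1) * ?ex f2 / L \<le> u ^ n"
    proof (cases "R1 = 0")
      case False
      have "(real M - 1) * ?ex f2 / L \<le> (2 powr (n * R1) * ?ex f2) / L"
        using M1 False by (intro divide_right_mono mult_right_mono) auto
      also have "\<dots> \<le> (2 powr (n * R1) * ?ex f2) / 2 powr (n * r)"
        by (rule divide_left_mono[OF L1(1)]) (use pos M1 in auto)
      also have "\<dots> = 2 powr (n * (R1 + (expect J f2 + \<delta>) - r))"
        by (simp add: powr_add[symmetric] powr_diff[symmetric] algebra_simps)
      also have "\<dots> \<le> u ^ n" using c2[OF False] by (intro powr_le nle) simp
      finally show ?thesis .
    next
      case True
      then have "real M - 1 = 0" using M1 pos by simp
      then show ?thesis using u0 by simp
    qed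
    have t3: "(real N - 1) * (?ex f3 + L * ?ex f4) \<le> 3 * u ^ n"
    proof (cases "R2 = 0")
      case False
      have "(real N - 1) * (?ex f3 + L * ?ex f4) \<le> 2 powr (n * R2) * (?ex f3 + (2 * 2 powr (n * r)) * ?ex f4)"
        using N1 False L1(2) by (intro mult_mono add_mono) auto
      also have "\<dots> = 2 powr (n * (R2 + (expect J f3 + \<delta>))) + 2 * 2 powr (n * (R2 + r + (expect J f4 + \<delta>)))"
        by (simp add: powr_add algebra_simps)
      also have "\<dots> \<le> u ^ n + 2 * u ^ n"
        using c3[OF False] c4[OF False] by (intro add_mono mult_left_mono powr_le nle) simp_all
      finally show ?thesis by simp
    next
      case True
      then have "real N - 1 = 0" using N1 pos by simp
      then show ?thesis using u0 by simp
    qed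
    have "5 * ?pe + 2 * sqrt ((real M - 1) * ?ex f0 + ?ex f1 / L + (real M - 1) * ?ex f2 / L) + (real N - 1) * (?ex f3 + L * ?ex f4) \<le> ?bd n"
      using t0 t1 t2 t3 by (intro add_mono mult_left_mono real_sqrt_le_mono) auto
    then have bound: "5 * ?pe + 2 * sqrt ((real M - 1) * ?ex f0 + ?ex f1 / L + (real M - 1) * ?ex f2 / L) + (real N - 1) * (?ex f3 + L * ?ex f4) \<le> \<epsilon>"
      using elim(1) by linarith
    let ?U = "pair_pmf (pmf_of_set {1..M}) (pair_pmf (pmf_of_set {1..N}) (replicate_pmf n pS))"
    obtain enc :: "nat \<Rightarrow> 's list \<Rightarrow> 'x1 list" and cb :: "nat \<Rightarrow> 'x2 list" and b :: "'y1 list \<Rightarrow> nat" and dec :: "'y2 list \<Rightarrow> nat"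
      where code: "\<And>ys. b ys \<in> {1..M}" "\<And>zs. dec zs \<in> {1..N}"
        "\<And>m s. length s = n \<Longrightarrow> length (enc m s) = n" "\<And>m. m \<in> {1..N} \<Longrightarrow> length (cb m) = n"
        and err: "pr ?U {(m1, m2, s). b (map2 y1 (enc m1 s) s) \<noteq> m1} \<le> \<epsilon>"
        "pr ?U {(m1, m2, s). dec (map2 y2 (cb m2) (map2 t1 (enc m1 s) s)) \<noteq> m2} \<le> \<epsilon>"
    proof (rule block_code_exists[where L = L and M = M and N = N and n = n and \<delta> = \<delta> and pS = pS and pQ = pQ
          and k = k and p = p and ?y1.0 = y1 and ?t1.0 = t1 and ?y2.0 = y2, folded K_def S_def T_def Y_def Z_def,
          folded f0_def f1_def f2_def f3_def f4_def J_def, OF pos elim(2) \<delta>])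
      fix enc :: "nat \<Rightarrow> 's list \<Rightarrow> 'x1 list" and cb :: "nat \<Rightarrow> 'x2 list" and b :: "'y1 list \<Rightarrow> nat" and dec :: "'y2 list \<Rightarrow> nat"
      assume "\<And>ys. b ys \<in> {1..M}" "\<And>zs. dec zs \<in> {1..N}"
        "\<And>m s. length s = n \<Longrightarrow> length (enc m s) = n" "\<And>m. m \<in> {1..N} \<Longrightarrow> length (cb m) = n"
        "pr ?U {(m1, m2, s). b (map2 y1 (enc m1 s) s) \<noteq> m1}
          \<le> 5 * ?pe + 2 * sqrt ((real M - 1) * ?ex f0 + ?ex f1 / L + (real M - 1) * ?ex f2 / L) + (real N - 1) * (?ex f3 + L * ?ex f4)"
        "pr ?U {(m1, m2, s). dec (map2 y2 (cb m2) (map2 t1 (enc m1 s) s)) \<noteq> m2}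
          \<le> 5 * ?pe + 2 * sqrt ((real M - 1) * ?ex f0 + ?ex f1 / L + (real M - 1) * ?ex f2 / L) + (real N - 1) * (?ex f3 + L * ?ex f4)"
      from that[OF this(1-4) order.trans[OF this(5) bound] order.trans[OF this(6) bound]] show thesis .
    qed
    show ?case
      by (rule is_code_of_words[of b n R1 dec R2 enc cb]) (unfold msgs source_pmf_def, use code err in auto)
  qed
qed

text \<open>Fourier-Motzkin elimination of r: the lower limits I(T1;S|Q) and R1 + I(T1;S|Q) -
  H(Y1|T1,S,Q) lie below the upper limit H(Y2|Q) - R2 by the third and the fourth strict
  bound.\<close>

lemma achievable_of_strict:
  fixes pS :: "'s::finite pmf" and pQ :: "'q::finite pmf" and k :: "'q \<Rightarrow> 's \<Rightarrow> 'x1::finite pmf" and p :: "'q \<Rightarrow> 'x2::finite pmf"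
    and y1 :: "'x1 \<Rightarrow> 's \<Rightarrow> 'y1" and t1 :: "'x1 \<Rightarrow> 's \<Rightarrow> 't1" and y2 :: "'x2 \<Rightarrow> 't1 \<Rightarrow> 'y2"
  assumes v: "(\<Sum>q\<in>UNIV. pmf pQ q *\<^sub>R rate_vec y1 t1 y2 (input_pmf pS (k q) (p q))) = (a, b, c, d)"
    and R: "0 \<le> R1" "0 \<le> R2"
    and strict: "R1 \<noteq> 0 \<Longrightarrow> R1 < a" "R2 \<noteq> 0 \<Longrightarrow> R2 < b" "R2 \<noteq> 0 \<Longrightarrow> R2 < c"
      "R1 \<noteq> 0 \<Longrightarrow> R2 \<noteq> 0 \<Longrightarrow> R1 + R2 < d"
  shows "achievable pS y1 t1 y2 (R1, R2)"
proof -
  define K where "K = (\<lambda>q. input_pmf pS (k q) (p q))"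
  define S where "S = (\<lambda>(s :: 's, x1 :: 'x1, x2 :: 'x2). s)"
  define T where "T = (\<lambda>(s :: 's, x1 :: 'x1, x2 :: 'x2). t1 x1 s)"
  define Y where "Y = (\<lambda>(s :: 's, x1 :: 'x1, x2 :: 'x2). y1 x1 s)"
  define Z where "Z = (\<lambda>(s :: 's, x1 :: 'x1, x2 :: 'x2). y2 x2 (t1 x1 s))"
  define J where "J = bind_pmf pQ (\<lambda>q. map_pmf (Pair q) (K q))"
  define f0 where "f0 = (\<lambda>z. log_mass K (\<lambda>w. (S w, Y w)) z - log_mass K S z)"
  define f1 where "f1 = (\<lambda>z. log_mass K (\<lambda>w. (S w, T w)) z - log_mass K S z - log_mass K T z)"
  define f2 where "f2 = (\<lambda>z. log_mass K (\<lambda>w. (S w, T w, Y w)) z - log_mass K S z - log_mass K T z)"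
  define f3 where "f3 = (\<lambda>z. log_mass K (\<lambda>w. (T w, Z w)) z - log_mass K T z)"
  define f4 where "f4 = log_mass K Z"
  have finJ: "finite (set_pmf J)" by simp
  have lm: "expect J (log_mass K F) = - (\<Sum>q\<in>UNIV. pmf pQ q * ent (K q) F)" for F :: "'s \<times> 'x1 \<times> 'x2 \<Rightarrow> 'e"
    unfolding J_def by (subst expect_log_mass) (simp_all add: integral_measure_pmf_real[where A = UNIV] mult.commute)
  have swap2: "ent (K q) (\<lambda>w. (A w, B w)) = ent (K q) (\<lambda>w. (B w, A w))"
    for q and A :: "'s \<times> 'x1 \<times> 'x2 \<Rightarrow> 'e" and B :: "'s \<times> 'x1 \<times> 'x2 \<Rightarrow> 'f"
    by (rule ent_eq_of_function[where f = "\<lambda>(a, b). (b, a)" and g = "\<lambda>(a, b). (b, a)"]) auto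
  have swap3: "ent (K q) (\<lambda>w. (S w, T w, Y w)) = ent (K q) (\<lambda>w. (Y w, T w, S w))" for q
    by (rule ent_eq_of_function[where f = "\<lambda>(a, b, c). (c, b, a)" and g = "\<lambda>(a, b, c). (c, b, a)"]) auto
  let ?m = "\<lambda>F. \<Sum>q\<in>UNIV. pmf pQ q * F q"
  have comps: "a = ?m (\<lambda>q. ent (K q) (\<lambda>w. (Y w, S w)) - ent (K q) S)"
    "b = ?m (\<lambda>q. ent (K q) (\<lambda>w. (Z w, T w)) - ent (K q) T)"
    "c = ?m (\<lambda>q. ent (K q) Z - (ent (K q) T + ent (K q) S - ent (K q) (\<lambda>w. (T w, S w))))"
    "d = ?m (\<lambda>q. ent (K q) (\<lambda>w. (Y w, T w, S w)) - ent (K q) (\<lambda>w. (T w, S w)) + ent (K q) Z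
        - (ent (K q) T + ent (K q) S - ent (K q) (\<lambda>w. (T w, S w))))"
    using v[symmetric]
    by (simp_all add: prod_eq_iff fst_sum snd_sum rate_vec_def Let_def cent_def K_def S_def T_def Y_def Z_def case_prod_unfold)
  have E: "expect J f0 = - a" "expect J f3 = - b" "expect J f4 = - (c + expect J f1)" "expect J f2 = expect J f1 - (d - c)"
    "expect J f1 = ?m (\<lambda>q. ent (K q) T + ent (K q) S - ent (K q) (\<lambda>w. (T w, S w)))"
    unfolding f0_def f1_def f2_def f3_def f4_def comps expect_diff[OF finJ] lm swap2[of _ S Y] swap2[of _ T Z] swap2[of _ S T] swap3
    by (simp_all add: sum.distrib sum_subtractf algebra_simps)
  \<comment> \<open>Mutual information is nonnegative, so every r above the lower limits is a
    legitimate rate.\<close>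
  have I0: "0 \<le> expect J f1"
    unfolding E(5) by (intro sum_nonneg mult_nonneg_nonneg) (simp_all add: ent_pair_le)
  define lo where "lo = (if R1 = 0 then expect J f1 else max (expect J f1) (R1 + expect J f2))"
  \<comment> \<open>The midpoint between the limits, H(Y2|Q) - R2 being
    \<open>c + expect J f1 - R2\<close>. For R2 = 0 there is no upper limit.\<close>
  define r where "r = (if R2 = 0 then lo + 1 else (lo + (c + expect J f1 - R2)) / 2)"
  have lo: "expect J f1 \<le> lo" "R1 \<noteq> 0 \<Longrightarrow> R1 + expect J f2 \<le> lo" by (auto simp: lo_def)
  have lor: "lo < r" and rhi: "R2 \<noteq> 0 \<Longrightarrow> r < c + expect J f1 - R2"
    using strict(3,4) E(4) by (auto simp: r_def lo_def field_simps)
  have r0: "0 \<le> r" using I0 lo(1) lor by linarith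
  \<comment> \<open>Half of the smallest slack; a condition that is not imposed contributes the
    value 1.\<close>
  define \<delta> where "\<delta> = Min {r - lo, if R1 = 0 then 1 else a - R1, if R2 = 0 then 1 else b - R2,
      if R2 = 0 then 1 else c + expect J f1 - R2 - r} / 2"
  have \<delta>: "0 < \<delta>" unfolding \<delta>_def using lor rhi strict by auto
  have \<delta>2: "2 * \<delta> \<le> r - lo" "R1 \<noteq> 0 \<Longrightarrow> 2 * \<delta> \<le> a - R1" "R2 \<noteq> 0 \<Longrightarrow> 2 * \<delta> \<le> b - R2"
    "R2 \<noteq> 0 \<Longrightarrow> 2 * \<delta> \<le> c + expect J f1 - R2 - r"
    unfolding \<delta>_def by simp_all
  show ?thesis
  proof (rule achievable_of_exponents[where \<delta> = \<delta> and r = r and pQ = pQ and k = k and p = p and pS = pS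
        and ?y1.0 = y1 and ?t1.0 = t1 and ?y2.0 = y2,
        folded K_def S_def T_def Y_def Z_def, folded J_def[unfolded K_def] f0_def f1_def f2_def f3_def f4_def,
        OF \<delta> r0 R])
    show "R1 + expect J f0 + 2 * \<delta> \<le> 0" if "R1 \<noteq> 0" using \<delta>2(2)[OF that] E by linarith
    show "expect J f1 + 2 * \<delta> \<le> r" using \<delta>2(1) lo by linarith
    show "R1 + expect J f2 + 2 * \<delta> \<le> r" if "R1 \<noteq> 0" using \<delta>2(1) lo(2)[OF that] by linarith
    show "R2 + expect J f3 + 2 * \<delta> \<le> 0" if "R2 \<noteq> 0" using \<delta>2(3)[OF that] E by linarith
    show "R2 + r + expect J f4 + 2 * \<delta> \<le> 0" if "R2 \<noteq> 0" using \<delta>2(4)[OF that] E by linarith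
  qed
qed

text \<open>Lowering both coordinates by e/4, with truncation at 0, makes the bounds strict for
  every coordinate that stays positive; a coordinate equal to 0 requires no strictness. The new pair
  is within e of R.\<close>

lemma rate_region_in_capacity_region:
  fixes pS :: "'s::finite pmf"
    and y1 :: "'x1::finite \<Rightarrow> 's \<Rightarrow> 'y1::finite"
    and t1 :: "'x1 \<Rightarrow> 's \<Rightarrow> 't1::finite"
    and y2 :: "'x2::finite \<Rightarrow> 't1 \<Rightarrow> 'y2::finite"
  assumes "R \<in> rate_region pS y1 t1 y2"
  shows "R \<in> capacity_region pS y1 t1 y2"
  unfolding capacity_region_def closure_approachable
proof (intro allI impI)
  fix e :: real assume e: "0 < e"
  obtain R1 R2 where R: "R = (R1, R2)" by (cases R)
  obtain pQ :: "4 pmf" and k p where R0: "0 \<le> R1" "0 \<le> R2"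
    and m: "meets (R1, R2) (\<Sum>q\<in>UNIV. pmf pQ q *\<^sub>R rate_vec y1 t1 y2 (input_pmf pS (k q) (p q)))"
    using assms unfolding R rate_region_iff by blast
  obtain a b c d where v: "(\<Sum>q\<in>UNIV. pmf pQ q *\<^sub>R rate_vec y1 t1 y2 (input_pmf pS (k q) (p q))) = (a, b, c, d)"
    by (rule prod_cases4)
  have le: "R1 \<le> a" "R2 \<le> b" "R2 \<le> c" "R1 + R2 \<le> d" using m unfolding v by (simp_all add: meets_def)
  define S1 where "S1 = max 0 (R1 - e / 4)"
  define S2 where "S2 = max 0 (R2 - e / 4)"
  have "achievable pS y1 t1 y2 (S1, S2)"
    by (rule achievable_of_strict[OF v]) (use le e R0 in \<open>auto simp: S1_def S2_def max_def split: if_splits\<close>)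
  moreover have "dist (S1, S2) R < e"
  proof -
    have "dist (S1, S2) R \<le> \<bar>S1 - R1\<bar> + \<bar>S2 - R2\<bar>"
      unfolding R dist_Pair_Pair dist_real_def using sqrt_sum_squares_le_sum_abs[of "\<bar>S1 - R1\<bar>" "\<bar>S2 - R2\<bar>"] by simp
    also have "\<dots> < e" using e R0 by (auto simp: S1_def S2_def max_def)
    finally show ?thesis .
  qed
  ultimately show "\<exists>y\<in>{R. achievable pS y1 t1 y2 R}. dist y R < e" by blast
qed

theorem theorem3:
  fixes pS :: "'s::finite pmf"
    and y1 :: "'x1::finite \<Rightarrow> 's \<Rightarrow> 'y1::finite"
    and t1 :: "'x1 \<Rightarrow> 's \<Rightarrow> 't1::finite"
    and y2 :: "'x2::finite \<Rightarrow> 't1 \<Rightarrow> 'y2::finite"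
  assumes injective: "\<And>x2. inj (y2 x2)"
  shows "capacity_region pS y1 t1 y2 = rate_region pS y1 t1 y2"
proof
  show "rate_region pS y1 t1 y2 \<subseteq> capacity_region pS y1 t1 y2"
    using rate_region_in_capacity_region by blast
  show "capacity_region pS y1 t1 y2 \<subseteq> rate_region pS y1 t1 y2"
    unfolding capacity_region_def
  proof (rule closure_minimal[OF _ closed_rate_region], rule subsetI)
    fix R assume "R \<in> {R. achievable pS y1 t1 y2 R}"
    then show "R \<in> rate_region pS y1 t1 y2"
      using achievable_in_rate_region[of y2 pS y1 t1 R] injective by simp
  qed
qed

end
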